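(* Let $(X,d)$ be a separable metric space. The following statements are equivalent. (i) The space $(X,d)$ is isometrically embeddable in a Hilbert space. (ii) For some Borel probability measure $\mu$ on $X$ with full support and finite $4$-th moment, one has $s_-(T_\mu)=0$, i.e. $T_\mu$ is positive semidefinite. (iii) For every Borel probability measure $\mu$ on $X$, one has $s_-(T_\mu)=0$. In case (ii), for an isometric embedding of $X$ in $\ell^2$ one may take the map $f\colon X\to\ell^2$ defined by $$f(x):=\left(\sqrt{\lambda_i}\,u_i(x)\right)_i,$$ where $\lambda_i\in\mathbb R$ are the strictly positive eigenvalues (counting multiplicities) and $u_i\in L^2(X,\mu)$ the respective eigenfunctions of the operator $T_\mu\colon L^2(X,\mu)\to L^2(X,\mu)$, normalized so that $\|u_i\|_2=1$ for all $i$. In all these cases, one necessarily has $s_-(X,d)=1$.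
   Context: For a real symmetric matrix or a linear operator $A$, $s_+(A)$ and $s_-(A)$ denote the numbers (possibly $+\infty$) of its strictly positive, respectively strictly negative, eigenvalues, counted with multiplicity. For a finite subset $X_N=\{x_1,\dots,x_N\}$ of a metric space $(X,d)$, $S(X_N):=\left(-\tfrac12 d^2(x_i,x_j)\right)_{i,j=1}^N$, and $$s_\pm(X,d):=\sup\{s_\pm(S(X_N)) : X_N\subset X \text{ finite}\}.$$ A Borel probability measure $\mu$ on $X$ has full support if $\operatorname{supp}\mu=X$, and finite $4$-th moment if $\int_X d^4(x_0,y)\,d\mu(y)<+\infty$ for some (hence all) $x_0\in X$. The linear operators $K_\mu,T_\mu$ on $L^2(X,\mu)$ are defined by $$(K_\mu u)(x):=-\frac12\int_X d^2(x,y)u(y)\,d\mu(y),\qquad T_\mu:=P_\mu K_\mu P_\mu,$$ where $P_\mu$ is the orthogonal projector of $L^2(X,\mu)$ onto the orthogonal complement of the constant function $\mathbf 1$. If $\mu$ has finite $4$-th moment, both are self-adjoint Hilbert–Schmidt operators over the whole of $L^2(X,\mu)$; if the $4$-th moment is infinite, their domains are not all of $L^2(X,\mu)$. One has $(T_\mu f)(x)=\int_X k_T(x,y)f(y)\,d\mu(y)$ with $$k_T(x,y)=k(x,y)-\int_X k(x,y')\,d\mu(y')-\int_X k(x',y)\,d\mu(x')+\int_X\int_X k(x',y')\,d\mu(x')\,d\mu(y'),\quad k(x,y):=-\tfrac12 d^2(x,y).$$ The norm $\|\cdot\|_2$ is that of $L^2(X,\mu)$. In the definition of $f$, the eigenfunctions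 are chosen mutually orthogonal and are understood as their continuous representatives, given pointwise by $u(x)=\lambda^{-1}\int_X k_T(x,y)u(y)\,d\mu(y)$; if there are only finitely many $\lambda_i$, the sequence $f(x)$ is completed by zeros.
   Formalization: The space X is taken to be non-empty (on the empty space (i) and (iii) hold but (ii) fails), and the final claim s_-(X,d)=1 is stated only for X with at least two points, since a one-point space has s_-(X,d)=0. *)

theory Defs
  imports
    "HOL-Probability.Probability"
    "Jordan_Normal_Form.Matrix_Kernel"
    "Jordan_Normal_Form.Char_Poly"
begin

section \<open>The Hilbert space of square summable real sequences\<close>

typedef ell2 = "{a :: nat \<Rightarrow> real. summable (\<lambda>i. (a i)\<^sup>2)}"
  morphisms coord Abs_ell2
  by (rule exI[of _ "\<lambda>_. 0"]) simp

setup_lifting type_definition_ell2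

lemma summable_prod_ell2:
  fixes a b :: "nat \<Rightarrow> real"
  assumes "summable (\<lambda>i. (a i)\<^sup>2)" "summable (\<lambda>i. (b i)\<^sup>2)"
  shows "summable (\<lambda>i. a i * b i)"
proof (rule summable_comparison_test'[where N = 0])
  show "summable (\<lambda>i. (a i)\<^sup>2 + (b i)\<^sup>2)"
    using assms by (rule summable_add)
  show "norm (a n * b n) \<le> (a n)\<^sup>2 + (b n)\<^sup>2" for n
  proof -
    have "2 * (\<bar>a n\<bar> * \<bar>b n\<bar>) \<le> \<bar>a n\<bar>\<^sup>2 + \<bar>b n\<bar>\<^sup>2"
      using sum_squares_bound[of "\<bar>a n\<bar>" "\<bar>b n\<bar>"] by (simp add: mult.assoc)
    moreover have "0 \<le> \<bar>a n\<bar> * \<bar>b n\<bar>" by simp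
    ultimately have "\<bar>a n\<bar> * \<bar>b n\<bar> \<le> \<bar>a n\<bar>\<^sup>2 + \<bar>b n\<bar>\<^sup>2" by linarith
    thus ?thesis by (simp add: abs_mult)
  qed
qed

lemma summable_add_ell2:
  fixes a b :: "nat \<Rightarrow> real"
  assumes "summable (\<lambda>i. (a i)\<^sup>2)" "summable (\<lambda>i. (b i)\<^sup>2)"
  shows "summable (\<lambda>i. (a i + b i)\<^sup>2)"
proof -
  have "summable (\<lambda>i. (a i)\<^sup>2 + (b i)\<^sup>2 + 2 * (a i * b i))"
    using assms by (intro summable_add summable_mult summable_prod_ell2)
  thus ?thesis by (simp add: power2_sum mult.assoc)
qed

lemma summable_scale_ell2:
  fixes a :: "nat \<Rightarrow> real"
  assumes "summable (\<lambda>i. (a i)\<^sup>2)"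
  shows "summable (\<lambda>i. (c * a i)\<^sup>2)"
  using summable_mult[OF assms, of "c\<^sup>2"] by (simp add: power_mult_distrib)

lemma summable_diff_ell2:
  fixes a b :: "nat \<Rightarrow> real"
  assumes "summable (\<lambda>i. (a i)\<^sup>2)" "summable (\<lambda>i. (b i)\<^sup>2)"
  shows "summable (\<lambda>i. (a i - b i)\<^sup>2)"
  using summable_add_ell2[OF assms(1) summable_scale_ell2[OF assms(2), of "-1"]] by simp

lemma summable_coord: "summable (\<lambda>i. (coord x i)\<^sup>2)"
  using coord[of x] by simp

lemma summable_coord_prod: "summable (\<lambda>i. coord x i * coord y i)"
  by (intro summable_prod_ell2 summable_coord)

instantiation ell2 :: real_inner
begin

lift_definition zero_ell2 :: ell2 is "\<lambda>_. 0" by simp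
lift_definition plus_ell2 :: "ell2 \<Rightarrow> ell2 \<Rightarrow> ell2" is "\<lambda>a b i. a i + b i"
  by (rule summable_add_ell2)
lift_definition minus_ell2 :: "ell2 \<Rightarrow> ell2 \<Rightarrow> ell2" is "\<lambda>a b i. a i - b i"
  by (rule summable_diff_ell2)
lift_definition uminus_ell2 :: "ell2 \<Rightarrow> ell2" is "\<lambda>a i. - a i" by simp
lift_definition scaleR_ell2 :: "real \<Rightarrow> ell2 \<Rightarrow> ell2" is "\<lambda>c a i. c * a i"
  by (rule summable_scale_ell2)
definition inner_ell2 :: "ell2 \<Rightarrow> ell2 \<Rightarrow> real" where
  "inner_ell2 x y = (\<Sum>i. coord x i * coord y i)"
definition norm_ell2 :: "ell2 \<Rightarrow> real" where
  "norm_ell2 x = sqrt (inner x x)"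
definition sgn_ell2 :: "ell2 \<Rightarrow> ell2" where
  "sgn_ell2 x = inverse (norm x) *\<^sub>R x"
definition dist_ell2 :: "ell2 \<Rightarrow> ell2 \<Rightarrow> real" where
  "dist_ell2 x y = norm (x - y)"
definition uniformity_ell2 :: "(ell2 \<times> ell2) filter" where
  "uniformity_ell2 = (INF e\<in>{0<..}. principal {(x, y). dist x y < e})"
definition open_ell2 :: "ell2 set \<Rightarrow> bool" where
  "open_ell2 U = (\<forall>x\<in>U. eventually (\<lambda>(x', y). x' = x \<longrightarrow> y \<in> U) uniformity)"

instance
proof
  fix x y z :: ell2 and a b :: real
  show "x + y + z = x + (y + z)" by transfer (simp add: add.assoc)
  show "x + y = y + x" by transfer (simp add: add.commute)
  show "0 + x = x" by transfer simp
  show "- x + x = 0" by transfer simp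
  show "x - y = x + - y" by transfer simp
  show "a *\<^sub>R (x + y) = a *\<^sub>R x + a *\<^sub>R y" by transfer (simp add: algebra_simps)
  show "(a + b) *\<^sub>R x = a *\<^sub>R x + b *\<^sub>R x" by transfer (simp add: algebra_simps)
  show "a *\<^sub>R b *\<^sub>R x = (a * b) *\<^sub>R x" by transfer (simp add: algebra_simps)
  show "1 *\<^sub>R x = x" by transfer simp
  show "inner x y = inner y x" by (simp add: inner_ell2_def mult.commute)
  show "inner (x + y) z = inner x z + inner y z"
    by (simp add: inner_ell2_def plus_ell2.rep_eq distrib_right
        suminf_add[OF summable_coord_prod summable_coord_prod])
  show "inner (a *\<^sub>R x) y = a * inner x y"
    by (simp add: inner_ell2_def scaleR_ell2.rep_eq mult.assoc
        suminf_mult[OF summable_coord_prod])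
  show "0 \<le> inner x x"
    by (simp add: inner_ell2_def suminf_nonneg summable_coord_prod)
  show "(inner x x = 0) = (x = 0)"
  proof -
    have "(inner x x = 0) = (\<forall>i. coord x i * coord x i = 0)"
      unfolding inner_ell2_def by (rule suminf_eq_zero_iff) (simp_all add: summable_coord_prod)
    also have "\<dots> = (x = 0)"
      by (simp add: coord_inject[symmetric] zero_ell2.rep_eq fun_eq_iff)
    finally show ?thesis .
  qed
qed (simp_all add: norm_ell2_def sgn_ell2_def dist_ell2_def uniformity_ell2_def open_ell2_def)

end

lemma norm_ell2_power2: "(norm x)\<^sup>2 = (\<Sum>i. (coord x i)\<^sup>2)" for x :: ell2
  unfolding power2_norm_eq_inner inner_ell2_def by (simp add: power2_eq_square)

lemma sum_coord_le_norm: "(\<Sum>i<k. (coord x i)\<^sup>2) \<le> (norm x)\<^sup>2" for x :: ell2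
  unfolding norm_ell2_power2 by (intro sum_le_suminf summable_coord) auto

lemma abs_coord_le_norm: "\<bar>coord x i\<bar> \<le> norm x" for x :: ell2
proof (rule power2_le_imp_le)
  have "(coord x i)\<^sup>2 \<le> (\<Sum>j<Suc i. (coord x j)\<^sup>2)" by (simp add: sum_nonneg)
  thus "\<bar>coord x i\<bar>\<^sup>2 \<le> (norm x)\<^sup>2" using sum_coord_le_norm[of x "Suc i"] by simp
qed simp

instance ell2 :: complete_space
proof
  fix X :: "nat \<Rightarrow> ell2"
  assume X: "Cauchy X"
  have "convergent (\<lambda>n. coord (X n) i)" for i
  proof -
    have "Cauchy (\<lambda>n. coord (X n) i)"
    proof (rule metric_CauchyI)
      fix e :: real assume "e > 0"
      then obtain M where M: "\<And>m n. m \<ge> M \<Longrightarrow> n \<ge> M \<Longrightarrow> dist (X m) (X n) < e"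
        using metric_CauchyD[OF X] by blast
      have "dist (coord (X m) i) (coord (X n) i) < e" if "m \<ge> M" "n \<ge> M" for m n
        using abs_coord_le_norm[of "X m - X n" i] M[OF that]
        by (simp add: dist_norm minus_ell2.rep_eq)
      thus "\<exists>M. \<forall>m\<ge>M. \<forall>n\<ge>M. dist (coord (X m) i) (coord (X n) i) < e" by blast
    qed
    thus ?thesis by (simp add: Cauchy_convergent_iff)
  qed
  then obtain a where a: "\<And>i. (\<lambda>n. coord (X n) i) \<longlonglongrightarrow> a i"
    unfolding convergent_def by metis
  have key: "\<exists>M. \<forall>m\<ge>M. \<forall>k. (\<Sum>i<k. (coord (X m) i - a i)\<^sup>2) \<le> e\<^sup>2" if "e > 0" for e :: real
  proof -
    obtain M where M: "\<And>m n. m \<ge> M \<Longrightarrow> n \<ge> M \<Longrightarrow> dist (X m) (X n) < e"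
      using metric_CauchyD[OF X \<open>e > 0\<close>] by blast
    have "(\<Sum>i<k. (coord (X m) i - a i)\<^sup>2) \<le> e\<^sup>2" if m: "m \<ge> M" for m k
    proof (rule LIMSEQ_le_const2)
      show "(\<lambda>n. \<Sum>i<k. (coord (X m) i - coord (X n) i)\<^sup>2) \<longlonglongrightarrow> (\<Sum>i<k. (coord (X m) i - a i)\<^sup>2)"
        by (intro tendsto_intros a)
      have "(\<Sum>i<k. (coord (X m) i - coord (X n) i)\<^sup>2) \<le> e\<^sup>2" if n: "n \<ge> M" for n
      proof -
        have "(\<Sum>i<k. (coord (X m) i - coord (X n) i)\<^sup>2) \<le> (norm (X m - X n))\<^sup>2"
          using sum_coord_le_norm[of "X m - X n" k] by (simp add: minus_ell2.rep_eq)
        also have "\<dots> \<le> e\<^sup>2"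
          using M[OF m n] by (intro power_mono) (simp_all add: dist_norm)
        finally show ?thesis .
      qed
      thus "\<exists>N. \<forall>n\<ge>N. (\<Sum>i<k. (coord (X m) i - coord (X n) i)\<^sup>2) \<le> e\<^sup>2" by blast
    qed
    thus ?thesis by blast
  qed
  obtain M where M: "\<And>k. (\<Sum>i<k. (coord (X M) i - a i)\<^sup>2) \<le> 1"
    using key[of 1] by auto
  have "summable (\<lambda>i. (coord (X M) i - a i)\<^sup>2)"
    by (rule summableI_nonneg_bounded[where x = 1]) (use M in auto)
  from summable_diff_ell2[OF summable_coord[of "X M"] this]
  have sa: "summable (\<lambda>i. (a i)\<^sup>2)" by simp
  define L where "L = Abs_ell2 a"
  have L: "coord L = a" using sa by (simp add: L_def Abs_ell2_inverse)
  have "X \<longlonglongrightarrow> L"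
  proof (rule metric_LIMSEQ_I)
    fix e :: real assume e: "e > 0"
    then obtain M where M: "\<And>m k. m \<ge> M \<Longrightarrow> (\<Sum>i<k. (coord (X m) i - a i)\<^sup>2) \<le> (e / 2)\<^sup>2"
      using key[of "e / 2"] by auto
    have "dist (X m) L < e" if "m \<ge> M" for m
    proof -
      have "(norm (X m - L))\<^sup>2 \<le> (e / 2)\<^sup>2"
        unfolding norm_ell2_power2
      proof (rule suminf_le_const[OF summable_coord])
        show "(\<Sum>i<k. (coord (X m - L) i)\<^sup>2) \<le> (e / 2)\<^sup>2" for k
          using M[OF that, of k] unfolding minus_ell2.rep_eq L .
      qed
      hence "norm (X m - L) \<le> e / 2" by (rule power2_le_imp_le) (use e in simp)
      thus ?thesis using e by (simp add: dist_norm)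
    qed
    thus "\<exists>M. \<forall>m\<ge>M. dist (X m) L < e" by blast
  qed
  thus "convergent X" by (rule convergentI)
qed


section \<open>Isometric embeddings\<close>

definition isometric_embedding :: "('a::metric_space \<Rightarrow> 'b::metric_space) \<Rightarrow> bool" where
  "isometric_embedding f \<longleftrightarrow> (\<forall>x y. dist (f x) (f y) = dist x y)"


section \<open>Negative eigenvalues of a matrix and the negative signature of a metric space\<close>

text \<open>Each negative eigenvalue is counted with the dimension of its eigenspace; the matrices
  considered are symmetric, so this is also its multiplicity as a root of the characteristic
  polynomial.\<close>

definition s_minus_mat :: "real mat \<Rightarrow> nat" where
  "s_minus_mat A = (\<Sum>r | eigenvalue A r \<and> r < 0. kernel_dim (char_matrix A r))"

definition S_mat :: "'a::metric_space list \<Rightarrow> real mat" where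
  "S_mat xs = mat (length xs) (length xs) (\<lambda>(i, j). - (1/2) * (dist (xs ! i) (xs ! j))\<^sup>2)"

text \<open>A finite subset of the space is given by a duplicate-free enumeration.\<close>

definition s_minus_space :: "'a::metric_space itself \<Rightarrow> enat" where
  "s_minus_space _ = (SUP xs \<in> {xs :: 'a list. distinct xs}. enat (s_minus_mat (S_mat xs)))"


section \<open>Borel probability measures on a metric space\<close>

definition borel_prob :: "'a::metric_space measure \<Rightarrow> bool" where
  "borel_prob \<mu> \<longleftrightarrow> prob_space \<mu> \<and> sets \<mu> = sets borel"

definition measure_supp :: "'a::metric_space measure \<Rightarrow> 'a set" where
  "measure_supp \<mu> = {x. \<forall>U. open U \<and> x \<in> U \<longrightarrow> emeasure \<mu> U > 0}"

definition full_support :: "'a::metric_space measure \<Rightarrow> bool" where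
  "full_support \<mu> \<longleftrightarrow> measure_supp \<mu> = UNIV"

definition finite_fourth_moment :: "'a::metric_space measure \<Rightarrow> bool" where
  "finite_fourth_moment \<mu> \<longleftrightarrow> (\<exists>x\<^sub>0. (\<integral>\<^sup>+ y. ennreal ((dist x\<^sub>0 y) ^ 4) \<partial>\<mu>) < \<infinity>)"


section \<open>Linear operators on real square integrable functions\<close>

text \<open>Elements of $L^2(\mu)$ are represented by square integrable functions, and equality in
  $L^2(\mu)$ is equality almost everywhere. A possibly unbounded operator is given by its
  domain \<open>D\<close> and its action \<open>A\<close> on representatives.\<close>

definition L2 :: "'a measure \<Rightarrow> ('a \<Rightarrow> real) set" where
  "L2 \<mu> = {u \<in> borel_measurable \<mu>. integrable \<mu> (\<lambda>x. (u x)\<^sup>2)}"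

definition eigenspace ::
  "'a measure \<Rightarrow> ('a \<Rightarrow> real) set \<Rightarrow> (('a \<Rightarrow> real) \<Rightarrow> 'a \<Rightarrow> real) \<Rightarrow> real \<Rightarrow> ('a \<Rightarrow> real) set" where
  "eigenspace \<mu> D A r = {u \<in> D. AE x in \<mu>. A u x = r * u x}"

definition lin_indep_AE :: "'a measure \<Rightarrow> nat \<Rightarrow> (nat \<Rightarrow> 'a \<Rightarrow> real) \<Rightarrow> bool" where
  "lin_indep_AE \<mu> n u \<longleftrightarrow>
     (\<forall>c. (AE x in \<mu>. (\<Sum>i<n. c i * u i x) = 0) \<longrightarrow> (\<forall>i<n. c i = 0))"

text \<open>The dimension in $L^2(\mu)$ of the eigenspace; it is 0 if \<open>r\<close> is not an eigenvalue.\<close>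

definition eig_mult ::
  "'a measure \<Rightarrow> ('a \<Rightarrow> real) set \<Rightarrow> (('a \<Rightarrow> real) \<Rightarrow> 'a \<Rightarrow> real) \<Rightarrow> real \<Rightarrow> enat" where
  "eig_mult \<mu> D A r =
     (SUP n \<in> {n. \<exists>u. (\<forall>i<n. u i \<in> eigenspace \<mu> D A r) \<and> lin_indep_AE \<mu> n u}. enat n)"

definition s_minus_op ::
  "'a measure \<Rightarrow> ('a \<Rightarrow> real) set \<Rightarrow> (('a \<Rightarrow> real) \<Rightarrow> 'a \<Rightarrow> real) \<Rightarrow> enat" where
  "s_minus_op \<mu> D A = (SUP F \<in> {F. finite F \<and> F \<subseteq> {..<0}}. \<Sum>r\<in>F. eig_mult \<mu> D A r)"

definition positive_semidefinite_op ::
  "'a measure \<Rightarrow> ('a \<Rightarrow> real) set \<Rightarrow> (('a \<Rightarrow> real) \<Rightarrow> 'a \<Rightarrow> real) \<Rightarrow> bool" where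
  "positive_semidefinite_op \<mu> D A \<longleftrightarrow> (\<forall>u\<in>D. 0 \<le> (\<integral>x. A u x * u x \<partial>\<mu>))"


section \<open>The operators $K_\mu$ and $T_\mu$\<close>

definition K_op :: "'a::metric_space measure \<Rightarrow> ('a \<Rightarrow> real) \<Rightarrow> 'a \<Rightarrow> real" where
  "K_op \<mu> u x = - (1/2) * (\<integral>y. (dist x y)\<^sup>2 * u y \<partial>\<mu>)"

text \<open>The integrability condition is needed because the Bochner integral of a function that is
  not integrable is 0.\<close>

definition K_dom :: "'a::metric_space measure \<Rightarrow> ('a \<Rightarrow> real) set" where
  "K_dom \<mu> = {u \<in> L2 \<mu>. (AE x in \<mu>. integrable \<mu> (\<lambda>y. (dist x y)\<^sup>2 * u y)) \<and> K_op \<mu> u \<in> L2 \<mu>}"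

definition P_op :: "'a measure \<Rightarrow> ('a \<Rightarrow> real) \<Rightarrow> 'a \<Rightarrow> real" where
  "P_op \<mu> u = (\<lambda>x. u x - (\<integral>y. u y \<partial>\<mu>))"

lemma (in prob_space) integrable_L2:
  assumes "u \<in> L2 M"
  shows "integrable M u"
proof (rule square_integrable_imp_integrable)
  show "u \<in> borel_measurable M" "integrable M (\<lambda>x. (u x)\<^sup>2)"
    using assms by (simp_all add: L2_def)
qed

lemma (in prob_space) P_op_in_L2:
  assumes u: "u \<in> L2 M"
  shows "P_op M u \<in> L2 M"
proof -
  define c where "c = expectation u"
  have m: "u \<in> borel_measurable M" and i2: "integrable M (\<lambda>x. (u x)\<^sup>2)"
    using u by (simp_all add: L2_def)
  have "integrable M (\<lambda>x. (u x)\<^sup>2 + (- 2 * c) * u x + c\<^sup>2)"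
    by (intro Bochner_Integration.integrable_add integrable_mult_right i2 integrable_L2[OF u]
        integrable_const)
  moreover have "(u x)\<^sup>2 + (- 2 * c) * u x + c\<^sup>2 = (u x - c)\<^sup>2" for x
    by (simp add: power2_diff)
  ultimately have "integrable M (\<lambda>x. (u x - c)\<^sup>2)" by simp
  moreover have "(\<lambda>x. u x - c) \<in> borel_measurable M"
    using m by (intro borel_measurable_diff borel_measurable_const)
  ultimately show ?thesis unfolding L2_def P_op_def c_def by simp
qed

text \<open>\<open>P_op\<close> is the orthogonal projector onto the orthogonal complement of the constants.\<close>

lemma (in prob_space) P_op_orthogonal_projector:
  assumes u: "u \<in> L2 M"
  shows "P_op M u \<in> L2 M" "(\<integral>x. P_op M u x * 1 \<partial>M) = 0"
    and "\<And>v. v \<in> L2 M \<Longrightarrow> (\<integral>x. v x * 1 \<partial>M) = 0 \<Longrightarrow> (\<integral>x. (u x - P_op M u x) * v x \<partial>M) = 0"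
proof -
  show "P_op M u \<in> L2 M" by (rule P_op_in_L2[OF u])
  show "(\<integral>x. P_op M u x * 1 \<partial>M) = 0"
    using integrable_L2[OF u] by (simp add: P_op_def prob_space)
  show "(\<integral>x. (u x - P_op M u x) * v x \<partial>M) = 0"
    if "v \<in> L2 M" "(\<integral>x. v x * 1 \<partial>M) = 0" for v
    using that by (simp add: P_op_def)
qed

definition T_op :: "'a::metric_space measure \<Rightarrow> ('a \<Rightarrow> real) \<Rightarrow> 'a \<Rightarrow> real" where
  "T_op \<mu> u = P_op \<mu> (K_op \<mu> (P_op \<mu> u))"

definition T_dom :: "'a::metric_space measure \<Rightarrow> ('a \<Rightarrow> real) set" where
  "T_dom \<mu> = {u \<in> L2 \<mu>. P_op \<mu> u \<in> K_dom \<mu>}"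

definition s_minus_T :: "'a::metric_space measure \<Rightarrow> enat" where
  "s_minus_T \<mu> = s_minus_op \<mu> (T_dom \<mu>) (T_op \<mu>)"

definition kern :: "'a::metric_space \<Rightarrow> 'a \<Rightarrow> real" where
  "kern x y = - (1/2) * (dist x y)\<^sup>2"

definition kern_T :: "'a::metric_space measure \<Rightarrow> 'a \<Rightarrow> 'a \<Rightarrow> real" where
  "kern_T \<mu> x y = kern x y - (\<integral>y'. kern x y' \<partial>\<mu>) - (\<integral>x'. kern x' y \<partial>\<mu>)
     + (\<integral>y'. (\<integral>x'. kern x' y' \<partial>\<mu>) \<partial>\<mu>)"


section \<open>Enumerations of the strictly positive eigenvalues of $T_\mu$\<close>

definition ecard :: "'b set \<Rightarrow> enat" where
  "ecard A = (if finite A then enat (card A) else \<infinity>)"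

text \<open>\<open>l i\<close> and \<open>u i\<close> for \<open>i < N\<close> enumerate the strictly positive eigenvalues, each repeated
  according to its multiplicity, and corresponding orthonormal eigenfunctions. The last
  condition selects the continuous representative of each eigenfunction.\<close>

definition pos_eigensystem ::
  "'a::metric_space measure \<Rightarrow> enat \<Rightarrow> (nat \<Rightarrow> real) \<Rightarrow> (nat \<Rightarrow> 'a \<Rightarrow> real) \<Rightarrow> bool" where
  "pos_eigensystem \<mu> N l u \<longleftrightarrow>
     (\<forall>i. enat i < N \<longrightarrow> 0 < l i \<and> u i \<in> eigenspace \<mu> (T_dom \<mu>) (T_op \<mu>) (l i)) \<and>
     (\<forall>r>0. ecard {i. enat i < N \<and> l i = r} = eig_mult \<mu> (T_dom \<mu>) (T_op \<mu>) r) \<and>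
     (\<forall>i j. enat i < N \<and> enat j < N \<longrightarrow> (\<integral>x. u i x * u j x \<partial>\<mu>) = (if i = j then 1 else 0)) \<and>
     (\<forall>i x. enat i < N \<longrightarrow> u i x = inverse (l i) * (\<integral>y. kern_T \<mu> x y * u i y \<partial>\<mu>))"

definition eigenmap ::
  "enat \<Rightarrow> (nat \<Rightarrow> real) \<Rightarrow> (nat \<Rightarrow> 'a \<Rightarrow> real) \<Rightarrow> 'a \<Rightarrow> nat \<Rightarrow> real" where
  "eigenmap N l u x i = (if enat i < N then sqrt (l i) * u i x else 0)"

end

(* The operator T has the continuous kernel k_T, bounded by h(x) h(y) with a continuous square
   integrable h, where k_T(x,x) - 2 k_T(x,y) + k_T(y,y) = d(x,y)^2.  The Rayleigh quotient of such
   an operator, if positive somewhere on the orthogonal complement of a set of eigenfunctions, is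
   maximised there by an eigenfunction: for a maximising sequence u_n the functions T u_n converge
   pointwise along a subsequence (first on a dense set), hence in L^2 by domination.  So
   s_-(T) = 0 means that T is positive semidefinite, and the eigenfunctions for positive eigenvalues
   are complete modulo the null space of T.  Full support makes every residual kernel
   k_T - sum_{i<n} lambda_i u_i(x) u_i(y) nonnegative on the diagonal; this gives Mercer's expansion
   of k_T at every point, that is, the isometry of the eigenmap.  Conversely, for an embedded space
   the form of T at u is the squared norm of the weak integral of the embedding against P u, and this
   needs no moment assumption.  Finally, the distance matrix of an embedded space is positive
   semidefinite on the hyperplane of vectors with vanishing sum, which leaves room for only one
   negative eigenvalue. *)
theory Submission
  imports Defs "HOL-Complex_Analysis.Great_Picard"
begin

section \<open>Square integrable functions\<close>

text \<open>The space is in general not compact, so Arzela-Ascoli and Dini are out of reach. The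
  first is replaced by the L^2-continuity of the sections of the kernel, which makes the images of
  the unit ball equicontinuous; the second by weak continuity of the eigenmap: its series need not
  converge uniformly, but bounded norms and continuous coordinates make the inner product of f(x)
  and f(y) continuous in y, and continuous functions that agree almost everywhere agree everywhere
  when the support is full. Functions stand for their classes, so limits are taken of the images
  \<open>T u\<close>, which have a definite value at every point, and not of the \<open>u\<close>
  themselves. The statement on all probability measures includes those with infinite fourth moment,
  where k_T may fail to exist; the direction from an embedding therefore works on the domain of the
  operator, where one point x0 with d(x0,.)^2 v integrable is enough. The way back needs a single
  measure: atoms on a dense sequence, with weights that tame the fourth moment.\<close>

lemma quadratic_nonneg_discriminant:
  fixes A B C :: real
  assumes "\<And>t. 0 \<le> A + 2 * t * B + t\<^sup>2 * C"
  shows "B\<^sup>2 \<le> A * C"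
proof (cases "C = 0")
  case True
  have "B = 0"
  proof (rule ccontr)
    assume "B \<noteq> 0"
    \<comment> \<open>The argument is the zero of \<open>A + 1 + 2 * t * B\<close>, so the affine
      polynomial takes the value -1 there.\<close>
    then have "A + 2 * (- (A + 1) / (2 * B)) * B + (- (A + 1) / (2 * B))\<^sup>2 * C = -1"
      using True by (simp add: field_simps)
    with assms[of "- (A + 1) / (2 * B)"] show False by simp
  qed
  then show ?thesis using True by simp
next
  case False
  have "0 \<le> C"
  proof (rule ccontr)
    assume "\<not> 0 \<le> C"
    then have C: "C < 0" by simp
    \<comment> \<open>For \<open>C < 0\<close> the quadratic term has to win:
      \<open>t * (-C)\<close> is at least \<open>\<bar>A\<bar> + 2 * \<bar>B\<bar> + 1\<close>, and
      the added 1 gives \<open>t \<ge> 1\<close>, so that multiplying by t once more dominates both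
      A and \<open>2 * t * B\<close>.\<close>
    define t where "t = (\<bar>A\<bar> + 2 * \<bar>B\<bar> + 1) / (- C) + 1"
    have t: "t \<ge> 1" "t * (-C) \<ge> \<bar>A\<bar> + 2 * \<bar>B\<bar> + 1"
      using C by (auto simp: t_def field_simps)
    have "t * (t * (-C)) \<ge> t * (\<bar>A\<bar> + 2 * \<bar>B\<bar> + 1)"
      using t by (intro mult_left_mono) auto
    moreover have "t * \<bar>A\<bar> \<ge> A" using t mult_right_mono[of 1 t "\<bar>A\<bar>"] by simp
    moreover have "t * \<bar>B\<bar> \<ge> t * (B)" using t by (intro mult_left_mono) auto
    ultimately have "A + 2 * t * B + t\<^sup>2 * C < 0"
      using t by (simp only: power2_eq_square distrib_left mult_minus_right mult.assoc mult.left_commute[of t 2] mult_1_right)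
    with assms[of t] show False by simp
  qed
  with False have C: "0 < C" by simp
  \<comment> \<open>\<open>- B / C\<close> is the vertex of the parabola.\<close>
  have "A + 2 * (- B / C) * B + (- B / C)\<^sup>2 * C = A - B\<^sup>2 / C"
    using C by (simp add: field_simps power2_eq_square)
  with assms[of "- B / C"] have "B\<^sup>2 / C \<le> A" by simp
  then show ?thesis using C by (simp add: field_simps)
qed

text \<open>Elimination with the last equation, by induction on the number of equations. Later this
  finds, in the span of more eigenfunctions than a given orthonormal family has members, a
  combination orthogonal to the whole family.\<close>

lemma exists_nontrivial_solution:
  fixes a :: "nat \<Rightarrow> nat \<Rightarrow> real"
  assumes "m < n"
  shows "\<exists>c. (\<exists>j<n. c j \<noteq> 0) \<and> (\<forall>i<m. (\<Sum>j<n. c j * a i j) = 0)"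
  using assms
proof (induction m arbitrary: n a)
  case 0
  then show ?case by (intro exI[of _ "\<lambda>_. 1"]) auto
next
  case (Suc m)
  obtain n' where n: "n = Suc n'" "m < n'" using Suc.prems by (cases n) auto
  show ?case
  proof (cases "\<forall>j<n. a m j = 0")
    case True
    obtain c where c: "\<exists>j<n. c j \<noteq> 0" "\<forall>i<m. (\<Sum>j<n. c j * a i j) = 0"
      using Suc.IH[of n a] Suc.prems by auto
    have "(\<Sum>j<n. c j * a m j) = 0" using True by simp
    with c show ?thesis by (intro exI[of _ c]) (auto simp: less_Suc_eq)
  next
    case False
    then obtain p where p: "p < n" "a m p \<noteq> 0" by auto
    \<comment> \<open>Swapping the pivot column p with the last one leaves the columns below n' to
      the induction hypothesis; s is an involution, so the same map carries the solution
      back.\<close>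
    define s where "s = Transposition.transpose p n'"
    have s: "bij_betw s {..<n} {..<n}"
      using p n by (intro bij_betw_byWitness[where f' = s]) (auto simp: s_def transpose_def)
    have sn: "s n' = p" by (simp add: s_def)
    define b where "b i j = a i (s j)" for i j
    have bp: "b m n' \<noteq> 0" using p by (simp add: b_def sn)
    obtain c where c: "\<exists>j<n'. c j \<noteq> 0"
        "\<forall>i<m. (\<Sum>j<n'. c j * (b i j - b i n' * b m j / b m n')) = 0"
      using Suc.IH[OF n(2), of "\<lambda>i j. b i j - b i n' * b m j / b m n'"] by auto
    \<comment> \<open>Back substitution: the last unknown is what equation m dictates.\<close>
    define d where "d j = (if j < n' then c j else - (\<Sum>j<n'. c j * b m j) / b m n')" for j
    have sum_d: "(\<Sum>j<n. d j * b i j)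
        = (\<Sum>j<n'. c j * b i j) - (\<Sum>j<n'. c j * b m j) / b m n' * b i n'" for i
      by (simp add: n d_def)
    have d0: "(\<Sum>j<n. d j * b i j) = 0" if "i < Suc m" for i
    proof (cases "i = m")
      case True
      then show ?thesis unfolding sum_d using bp by simp
    next
      case False
      then have "i < m" using that by simp
      then have "0 = (\<Sum>j<n'. c j * (b i j - b i n' * b m j / b m n'))" using c by simp
      also have "\<dots> = (\<Sum>j<n'. c j * b i j) - (\<Sum>j<n'. c j * b m j) / b m n' * b i n'"
        by (simp add: right_diff_distrib sum_subtractf sum_divide_distrib sum_distrib_right
            sum_distrib_left mult.commute mult.left_commute)
      finally show ?thesis unfolding sum_d by simp
    qed
    define e where "e j = d (s j)" for j
    have ss: "s (s j) = j" for j by (simp add: s_def)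
    have "(\<Sum>j<n. e j * a i j) = (\<Sum>j<n. d j * b i j)" for i
      using sum.reindex_bij_betw[OF s, of "\<lambda>j. e j * a i j"] by (simp add: e_def b_def ss)
    moreover have "\<exists>j<n. e j \<noteq> 0"
    proof -
      obtain j where j: "j < n'" "c j \<noteq> 0" using c by auto
      then have "s j < n" "e (s j) \<noteq> 0"
        using s n by (auto simp: e_def ss d_def bij_betw_def)
      then show ?thesis by auto
    qed
    ultimately show ?thesis using d0 by auto
  qed
qed

section \<open>The form of L^2 on representatives: an inner product up to null functions\<close>

definition l2ip :: "'a measure \<Rightarrow> ('a \<Rightarrow> real) \<Rightarrow> ('a \<Rightarrow> real) \<Rightarrow> real" where
  "l2ip M u v = (\<integral>x. u x * v x \<partial>M)"

lemma L2_D: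
  assumes "u \<in> L2 M"
  shows "u \<in> borel_measurable M" "integrable M (\<lambda>x. (u x)\<^sup>2)"
  using assms by (auto simp: L2_def)

lemma L2_mult_integrable:
  assumes "u \<in> L2 M" "v \<in> L2 M"
  shows "integrable M (\<lambda>x. u x * v x)"
proof (rule Bochner_Integration.integrable_bound)
  show "integrable M (\<lambda>x. (u x)\<^sup>2 + (v x)\<^sup>2)"
    using assms by (auto simp: L2_def)
  show "(\<lambda>x. u x * v x) \<in> borel_measurable M"
    using L2_D[OF assms(1)] L2_D[OF assms(2)] by measurable
  have "\<bar>a * b\<bar> \<le> a\<^sup>2 + b\<^sup>2" for a b :: real
    using sum_squares_bound[of a b] sum_squares_bound[of a "-b"] by (auto simp: abs_if)
  then show "AE x in M. norm (u x * v x) \<le> norm ((u x)\<^sup>2 + (v x)\<^sup>2)"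
    by simp
qed

lemma L2_bound:
  assumes "h \<in> L2 M" "u \<in> borel_measurable M" "\<And>x. \<bar>u x\<bar> \<le> \<bar>h x\<bar>"
  shows "u \<in> L2 M"
  unfolding L2_def
proof (intro CollectI conjI assms(2))
  show "integrable M (\<lambda>x. (u x)\<^sup>2)"
  proof (rule Bochner_Integration.integrable_bound)
    show "integrable M (\<lambda>x. (h x)\<^sup>2)" using assms(1) by (simp add: L2_def)
    show "(\<lambda>x. (u x)\<^sup>2) \<in> borel_measurable M" using assms(2) by measurable
    show "AE x in M. norm ((u x)\<^sup>2) \<le> norm ((h x)\<^sup>2)"
      using assms(3) by (simp add: abs_le_square_iff)
  qed
qed

lemma L2_scale: "u \<in> L2 M \<Longrightarrow> (\<lambda>x. c * u x) \<in> L2 M"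
  by (auto simp: L2_def power_mult_distrib)

lemma L2_add:
  assumes "u \<in> L2 M" "v \<in> L2 M"
  shows "(\<lambda>x. u x + v x) \<in> L2 M"
proof -
  have "integrable M (\<lambda>x. (u x)\<^sup>2 + (v x)\<^sup>2 + 2 * (u x * v x))"
    using L2_D[OF assms(1)] L2_D[OF assms(2)] L2_mult_integrable[OF assms] by auto
  then show ?thesis
    using assms unfolding L2_def by (auto simp: power2_sum mult.assoc)
qed

lemma L2_diff:
  assumes "u \<in> L2 M" "v \<in> L2 M"
  shows "(\<lambda>x. u x - v x) \<in> L2 M"
  using L2_add[OF assms(1) L2_scale[OF assms(2), of "-1"]] by simp

lemma L2_zero: "(\<lambda>x. 0) \<in> L2 M"
  by (simp add: L2_def)

lemma L2_sum:
  assumes "\<And>i. i \<in> F \<Longrightarrow> u i \<in> L2 M"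
  shows "(\<lambda>x. \<Sum>i\<in>F. u i x) \<in> L2 M"
  using assms by (induction F rule: infinite_finite_induct) (auto intro: L2_zero L2_add)

lemma l2ip_commute: "l2ip M u v = l2ip M v u"
  by (simp add: l2ip_def mult.commute)

lemma l2ip_add_left:
  assumes "u \<in> L2 M" "v \<in> L2 M" "w \<in> L2 M"
  shows "l2ip M (\<lambda>x. u x + v x) w = l2ip M u w + l2ip M v w"
  using L2_mult_integrable[OF assms(1,3)] L2_mult_integrable[OF assms(2,3)]
  by (simp add: l2ip_def distrib_right)

lemma l2ip_scale_left: "l2ip M (\<lambda>x. c * u x) w = c * l2ip M u w"
  by (simp add: l2ip_def mult.assoc)

lemma l2ip_diff_left:
  assumes "u \<in> L2 M" "v \<in> L2 M" "w \<in> L2 M"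
  shows "l2ip M (\<lambda>x. u x - v x) w = l2ip M u w - l2ip M v w"
  using L2_mult_integrable[OF assms(1,3)] L2_mult_integrable[OF assms(2,3)]
  by (simp add: l2ip_def left_diff_distrib)

lemma l2ip_sum_left:
  assumes "\<And>i. i \<in> F \<Longrightarrow> u i \<in> L2 M" "w \<in> L2 M"
  shows "l2ip M (\<lambda>x. \<Sum>i\<in>F. u i x) w = (\<Sum>i\<in>F. l2ip M (u i) w)"
  unfolding l2ip_def sum_distrib_right
  using L2_mult_integrable[OF assms(1) assms(2)] by (intro Bochner_Integration.integral_sum) auto

lemma l2ip_scale_right: "l2ip M w (\<lambda>x. c * u x) = c * l2ip M w u"
  by (simp add: l2ip_commute[of M w] l2ip_scale_left)

lemma l2ip_add_right:
  assumes "w \<in> L2 M" "u \<in> L2 M" "v \<in> L2 M"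
  shows "l2ip M w (\<lambda>x. u x + v x) = l2ip M w u + l2ip M w v"
  using l2ip_add_left[OF assms(2,3,1)] by (simp add: l2ip_commute[of M w])

lemma l2ip_diff_right:
  assumes "w \<in> L2 M" "u \<in> L2 M" "v \<in> L2 M"
  shows "l2ip M w (\<lambda>x. u x - v x) = l2ip M w u - l2ip M w v"
  using l2ip_diff_left[OF assms(2,3,1)] by (simp add: l2ip_commute[of M w])

lemma l2ip_sum_right:
  assumes "w \<in> L2 M" "\<And>i. i \<in> F \<Longrightarrow> u i \<in> L2 M"
  shows "l2ip M w (\<lambda>x. \<Sum>i\<in>F. u i x) = (\<Sum>i\<in>F. l2ip M w (u i))"
  using l2ip_sum_left[of F u M w, OF assms(2,1)] by (simp add: l2ip_commute[of M w])

lemma l2ip_nonneg: "0 \<le> l2ip M u u"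
  by (simp add: l2ip_def)

lemma l2ip_eq_0_iff:
  assumes "u \<in> L2 M"
  shows "l2ip M u u = 0 \<longleftrightarrow> (AE x in M. u x = 0)"
  using integral_nonneg_eq_0_iff_AE[of M "\<lambda>x. (u x)\<^sup>2"] L2_D[OF assms]
  by (simp add: l2ip_def power2_eq_square)

lemma l2ip_cong_AE:
  assumes "u \<in> L2 M" "v \<in> L2 M" "w \<in> L2 M" "AE x in M. u x = v x"
  shows "l2ip M u w = l2ip M v w"
  unfolding l2ip_def using assms L2_mult_integrable[OF assms(1,3)] L2_mult_integrable[OF assms(2,3)]
  by (intro integral_cong_AE borel_measurable_integrable) auto

text \<open>Only nonnegativity and the expansion along the line \<open>u + t * v\<close> enter, so
  this serves forms that are nonnegative just on a subset: the L^2 form, the form of \<Lambda> - T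
  on an orthogonal complement, and the form of T.\<close>

lemma positive_form_Cauchy_Schwarz:
  fixes a :: "('a \<Rightarrow> real) \<Rightarrow> ('a \<Rightarrow> real) \<Rightarrow> real"
  assumes "\<And>t. 0 \<le> a (\<lambda>x. u x + t * v x) (\<lambda>x. u x + t * v x)"
    and "\<And>t. a (\<lambda>x. u x + t * v x) (\<lambda>x. u x + t * v x) = a u u + 2 * t * a u v + t\<^sup>2 * a v v"
  shows "(a u v)\<^sup>2 \<le> a u u * a v v"
  by (rule quadratic_nonneg_discriminant) (use assms(1) in \<open>simp add: assms(2)\<close>)

lemma l2ip_Cauchy_Schwarz:
  assumes "u \<in> L2 M" "v \<in> L2 M"
  shows "(l2ip M u v)\<^sup>2 \<le> l2ip M u u * l2ip M v v"
proof (rule positive_form_Cauchy_Schwarz[of "l2ip M" u v])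
  show "l2ip M (\<lambda>x. u x + t * v x) (\<lambda>x. u x + t * v x)
      = l2ip M u u + 2 * t * l2ip M u v + t\<^sup>2 * l2ip M v v" for t
    using assms
    by (simp add: l2ip_add_left l2ip_add_right l2ip_scale_left l2ip_scale_right L2_add L2_scale
        l2ip_commute[of M v u] power2_eq_square distrib_left)
qed (rule l2ip_nonneg)

lemma l2ip_tendsto_0:
  assumes "\<And>n. z n \<in> L2 M" "e \<in> L2 M" "(\<lambda>n. l2ip M (z n) (z n)) \<longlonglongrightarrow> 0"
  shows "(\<lambda>n. l2ip M (z n) e) \<longlonglongrightarrow> 0"
proof -
  have "(\<lambda>n. (l2ip M (z n) e)\<^sup>2) \<longlonglongrightarrow> 0"
  proof (rule tendsto_sandwich[OF _ _ tendsto_const])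
    show "(\<lambda>n. l2ip M (z n) (z n) * l2ip M e e) \<longlonglongrightarrow> 0"
      using tendsto_mult_right[OF assms(3), of "l2ip M e e"] by simp
  qed (use l2ip_Cauchy_Schwarz[OF assms(1,2)] in auto)
  then have "(\<lambda>n. sqrt ((l2ip M (z n) e)\<^sup>2)) \<longlonglongrightarrow> sqrt 0" by (rule tendsto_real_sqrt)
  then show ?thesis by (simp add: tendsto_rabs_zero_iff)
qed

section \<open>Integral operators with a symmetric kernel\<close>

text \<open>The product bound with a square integrable h replaces compactness of the space: it
  dominates the kernel in either variable, and h is bounded along convergent sequences. The kernel
  stays abstract because it is taken to be k, then k_T and, to reach negative eigenvalues,
  \<open>- k x y\<close>.\<close>

locale sym_kernel = prob_space M for M :: "'a::metric_space measure" +
  fixes k :: "'a \<Rightarrow> 'a \<Rightarrow> real" and h :: "'a \<Rightarrow> real"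
  assumes sets_M: "sets M = sets borel"
    and separable: "separable_space (euclidean :: 'a topology)"
    and k_measurable: "(\<lambda>p. k (fst p) (snd p)) \<in> borel_measurable (M \<Otimes>\<^sub>M M)"
    and k_sym: "k x y = k y x"
    and k_bound: "\<bar>k x y\<bar> \<le> h x * h y"
    and k_continuous: "continuous_on UNIV (\<lambda>p. k (fst p) (snd p))"
    and h_nonneg: "0 \<le> h x"
    and h_continuous: "continuous_on UNIV h"
    and h_L2: "h \<in> L2 M"
begin

sublocale MM: pair_prob_space M M ..

abbreviation ip :: "('a \<Rightarrow> real) \<Rightarrow> ('a \<Rightarrow> real) \<Rightarrow> real" where
  "ip \<equiv> l2ip M"

definition T :: "('a \<Rightarrow> real) \<Rightarrow> 'a \<Rightarrow> real" where
  "T u x = (\<integral>y. k x y * u y \<partial>M)"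

lemma space_M: "space M = UNIV"
  using sets_eq_imp_space_eq[OF sets_M] by simp

lemma continuous_imp_measurable_M: "continuous_on UNIV f \<Longrightarrow> f \<in> borel_measurable M"
  using borel_measurable_continuous_onI[of f] measurable_cong_sets[OF sets_M refl] by blast

lemma k_section_continuous: "continuous_on UNIV (k x)"
  using continuous_on_compose2[OF k_continuous, of UNIV "\<lambda>y. (x, y)"]
  by (simp add: continuous_on_Pair)

lemma k_section_L2: "k x \<in> L2 M"
proof (rule L2_bound)
  show "(\<lambda>y. h x * h y) \<in> L2 M" by (rule L2_scale[OF h_L2])
  show "k x \<in> borel_measurable M"
    by (rule continuous_imp_measurable_M[OF k_section_continuous])
  show "\<bar>k x y\<bar> \<le> \<bar>h x * h y\<bar>" for y
    using k_bound[of x y] by linarith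
qed

lemma k_mult_integrable: "u \<in> L2 M \<Longrightarrow> integrable M (\<lambda>y. k x y * u y)"
  by (rule L2_mult_integrable[OF k_section_L2])

lemma T_eq_ip: "T u x = ip (k x) u"
  by (simp add: T_def l2ip_def)

lemma ip_k_k_le: "ip (k x) (k x) \<le> (h x)\<^sup>2 * ip h h"
proof -
  have "ip (k x) (k x) \<le> (\<integral>y. (h x * h y) * (h x * h y) \<partial>M)"
    unfolding l2ip_def
  proof (rule integral_mono)
    show "integrable M (\<lambda>y. k x y * k x y)" by (intro L2_mult_integrable k_section_L2)
    show "integrable M (\<lambda>y. h x * h y * (h x * h y))" by (intro L2_mult_integrable L2_scale h_L2)
    show "k x y * k x y \<le> h x * h y * (h x * h y)" for y
      using k_bound[of x y] abs_mult_self_eq[of "k x y"] mult_mono'[OF k_bound[of x y] k_bound[of x y]]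
      by simp
  qed
  also have "\<dots> = (\<integral>y. (h x)\<^sup>2 * (h y * h y) \<partial>M)"
    by (rule Bochner_Integration.integral_cong) (simp_all add: power2_eq_square)
  also have "\<dots> = (h x)\<^sup>2 * ip h h"
    unfolding l2ip_def by simp
  finally show ?thesis .
qed

lemma T_bound_sq: "u \<in> L2 M \<Longrightarrow> (T u x)\<^sup>2 \<le> (h x)\<^sup>2 * (ip h h * ip u u)"
  using l2ip_Cauchy_Schwarz[OF k_section_L2[of x], of u] mult_right_mono[OF ip_k_k_le[of x] l2ip_nonneg[of M u]]
  unfolding T_eq_ip by (simp add: mult.assoc)

lemma T_bound: "u \<in> L2 M \<Longrightarrow> \<bar>T u x\<bar> \<le> h x * sqrt (ip h h * ip u u)"
  using real_sqrt_le_mono[OF T_bound_sq[of u x]] h_nonneg[of x]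
  by (simp add: real_sqrt_mult)

text \<open>Along a convergent sequence h is bounded by some C, hence
  \<open>C * \<bar>h y * u y\<bar>\<close> dominates. An image of T is thus a continuous function
  and not only a class, which lets later equations be stated at each point.\<close>

lemma T_continuous:
  assumes u: "u \<in> L2 M"
  shows "continuous_on UNIV (T u)"
proof -
  have "(\<lambda>n. T u (X n)) \<longlonglongrightarrow> T u x" if X: "X \<longlonglongrightarrow> x" for X x
  proof -
    have "(\<lambda>n. h (X n)) \<longlonglongrightarrow> h x"
      using h_continuous X by (simp add: continuous_on_sequentially o_def)
    then have "Bseq (\<lambda>n. h (X n))" by (intro convergent_imp_Bseq convergentI)
    then obtain C where C: "\<And>n. \<bar>h (X n)\<bar> \<le> C" by (auto simp: Bseq_def)
    show ?thesis
      unfolding T_def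
    proof (rule integral_dominated_convergence)
      show "(\<lambda>y. k x y * u y) \<in> borel_measurable M" "\<And>n. (\<lambda>y. k (X n) y * u y) \<in> borel_measurable M"
        using k_mult_integrable[OF u] by auto
      have "integrable M (\<lambda>y. C * \<bar>h y * u y\<bar>)"
        using L2_mult_integrable[OF h_L2 u] by auto
      then show "integrable M (\<lambda>y. C * \<bar>h y * u y\<bar>)" .
      show "AE y in M. norm (k (X n) y * u y) \<le> C * \<bar>h y * u y\<bar>" for n
      proof (rule AE_I2)
        fix y
        have "\<bar>k (X n) y\<bar> \<le> C * h y"
          using k_bound[of "X n" y] mult_right_mono[OF C[of n] h_nonneg[of y]] h_nonneg[of "X n"] by simp
        then have "\<bar>k (X n) y\<bar> * \<bar>u y\<bar> \<le> (C * h y) * \<bar>u y\<bar>" by (intro mult_right_mono) auto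
        then show "norm (k (X n) y * u y) \<le> C * \<bar>h y * u y\<bar>"
          using h_nonneg[of y] by (simp add: abs_mult mult.assoc)
      qed
      show "AE y in M. (\<lambda>n. k (X n) y * u y) \<longlonglongrightarrow> k x y * u y"
      proof (rule AE_I2)
        fix y
        have "(\<lambda>n. k y (X n)) \<longlonglongrightarrow> k y x"
          using k_section_continuous[of y] X by (simp add: continuous_on_sequentially o_def)
        then show "(\<lambda>n. k (X n) y * u y) \<longlonglongrightarrow> k x y * u y"
          by (intro tendsto_mult_right) (simp add: k_sym[of _ y])
      qed
    qed
  qed
  then show ?thesis by (simp add: continuous_on_sequentially o_def)
qed

lemma T_L2:
  assumes "u \<in> L2 M"
  shows "T u \<in> L2 M"
proof (rule L2_bound)
  show "(\<lambda>x. sqrt (ip h h * ip u u) * h x) \<in> L2 M" by (rule L2_scale[OF h_L2])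
  show "T u \<in> borel_measurable M" by (rule continuous_imp_measurable_M[OF T_continuous[OF assms]])
  show "\<bar>T u x\<bar> \<le> \<bar>sqrt (ip h h * ip u u) * h x\<bar>" for x
    using T_bound[OF assms, of x] by (simp add: mult.commute)
qed

lemma T_add: "u \<in> L2 M \<Longrightarrow> v \<in> L2 M \<Longrightarrow> T (\<lambda>x. u x + v x) x = T u x + T v x"
  by (simp add: T_eq_ip l2ip_add_right k_section_L2)

lemma T_diff: "u \<in> L2 M \<Longrightarrow> v \<in> L2 M \<Longrightarrow> T (\<lambda>x. u x - v x) x = T u x - T v x"
  by (simp add: T_eq_ip l2ip_diff_right k_section_L2)

lemma T_scale: "T (\<lambda>x. c * u x) x = c * T u x"
  by (simp add: T_eq_ip l2ip_scale_right)

lemma T_sum: "(\<And>i. i \<in> F \<Longrightarrow> u i \<in> L2 M) \<Longrightarrow> T (\<lambda>x. \<Sum>i\<in>F. u i x) x = (\<Sum>i\<in>F. T (u i) x)"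
  by (simp add: T_eq_ip l2ip_sum_right k_section_L2)

lemma kernel_form_integrable:
  assumes "u \<in> L2 M" "v \<in> L2 M"
  shows "integrable (M \<Otimes>\<^sub>M M) (\<lambda>(x, y). k x y * u y * v x)"
proof (rule Bochner_Integration.integrable_bound)
  show "integrable (M \<Otimes>\<^sub>M M) (\<lambda>(x, y). (h x * v x) * (h y * u y))"
  proof (rule MM.Fubini_integrable)
    note u = L2_mult_integrable[OF h_L2 assms(1)] and v = L2_mult_integrable[OF h_L2 assms(2)]
    show "(\<lambda>(x, y). (h x * v x) * (h y * u y)) \<in> borel_measurable (M \<Otimes>\<^sub>M M)"
      using borel_measurable_integrable[OF u] borel_measurable_integrable[OF v] by measurable
    show "integrable M (\<lambda>x. \<integral>y. norm (case (x, y) of (x, y) \<Rightarrow> (h x * v x) * (h y * u y)) \<partial>M)"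
      using integrable_mult_left[OF integrable_abs[OF v], of "\<integral>y. \<bar>h y * u y\<bar> \<partial>M"]
      by (simp add: abs_mult mult.assoc)
    show "AE x in M. integrable M (\<lambda>y. case (x, y) of (x, y) \<Rightarrow> (h x * v x) * (h y * u y))"
      using u by simp
  qed
  show "(\<lambda>(x, y). k x y * u y * v x) \<in> borel_measurable (M \<Otimes>\<^sub>M M)"
    using k_measurable L2_D(1)[OF assms(1)] L2_D(1)[OF assms(2)]
    by (simp add: case_prod_beta) measurable
  show "AE p in M \<Otimes>\<^sub>M M. norm (case p of (x, y) \<Rightarrow> k x y * u y * v x)
      \<le> norm (case p of (x, y) \<Rightarrow> (h x * v x) * (h y * u y))"
  proof (rule AE_I2, clarsimp simp: abs_mult)
    fix x y
    have "\<bar>k x y\<bar> * (\<bar>u y\<bar> * \<bar>v x\<bar>) \<le> (h x * h y) * (\<bar>u y\<bar> * \<bar>v x\<bar>)"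
      by (intro mult_right_mono k_bound) auto
    then show "\<bar>k x y\<bar> * \<bar>u y\<bar> * \<bar>v x\<bar> \<le> \<bar>h x\<bar> * \<bar>v x\<bar> * (\<bar>h y\<bar> * \<bar>u y\<bar>)"
      using h_nonneg[of x] h_nonneg[of y] by (simp add: mult_ac)
  qed
qed

lemma T_selfadjoint:
  assumes "u \<in> L2 M" "v \<in> L2 M"
  shows "ip (T u) v = ip u (T v)"
proof -
  have "ip (T u) v = (\<integral>x. (\<integral>y. k x y * u y * v x \<partial>M) \<partial>M)"
    unfolding l2ip_def T_def by simp
  also have "\<dots> = (\<integral>y. (\<integral>x. k x y * u y * v x \<partial>M) \<partial>M)"
    by (rule MM.Fubini_integral[OF kernel_form_integrable[OF assms], symmetric])
  also have "\<dots> = (\<integral>y. u y * (\<integral>x. k y x * v x \<partial>M) \<partial>M)"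
    by (simp add: k_sym[of _ y for y] mult_ac)
  finally show ?thesis unfolding l2ip_def T_def .
qed

end

lemma countable_dense_if_separable:
  assumes "separable_space (euclidean :: 'a::topological_space topology)"
  shows "\<exists>D :: 'a set. countable D \<and> closure D = UNIV"
  using assms by (simp add: separable_space_def euclidean_closure_of)

section \<open>Compactness of the integral operator\<close>

context sym_kernel
begin

text \<open>By Cauchy-Schwarz, this makes the functions \<open>T u\<close> with
  \<open>ip u u \<le> 1\<close> equicontinuous at x.\<close>

lemma k_section_tendsto:
  assumes X: "X \<longlonglongrightarrow> x"
  shows "(\<lambda>n. ip (\<lambda>y. k x y - k (X n) y) (\<lambda>y. k x y - k (X n) y)) \<longlonglongrightarrow> 0"
proof -
  have "(\<lambda>n. h (X n)) \<longlonglongrightarrow> h x"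
    using h_continuous X by (simp add: continuous_on_sequentially o_def)
  then have "Bseq (\<lambda>n. h (X n))" by (intro convergent_imp_Bseq convergentI)
  then obtain C where C: "\<And>n. \<bar>h (X n)\<bar> \<le> C" by (auto simp: Bseq_def)
  have "(\<lambda>n. \<integral>y. (k x y - k (X n) y)\<^sup>2 \<partial>M) \<longlonglongrightarrow> (\<integral>y. 0 \<partial>M)"
  proof (rule integral_dominated_convergence)
    show "(\<lambda>y. (k x y - k (X n) y)\<^sup>2) \<in> borel_measurable M" for n
      using L2_D(1)[OF k_section_L2] by measurable
    show "integrable M (\<lambda>y. ((h x + C) * h y)\<^sup>2)"
      using L2_scale[OF h_L2] by (simp add: L2_def)
    show "AE y in M. norm ((k x y - k (X n) y)\<^sup>2) \<le> ((h x + C) * h y)\<^sup>2" for n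
    proof (rule AE_I2)
      fix y
      have "\<bar>k (X n) y\<bar> \<le> C * h y"
        using k_bound[of "X n" y] mult_right_mono[OF C[of n] h_nonneg[of y]] h_nonneg[of "X n"] by simp
      then have "\<bar>k x y - k (X n) y\<bar> \<le> (h x + C) * h y"
        using k_bound[of x y] by (simp add: distrib_right)
      then have "\<bar>k x y - k (X n) y\<bar>\<^sup>2 \<le> ((h x + C) * h y)\<^sup>2"
        by (intro power_mono) auto
      then show "norm ((k x y - k (X n) y)\<^sup>2) \<le> ((h x + C) * h y)\<^sup>2" by simp
    qed
    show "AE y in M. (\<lambda>n. (k x y - k (X n) y)\<^sup>2) \<longlonglongrightarrow> 0"
    proof (rule AE_I2)
      fix y
      have "(\<lambda>n. k y (X n)) \<longlonglongrightarrow> k y x"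
        using k_section_continuous[of y] X by (simp add: continuous_on_sequentially o_def)
      then have "(\<lambda>n. (k x y - k (X n) y)\<^sup>2) \<longlonglongrightarrow> (k x y - k x y)\<^sup>2"
        by (intro tendsto_intros) (simp add: k_sym[of _ y])
      then show "(\<lambda>n. (k x y - k (X n) y)\<^sup>2) \<longlonglongrightarrow> 0" by simp
    qed
  qed simp
  then show ?thesis by (simp add: l2ip_def power2_eq_square)
qed

lemma T_compact:
  fixes u :: "nat \<Rightarrow> 'a \<Rightarrow> real"
  assumes u: "\<And>n. u n \<in> L2 M" and u1: "\<And>n. ip (u n) (u n) \<le> 1"
  obtains s g where "strict_mono s" "g \<in> L2 M" "\<And>x. (\<lambda>n. T (u (s n)) x) \<longlonglongrightarrow> g x"
    "(\<lambda>n. ip (\<lambda>x. T (u (s n)) x - g x) (\<lambda>x. T (u (s n)) x - g x)) \<longlonglongrightarrow> 0"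
proof -
  define H where "H = sqrt (ip h h)"
  have H0: "0 \<le> H" by (simp add: H_def l2ip_nonneg)
  have Tb: "\<bar>T (u n) x\<bar> \<le> H * h x" for n x
  proof -
    have "sqrt (ip h h * ip (u n) (u n)) \<le> H * 1"
      unfolding H_def real_sqrt_mult using u1[of n]
      by (intro mult_mono) (auto simp: l2ip_nonneg)
    then have "h x * sqrt (ip h h * ip (u n) (u n)) \<le> h x * H"
      using h_nonneg[of x] by (intro mult_left_mono) auto
    then show ?thesis using T_bound[OF u, of n x] by (simp add: mult.commute)
  qed
  obtain D where "countable D \<and> closure D = (UNIV :: 'a set)"
    using countable_dense_if_separable[OF separable] ..
  then have D: "countable D" "closure D = UNIV" by simp_all
  \<comment> \<open>Division by c brings all values into [-1, 1], the uniform bound that the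
    diagonal extraction asks for; the summand 1 keeps c positive where h vanishes.\<close>
  define c where "c x = H * h x + 1" for x
  have c: "c x > 0" for x unfolding c_def by (intro add_nonneg_pos mult_nonneg_nonneg H0 h_nonneg) simp
  obtain s where s: "strict_mono (s :: nat \<Rightarrow> nat)"
      "\<And>x. x \<in> D \<Longrightarrow> \<exists>l. (\<lambda>n. T (u (s n)) x / c x) \<longlonglongrightarrow> l"
  proof (rule function_convergent_subsequence[OF D(1), of "\<lambda>n x. T (u n) x / c x" 1])
    show "norm (T (u n) x / c x) \<le> 1" for n x
    proof -
      have "\<bar>T (u n) x\<bar> \<le> c x" using Tb[of n x] by (simp add: c_def)
      then show ?thesis using c[of x] by simp
    qed
  qed (rule that)
  have conv_D: "Cauchy (\<lambda>n. T (u (s n)) q)" if q: "q \<in> D" for q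
  proof -
    obtain l where "(\<lambda>n. T (u (s n)) q / c q) \<longlonglongrightarrow> l" using s(2)[OF q] by blast
    from tendsto_mult_right[OF this, of "c q"] have "(\<lambda>n. T (u (s n)) q) \<longlonglongrightarrow> l * c q"
      using c[of q] by simp
    then show ?thesis by (rule LIMSEQ_imp_Cauchy)
  qed
  have "convergent (\<lambda>n. T (u (s n)) x)" for x
  proof -
    obtain X where X: "\<And>j. X j \<in> D" "X \<longlonglongrightarrow> x"
      using D(2) closure_sequential[of x D] by auto
    have "Cauchy (\<lambda>n. T (u (s n)) x)"
    proof (rule metric_CauchyI)
      fix e :: real assume e: "0 < e"
      \<comment> \<open>One point \<open>X j\<close> of the dense set close to x serves all n at
        once and accounts for two thirds of e; the remaining third comes from convergence at
        \<open>X j\<close>.\<close>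
      have "eventually (\<lambda>j. ip (\<lambda>y. k x y - k (X j) y) (\<lambda>y. k x y - k (X j) y) < (e / 3)\<^sup>2) sequentially"
        using order_tendstoD(2)[OF k_section_tendsto[OF X(2)], of "(e / 3)\<^sup>2"] e by simp
      then obtain j where j: "ip (\<lambda>y. k x y - k (X j) y) (\<lambda>y. k x y - k (X j) y) < (e / 3)\<^sup>2"
        by (auto simp: eventually_sequentially)
      have near: "\<bar>T (u n) x - T (u n) (X j)\<bar> < e / 3" for n
      proof (rule power2_less_imp_less)
        let ?d = "\<lambda>y. k x y - k (X j) y"
        have d: "?d \<in> L2 M" by (intro L2_diff k_section_L2)
        have "(T (u n) x - T (u n) (X j))\<^sup>2 = (ip ?d (u n))\<^sup>2"
          by (simp add: T_eq_ip l2ip_diff_left k_section_L2 u)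
        also have "\<dots> \<le> ip ?d ?d * ip (u n) (u n)" by (rule l2ip_Cauchy_Schwarz[OF d u])
        also have "\<dots> \<le> ip ?d ?d * 1" by (intro mult_left_mono u1 l2ip_nonneg)
        also have "\<dots> < (e / 3)\<^sup>2" using j by simp
        finally show "\<bar>T (u n) x - T (u n) (X j)\<bar>\<^sup>2 < (e / 3)\<^sup>2" by simp
      qed (use e in simp)
      obtain N where N: "\<And>m n. m \<ge> N \<Longrightarrow> n \<ge> N \<Longrightarrow> dist (T (u (s m)) (X j)) (T (u (s n)) (X j)) < e / 3"
        using metric_CauchyD[OF conv_D[OF X(1)[of j]], of "e / 3"] e by auto
      have "dist (T (u (s m)) x) (T (u (s n)) x) < e" if "m \<ge> N" "n \<ge> N" for m n
        using N[OF that] near[of "s m"] near[of "s n"]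
        unfolding dist_real_def abs_less_iff by linarith
      then show "\<exists>N. \<forall>m\<ge>N. \<forall>n\<ge>N. dist (T (u (s m)) x) (T (u (s n)) x) < e" by blast
    qed
    then show ?thesis by (simp add: Cauchy_convergent_iff)
  qed
  then obtain g where g: "\<And>x. (\<lambda>n. T (u (s n)) x) \<longlonglongrightarrow> g x"
    unfolding convergent_def by metis
  have g_meas: "g \<in> borel_measurable M"
    by (rule borel_measurable_LIMSEQ_real[OF g]) (rule L2_D(1)[OF T_L2[OF u]])
  have gb: "\<bar>g x\<bar> \<le> H * h x" for x
    by (rule LIMSEQ_le_const2[OF tendsto_rabs[OF g[of x]]]) (use Tb in auto)
  have gL2: "g \<in> L2 M"
    by (rule L2_bound[OF L2_scale[OF h_L2, of H] g_meas]) (use gb abs_ge_self order_trans in blast)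
  have "(\<lambda>n. \<integral>x. (T (u (s n)) x - g x)\<^sup>2 \<partial>M) \<longlonglongrightarrow> (\<integral>x. 0 \<partial>M)"
  proof (rule integral_dominated_convergence)
    show "(\<lambda>x. (T (u (s n)) x - g x)\<^sup>2) \<in> borel_measurable M" for n
      using L2_D(1)[OF T_L2[OF u]] g_meas by measurable
    show "integrable M (\<lambda>x. (2 * H * h x)\<^sup>2)"
      using L2_scale[OF h_L2] by (simp add: L2_def)
    show "AE x in M. norm ((T (u (s n)) x - g x)\<^sup>2) \<le> (2 * H * h x)\<^sup>2" for n
    proof (rule AE_I2)
      fix x
      have "\<bar>T (u (s n)) x - g x\<bar> \<le> 2 * H * h x" using Tb[of "s n" x] gb[of x] by linarith
      then have "\<bar>T (u (s n)) x - g x\<bar>\<^sup>2 \<le> (2 * H * h x)\<^sup>2" by (intro power_mono) auto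
      then show "norm ((T (u (s n)) x - g x)\<^sup>2) \<le> (2 * H * h x)\<^sup>2" by simp
    qed
    show "AE x in M. (\<lambda>n. (T (u (s n)) x - g x)\<^sup>2) \<longlonglongrightarrow> 0"
    proof (rule AE_I2)
      fix x
      have "(\<lambda>n. (T (u (s n)) x - g x)\<^sup>2) \<longlonglongrightarrow> (g x - g x)\<^sup>2"
        by (intro tendsto_intros g)
      then show "(\<lambda>n. (T (u (s n)) x - g x)\<^sup>2) \<longlonglongrightarrow> 0" by simp
    qed
  qed simp
  then have "(\<lambda>n. ip (\<lambda>x. T (u (s n)) x - g x) (\<lambda>x. T (u (s n)) x - g x)) \<longlonglongrightarrow> 0"
    by (simp add: l2ip_def power2_eq_square)
  with s(1) gL2 g show thesis by (rule that)
qed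

text \<open>\<open>ip h h\<close> is the L^2 norm of the dominating kernel \<open>h x * h y\<close>,
  hence a bound for the Hilbert-Schmidt norm of T. It keeps the Rayleigh quotients bounded, so that
  their supremum makes sense.\<close>

lemma T_form_bound:
  assumes "u \<in> L2 M"
  shows "\<bar>ip (T u) u\<bar> \<le> ip h h * ip u u"
proof (rule power2_le_imp_le)
  have "ip (T u) (T u) \<le> (\<integral>x. (h x * h x) * (ip h h * ip u u) \<partial>M)"
    unfolding l2ip_def[of M "T u"]
  proof (rule integral_mono)
    show "integrable M (\<lambda>x. T u x * T u x)" by (intro L2_mult_integrable T_L2 assms)
    show "integrable M (\<lambda>x. (h x * h x) * (ip h h * ip u u))"
      by (intro integrable_mult_left L2_mult_integrable h_L2)
    show "T u x * T u x \<le> h x * h x * (ip h h * ip u u)" for x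
      using T_bound_sq[OF assms, of x] by (simp add: power2_eq_square)
  qed
  also have "\<dots> = ip h h * (ip h h * ip u u)" by (simp add: l2ip_def)
  finally have "ip (T u) (T u) * ip u u \<le> ip h h * (ip h h * ip u u) * ip u u"
    by (intro mult_right_mono l2ip_nonneg)
  then show "\<bar>ip (T u) u\<bar>\<^sup>2 \<le> (ip h h * ip u u)\<^sup>2"
    using l2ip_Cauchy_Schwarz[OF T_L2[OF assms] assms] by (simp add: power2_eq_square mult_ac)
  show "0 \<le> ip h h * ip u u" by (simp add: l2ip_nonneg)
qed

text \<open>Self-adjointness merges the two mixed terms. The parameter c covers both forms in use:
  \<open>c = \<Lambda>\<close> gives the form of \<Lambda> - T, and \<open>c = 0\<close> gives minus
  the form of T.\<close>

lemma form_add_scale: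
  assumes "u \<in> L2 M" "v \<in> L2 M"
  shows "c * ip (\<lambda>x. u x + t * v x) (\<lambda>x. u x + t * v x) - ip (T (\<lambda>x. u x + t * v x)) (\<lambda>x. u x + t * v x)
    = (c * ip u u - ip (T u) u) + 2 * t * (c * ip u v - ip (T u) v) + t\<^sup>2 * (c * ip v v - ip (T v) v)"
proof -
  have "T (\<lambda>x. u x + t * v x) = (\<lambda>x. T u x + t * T v x)"
    by (rule ext) (simp add: T_add[OF assms(1) L2_scale[OF assms(2)]] T_scale)
  moreover have "ip (T v) u = ip (T u) v"
    using T_selfadjoint[OF assms] by (simp add: l2ip_commute)
  ultimately show ?thesis
    using assms
    by (simp add: l2ip_add_left l2ip_add_right l2ip_scale_left l2ip_scale_right L2_add L2_scale T_L2
        l2ip_commute[of M v u] power2_eq_square algebra_simps)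
qed

end

section \<open>Eigenfunctions of a symmetric kernel\<close>

context sym_kernel
begin

text \<open>The equation is demanded at every point. For \<open>r \<noteq> 0\<close> this selects
  the continuous representative, as e is then a multiple of an image of T.\<close>

definition eigvec :: "real \<Rightarrow> ('a \<Rightarrow> real) \<Rightarrow> bool" where
  "eigvec r e \<longleftrightarrow> e \<in> L2 M \<and> (\<forall>x. T e x = r * e x)"

lemma eigvec_ip:
  assumes "eigvec r e" "u \<in> L2 M"
  shows "ip (T u) e = r * ip u e"
proof -
  have "ip (T u) e = ip u (T e)" using assms by (simp add: T_selfadjoint eigvec_def)
  also have "T e = (\<lambda>x. r * e x)" using assms by (auto simp: eigvec_def)
  finally show ?thesis by (simp add: l2ip_scale_right)
qed

lemma eigvec_continuous:
  assumes "eigvec r e" "r \<noteq> 0"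
  shows "continuous_on UNIV e"
proof -
  have "e = (\<lambda>x. T e x / r)" using assms by (auto simp: eigvec_def)
  moreover have "continuous_on UNIV (\<lambda>x. T e x / r)"
    using assms by (intro continuous_intros T_continuous) (auto simp: eigvec_def)
  ultimately show ?thesis by metis
qed

definition perp :: "('a \<Rightarrow> real) set \<Rightarrow> ('a \<Rightarrow> real) set" where
  "perp S = {u \<in> L2 M. \<forall>e\<in>S. ip u e = 0}"

text \<open>With \<Lambda> the supremum of the Rayleigh quotients on \<open>perp S\<close>, the form
  of \<Lambda> - T is nonnegative there, and Cauchy-Schwarz bounds the squared norm of (\<Lambda> -
  T) u by a multiple of this form at u. Along a maximising sequence (\<Lambda> - T) u therefore
  tends to 0, while T u tends to some g on a subsequence; so \<Lambda> u tends to g as well, and g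
  is an eigenfunction for \<Lambda>.\<close>

lemma exists_positive_eigvec:
  assumes S: "\<And>e. e \<in> S \<Longrightarrow> \<exists>r. eigvec r e"
    and w: "w \<in> perp S" "0 < ip (T w) w"
  shows "\<exists>v r. v \<in> perp S \<and> 0 < r \<and> eigvec r v \<and> ip v v = 1"
proof -
  have SL2: "e \<in> L2 M" if "e \<in> S" for e using S[OF that] by (auto simp: eigvec_def)
  have perp_lin: "(\<lambda>x. u x + t * v x) \<in> perp S" if "u \<in> perp S" "v \<in> perp S" for u v t
    using that SL2 by (auto simp: perp_def l2ip_add_left l2ip_scale_left L2_add L2_scale)
  have perp_scale: "(\<lambda>x. t * v x) \<in> perp S" if "v \<in> perp S" for v t
    using that by (auto simp: perp_def l2ip_scale_left L2_scale)
  \<comment> \<open>Invariance, because T is self-adjoint and S consists of eigenfunctions.\<close>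
  have perp_T: "T u \<in> perp S" if "u \<in> perp S" for u
  proof -
    have u: "u \<in> L2 M" using that by (simp add: perp_def)
    have "ip (T u) e = 0" if e: "e \<in> S" for e
    proof -
      obtain r where "eigvec r e" using S[OF e] by blast
      then show ?thesis using eigvec_ip[of r e u] u \<open>u \<in> perp S\<close> e by (simp add: perp_def)
    qed
    then show ?thesis using T_L2[OF u] by (simp add: perp_def)
  qed
  define H where "H = ip h h"
  define Q where "Q = {ip (T u) u | u. u \<in> perp S \<and> ip u u = 1}"
  define \<Lambda> where "\<Lambda> = Sup Q"
  have normalise: "(\<lambda>x. inverse (sqrt (ip u u)) * u x) \<in> perp S"
      "ip (\<lambda>x. inverse (sqrt (ip u u)) * u x) (\<lambda>x. inverse (sqrt (ip u u)) * u x) = 1"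
      "ip (T (\<lambda>x. inverse (sqrt (ip u u)) * u x)) (\<lambda>x. inverse (sqrt (ip u u)) * u x) = ip (T u) u / ip u u"
    if "u \<in> perp S" "ip u u > 0" for u
  proof -
    have sq: "inverse (sqrt (ip u u)) * inverse (sqrt (ip u u)) = inverse (ip u u)"
      using that(2) by (simp flip: inverse_mult_distrib)
    show "(\<lambda>x. inverse (sqrt (ip u u)) * u x) \<in> perp S" using that perp_scale by blast
    show "ip (\<lambda>x. inverse (sqrt (ip u u)) * u x) (\<lambda>x. inverse (sqrt (ip u u)) * u x) = 1"
      using that(2) by (simp add: l2ip_scale_left l2ip_scale_right mult.assoc[symmetric] sq)
    have "T (\<lambda>x. inverse (sqrt (ip u u)) * u x) = (\<lambda>x. inverse (sqrt (ip u u)) * T u x)"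
      by (rule ext) (rule T_scale)
    then show "ip (T (\<lambda>x. inverse (sqrt (ip u u)) * u x)) (\<lambda>x. inverse (sqrt (ip u u)) * u x) = ip (T u) u / ip u u"
      by (simp add: l2ip_scale_left l2ip_scale_right mult.assoc[symmetric] sq)
        (simp add: divide_inverse)
  qed
  have bdd: "bdd_above Q"
  proof (rule bdd_aboveI)
    show "q \<le> H" if "q \<in> Q" for q
      using that T_form_bound by (force simp: Q_def H_def perp_def abs_le_iff)
  qed
  have ww: "ip w w > 0"
  proof -
    have "ip w w \<noteq> 0"
      using T_form_bound[of w] w by (auto simp: perp_def)
    then show ?thesis using l2ip_nonneg[of M w] by simp
  qed
  have inQ: "ip (T u) u / ip u u \<in> Q" if "u \<in> perp S" "ip u u > 0" for u
    unfolding Q_def using normalise[OF that]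
    by (intro CollectI exI[of _ "\<lambda>x. inverse (sqrt (ip u u)) * u x"]) simp
  have "0 < ip (T w) w / ip w w" using w(2) ww by simp
  also have "\<dots> \<le> \<Lambda>" unfolding \<Lambda>_def by (rule cSup_upper[OF inQ[OF w(1) ww] bdd])
  finally have \<Lambda>: "0 < \<Lambda>" .
  have Q0: "Q \<noteq> {}" using inQ[OF w(1) ww] by auto
  have le\<Lambda>: "ip (T u) u \<le> \<Lambda> * ip u u" if u: "u \<in> perp S" for u
  proof (cases "ip u u = 0")
    case True
    then show ?thesis using T_form_bound[of u] u by (auto simp: perp_def)
  next
    case False
    then have "ip u u > 0" using l2ip_nonneg[of M u] by simp
    then have "ip (T u) u / ip u u \<in> Q" using inQ[OF u] by simp
    then have "ip (T u) u / ip u u \<le> \<Lambda>" unfolding \<Lambda>_def by (rule cSup_upper[OF _ bdd])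
    then show ?thesis using \<open>ip u u > 0\<close> by (simp add: field_simps)
  qed
  define a where "a u v = \<Lambda> * ip u v - ip (T u) v" for u v
  have a_CS: "(a u v)\<^sup>2 \<le> a u u * a v v" if "u \<in> perp S" "v \<in> perp S" for u v
  proof (rule positive_form_Cauchy_Schwarz[of a u v])
    show "0 \<le> a (\<lambda>x. u x + t * v x) (\<lambda>x. u x + t * v x)" for t
      using le\<Lambda>[OF perp_lin[OF that]] by (simp add: a_def)
    show "a (\<lambda>x. u x + t * v x) (\<lambda>x. u x + t * v x) = a u u + 2 * t * a u v + t\<^sup>2 * a v v" for t
      unfolding a_def using that by (intro form_add_scale) (auto simp: perp_def)
  qed
  \<comment> \<open>Cauchy-Schwarz for a, tested with
    \<open>v = (\<lambda>x. \<Lambda> * u x - T u x)\<close>, for which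
    \<open>a u v = ip v v\<close>; one factor \<open>ip v v\<close> cancels.\<close>
  have residual: "ip (\<lambda>x. \<Lambda> * u x - T u x) (\<lambda>x. \<Lambda> * u x - T u x) \<le> (\<Lambda> + H) * a u u"
    if u: "u \<in> perp S" for u
  proof -
    define v where "v = (\<lambda>x. \<Lambda> * u x - T u x)"
    have uL2: "u \<in> L2 M" using u by (simp add: perp_def)
    have "(\<lambda>x. \<Lambda> * u x + (-1) * T u x) \<in> perp S"
      by (rule perp_lin[OF perp_scale[OF u] perp_T[OF u]])
    then have v: "v \<in> perp S" by (simp add: v_def)
    then have vL2: "v \<in> L2 M" by (simp add: perp_def)
    have "a u v = ip (\<lambda>x. \<Lambda> * u x - T u x) v"
      unfolding a_def by (simp add: l2ip_diff_left l2ip_scale_left L2_scale uL2 vL2 T_L2)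
    then have auv: "a u v = ip v v" unfolding v_def .
    then have "ip v v * ip v v \<le> a u u * a v v"
      using a_CS[OF u v] by (simp add: power2_eq_square)
    also have "\<dots> \<le> a u u * ((\<Lambda> + H) * ip v v)"
    proof (rule mult_left_mono)
      show "a v v \<le> (\<Lambda> + H) * ip v v"
        using T_form_bound[OF vL2] by (simp add: a_def H_def distrib_right)
      show "0 \<le> a u u" using le\<Lambda>[OF u] by (simp add: a_def)
    qed
    finally have "ip v v * ip v v \<le> ((\<Lambda> + H) * a u u) * ip v v" by (simp add: mult_ac)
    moreover have "0 \<le> (\<Lambda> + H) * a u u"
      using \<Lambda> l2ip_nonneg[of M h] le\<Lambda>[OF u] by (simp add: a_def H_def)
    ultimately have "ip v v \<le> (\<Lambda> + H) * a u u"
      using l2ip_nonneg[of M v] by (cases "ip v v = 0") (auto simp: mult_le_cancel_right)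
    then show ?thesis by (simp add: v_def)
  qed
  have "\<exists>u. u \<in> perp S \<and> ip u u = 1 \<and> \<Lambda> - inverse (real (Suc n)) < ip (T u) u" for n
  proof -
    have "\<Lambda> - inverse (real (Suc n)) < Sup Q" by (simp add: \<Lambda>_def)
    then obtain q where "q \<in> Q" "\<Lambda> - inverse (real (Suc n)) < q"
      using less_cSup_iff[OF Q0 bdd] by blast
    then show ?thesis by (auto simp: Q_def)
  qed
  then obtain u where u: "\<And>n. u n \<in> perp S" "\<And>n. ip (u n) (u n) = 1"
      "\<And>n. \<Lambda> - inverse (real (Suc n)) < ip (T (u n)) (u n)"
    by metis
  have uL2: "u n \<in> L2 M" for n using u(1)[of n] by (simp add: perp_def)
  obtain s g where s: "strict_mono s" and gL2: "g \<in> L2 M"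
    and g: "\<And>x. (\<lambda>n. T (u (s n)) x) \<longlonglongrightarrow> g x"
    and g2: "(\<lambda>n. ip (\<lambda>x. T (u (s n)) x - g x) (\<lambda>x. T (u (s n)) x - g x)) \<longlonglongrightarrow> 0"
    by (rule T_compact[of u]) (simp_all add: uL2 u(2))
  define p where "p n = (\<lambda>x. \<Lambda> * u (s n) x - T (u (s n)) x)" for n
  define q where "q n = (\<lambda>x. T (u (s n)) x - g x)" for n
  define z where "z n = (\<lambda>x. \<Lambda> * u (s n) x - g x)" for n
  have pL2: "p n \<in> L2 M" and qL2: "q n \<in> L2 M" and zL2: "z n \<in> L2 M" for n
    unfolding p_def q_def z_def by (intro L2_diff L2_scale uL2 T_L2 gL2)+
  have z_eq: "z n = (\<lambda>x. p n x + q n x)" for n by (simp add: p_def q_def z_def)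
  have p0: "(\<lambda>n. ip (p n) (p n)) \<longlonglongrightarrow> 0"
  proof (rule tendsto_sandwich[OF _ _ tendsto_const])
    show "(\<lambda>n. (\<Lambda> + H) * inverse (real (Suc (s n)))) \<longlonglongrightarrow> 0"
      using tendsto_mult_right_zero[OF LIMSEQ_subseq_LIMSEQ[OF LIMSEQ_inverse_real_of_nat s]]
      by (simp add: o_def)
    have "ip (p n) (p n) \<le> (\<Lambda> + H) * inverse (real (Suc (s n)))" for n
    proof -
      have "ip (p n) (p n) \<le> (\<Lambda> + H) * a (u (s n)) (u (s n))"
        unfolding p_def by (rule residual[OF u(1)])
      also have "\<dots> \<le> (\<Lambda> + H) * inverse (real (Suc (s n)))"
        using u(2)[of "s n"] u(3)[of "s n"] \<Lambda> l2ip_nonneg[of M h]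
        by (intro mult_left_mono) (auto simp: a_def H_def)
      finally show ?thesis .
    qed
    then show "\<forall>\<^sub>F n in sequentially. ip (p n) (p n) \<le> (\<Lambda> + H) * inverse (real (Suc (s n)))" by simp
  qed (simp add: l2ip_nonneg)
  have z0: "(\<lambda>n. ip (z n) (z n)) \<longlonglongrightarrow> 0"
  proof (rule tendsto_sandwich[OF _ _ tendsto_const])
    show "(\<lambda>n. 2 * ip (p n) (p n) + 2 * ip (q n) (q n)) \<longlonglongrightarrow> 0"
      using tendsto_add[OF tendsto_mult_left[OF p0, of 2] tendsto_mult_left[OF g2, of 2]]
      by (simp add: q_def)
    have "ip (z n) (z n) \<le> 2 * ip (p n) (p n) + 2 * ip (q n) (q n)" for n
    proof -
      have "0 \<le> ip (\<lambda>x. p n x - q n x) (\<lambda>x. p n x - q n x)" by (rule l2ip_nonneg)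
      then show ?thesis unfolding z_eq
        by (simp add: l2ip_diff_left l2ip_diff_right l2ip_add_left l2ip_add_right pL2 qL2 L2_add L2_diff)
    qed
    then show "\<forall>\<^sub>F n in sequentially. ip (z n) (z n) \<le> 2 * ip (p n) (p n) + 2 * ip (q n) (q n)" by simp
  qed (simp add: l2ip_nonneg)
  have ze: "(\<lambda>n. ip (z n) e) \<longlonglongrightarrow> 0" if "e \<in> L2 M" for e
    by (rule l2ip_tendsto_0[OF zL2 that z0])
  \<comment> \<open>\<open>T (z n) x\<close> tends to 0, but it equals
    \<open>\<Lambda> * T (u (s n)) x - T g x\<close>, whose limit is
    \<open>\<Lambda> * g x - T g x\<close> by the choice of the subsequence.\<close>
  have Tg: "T g x = \<Lambda> * g x" for x
  proof -
    have "(\<lambda>n. T (z n) x) \<longlonglongrightarrow> 0"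
      using ze[OF k_section_L2[of x]] by (simp add: T_eq_ip l2ip_commute)
    moreover have "T (z n) x = \<Lambda> * T (u (s n)) x - T g x" for n
      unfolding z_def by (simp add: T_diff L2_scale uL2 gL2 T_scale)
    ultimately have "(\<lambda>n. \<Lambda> * T (u (s n)) x - T g x) \<longlonglongrightarrow> 0" by simp
    moreover have "(\<lambda>n. \<Lambda> * T (u (s n)) x - T g x) \<longlonglongrightarrow> \<Lambda> * g x - T g x"
      by (intro tendsto_intros g)
    ultimately have "\<Lambda> * g x - T g x = 0" by (rule LIMSEQ_unique[rotated])
    then show ?thesis by simp
  qed
  have g_perp: "g \<in> perp S"
  proof -
    have "ip g e = 0" if e: "e \<in> S" for e
    proof -
      have "ip (z n) e = - ip g e" for n
        using u(1)[of "s n"] e SL2[OF e] unfolding z_def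
        by (simp add: l2ip_diff_left L2_scale uL2 gL2 l2ip_scale_left perp_def)
      then show ?thesis using ze[OF SL2[OF e]] by (simp add: LIMSEQ_const_iff)
    qed
    then show ?thesis using gL2 by (simp add: perp_def)
  qed
  \<comment> \<open>The limit must not vanish: \<Lambda> times \<open>u (s n)\<close> has squared
    norm \<Lambda>^2 and differs from g by \<open>z n\<close>, which tends to 0.\<close>
  have gg: "ip g g = \<Lambda>\<^sup>2"
  proof -
    have "\<Lambda>\<^sup>2 = ip g g + 2 * ip (z n) g + ip (z n) (z n)" for n
    proof -
      have "\<Lambda>\<^sup>2 = ip (\<lambda>x. \<Lambda> * u (s n) x) (\<lambda>x. \<Lambda> * u (s n) x)"
        using u(2)[of "s n"] by (simp add: l2ip_scale_left l2ip_scale_right power2_eq_square)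
      also have "(\<lambda>x. \<Lambda> * u (s n) x) = (\<lambda>x. g x + z n x)" by (simp add: z_def)
      finally show ?thesis
        by (simp add: l2ip_add_left l2ip_add_right gL2 zL2 L2_add l2ip_commute[of M g "z n"])
    qed
    moreover have "(\<lambda>n. ip g g + 2 * ip (z n) g + ip (z n) (z n)) \<longlonglongrightarrow> ip g g + 2 * 0 + 0"
      by (intro tendsto_intros ze gL2 z0)
    ultimately have "(\<lambda>n::nat. \<Lambda>\<^sup>2) \<longlonglongrightarrow> ip g g" by simp
    then show ?thesis by (simp add: LIMSEQ_const_iff)
  qed
  define v where "v = (\<lambda>x. inverse \<Lambda> * g x)"
  have "v \<in> perp S" unfolding v_def by (rule perp_scale[OF g_perp])
  moreover have "eigvec \<Lambda> v"
    unfolding eigvec_def v_def using Tg \<Lambda> by (simp add: L2_scale gL2 T_scale)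
  moreover have "ip v v = 1"
    unfolding v_def l2ip_scale_left l2ip_scale_right gg using \<Lambda>
    by (simp add: power2_eq_square field_simps)
  ultimately show ?thesis using \<Lambda> by blast
qed

end

section \<open>Positive semidefinite kernels and their eigenfunction expansion\<close>

text \<open>Beyond a finite head z has small norm, and the head meets only finitely many coordinates
  of \<open>w n\<close>. The use is continuity of \<open>inner (f x) (f y)\<close> in y for a map f
  whose continuity in norm is not known.\<close>

lemma ell2_bounded_weak_tendsto:
  fixes w :: "nat \<Rightarrow> ell2"
  assumes bd: "\<And>n. norm (w n) \<le> C" and lim: "\<And>i. (\<lambda>n. coord (w n) i) \<longlonglongrightarrow> coord l i"
  shows "(\<lambda>n. inner z (w n)) \<longlonglongrightarrow> inner z l"
proof (rule metric_LIMSEQ_I)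
  fix \<epsilon> :: real assume \<epsilon>: "0 < \<epsilon>"
  \<comment> \<open>K bounds \<open>norm (w n - l)\<close>; the 1 makes it a legitimate
    divisor.\<close>
  define K where "K = C + norm l + 1"
  have K: "0 < K" using bd[of 0] norm_ge_zero[of "w 0"] norm_ge_zero[of l] unfolding K_def by linarith
  have "(\<lambda>m. \<Sum>i. (coord z (i + m))\<^sup>2) \<longlonglongrightarrow> 0"
    by (rule suminf_exist_split2[OF summable_coord])
  then have "\<forall>\<^sub>F m in sequentially. (\<Sum>i. (coord z (i + m))\<^sup>2) < (\<epsilon> / (2 * K))\<^sup>2"
    using \<epsilon> K by (intro order_tendstoD(2)) auto
  then obtain m where m: "(\<Sum>i. (coord z (i + m))\<^sup>2) < (\<epsilon> / (2 * K))\<^sup>2"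
    by (auto simp: eventually_sequentially)
  define t where "t = Abs_ell2 (\<lambda>i. if i < m then 0 else coord z i)"
  have t: "coord t = (\<lambda>i. if i < m then 0 else coord z i)"
    unfolding t_def
    by (rule Abs_ell2_inverse) (auto intro!: summable_comparison_test'[OF summable_coord[of z]])
  have split: "inner z w = (\<Sum>i<m. coord z i * coord w i) + inner t w" for w :: ell2
  proof -
    have "inner z w = (\<Sum>i. coord z (i + m) * coord w (i + m)) + (\<Sum>i<m. coord z i * coord w i)"
      unfolding inner_ell2_def by (rule suminf_split_initial_segment[OF summable_coord_prod])
    moreover have "inner t w = (\<Sum>i. coord t (i + m) * coord w (i + m)) + (\<Sum>i<m. coord t i * coord w i)"
      unfolding inner_ell2_def by (rule suminf_split_initial_segment[OF summable_coord_prod])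
    ultimately show ?thesis by (simp add: t)
  qed
  have nt: "norm t < \<epsilon> / (2 * K)"
  proof (rule power2_less_imp_less)
    have "(norm t)\<^sup>2 = (\<Sum>i. (coord t (i + m))\<^sup>2) + (\<Sum>i<m. (coord t i)\<^sup>2)"
      unfolding norm_ell2_power2 by (rule suminf_split_initial_segment[OF summable_coord])
    then show "(norm t)\<^sup>2 < (\<epsilon> / (2 * K))\<^sup>2" using m by (simp add: t)
  qed (use \<epsilon> K in simp)
  have part: "(\<lambda>n. \<Sum>i<m. coord z i * coord (w n) i) \<longlonglongrightarrow> (\<Sum>i<m. coord z i * coord l i)"
    by (intro tendsto_intros lim)
  have "0 < \<epsilon> / 2" using \<epsilon> by simp
  from metric_LIMSEQ_D[OF part this] obtain N where N: "\<And>n. n \<ge> N \<Longrightarrow>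
      dist (\<Sum>i<m. coord z i * coord (w n) i) (\<Sum>i<m. coord z i * coord l i) < \<epsilon> / 2"
    by auto
  have "dist (inner z (w n)) (inner z l) < \<epsilon>" if "n \<ge> N" for n
  proof -
    have "\<bar>inner t (w n) - inner t l\<bar> = \<bar>inner t (w n - l)\<bar>" by (simp add: inner_diff_right)
    also have "\<dots> \<le> norm t * norm (w n - l)" by (rule Cauchy_Schwarz_ineq2)
    also have "\<dots> \<le> norm t * K"
      using bd[of n] norm_triangle_ineq4[of "w n" l]
      by (intro mult_left_mono) (auto simp: K_def)
    also have "\<dots> \<le> \<epsilon> / 2" using nt K by (simp add: field_simps)
    finally have "\<bar>inner t (w n) - inner t l\<bar> \<le> \<epsilon> / 2" .
    moreover have "\<bar>(\<Sum>i<m. coord z i * coord (w n) i) - (\<Sum>i<m. coord z i * coord l i)\<bar> < \<epsilon> / 2"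
      using N[OF that] by (simp add: dist_real_def)
    ultimately show ?thesis
      unfolding dist_real_def split[of "w n"] split[of l] abs_less_iff abs_le_iff by linarith
  qed
  then show "\<exists>N. \<forall>n\<ge>N. dist (inner z (w n)) (inner z l) < \<epsilon>" by blast
qed

section \<open>Finite systems of eigenfunctions of a positive semidefinite kernel\<close>

locale psd_kernel = sym_kernel +
  assumes psd: "\<And>u. u \<in> L2 M \<Longrightarrow> 0 \<le> ip (T u) u"
    and full: "\<And>U. open U \<Longrightarrow> U \<noteq> {} \<Longrightarrow> 0 < measure M U"
begin

lemma open_in_M: "open U \<Longrightarrow> U \<in> sets M"
  by (simp add: sets_M)

text \<open>The set where a continuous function is nonzero is open, so under full support it is
  empty or of positive measure. Together with the diagonal bound below, this is where full support
  acts.\<close>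

lemma AE_zero_continuous:
  fixes r :: "'a \<Rightarrow> real"
  assumes "continuous_on UNIV r" "AE x in M. r x = 0"
  shows "r x = 0"
proof (rule ccontr)
  assume "r x \<noteq> 0"
  have o: "open {x. r x \<noteq> 0}"
    by (rule open_Collect_neq[OF assms(1) continuous_on_const])
  have "emeasure M {x. r x \<noteq> 0} = 0"
    using assms(2) AE_iff_measurable[of "{x. r x \<noteq> 0}" M "\<lambda>x. r x = 0"] open_in_M[OF o]
    by (simp add: space_M)
  then have "measure M {x. r x \<noteq> 0} = 0" by (simp add: measure_def)
  then show False using full[OF o] \<open>r x \<noteq> 0\<close> by auto
qed

text \<open>The index type is left free: Zorn's lemma yields a set of pairs (eigenvalue,
  eigenfunction) that indexes itself through \<open>fst\<close> and \<open>snd\<close>, while the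
  eigenmap is indexed by natural numbers.\<close>

definition orthonormal_eigensystem :: "'i set \<Rightarrow> ('i \<Rightarrow> real) \<Rightarrow> ('i \<Rightarrow> 'a \<Rightarrow> real) \<Rightarrow> bool" where
  "orthonormal_eigensystem I l e \<longleftrightarrow>
     (\<forall>i\<in>I. 0 < l i \<and> eigvec (l i) (e i)) \<and>
     (\<forall>i\<in>I. \<forall>j\<in>I. ip (e i) (e j) = (if i = j then 1 else 0))"

lemma orthonormal_eigensystem_mono:
  "orthonormal_eigensystem I l e \<Longrightarrow> F \<subseteq> I \<Longrightarrow> orthonormal_eigensystem F l e"
  unfolding orthonormal_eigensystem_def by blast

text \<open>The form of T is nonnegative at v minus its projection p. As \<open>ip (T v) p\<close>,
  \<open>ip (T p) v\<close> and \<open>ip (T p) p\<close> all equal B, its value there is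
  \<open>ip (T v) v - B\<close>.\<close>

lemma eigensystem_Bessel:
  assumes es: "orthonormal_eigensystem F l e" and F: "finite F" and v: "v \<in> L2 M"
  shows "(\<Sum>i\<in>F. l i * (ip v (e i))\<^sup>2) \<le> ip (T v) v"
proof -
  have e: "\<And>i. i \<in> F \<Longrightarrow> e i \<in> L2 M" "\<And>i. i \<in> F \<Longrightarrow> eigvec (l i) (e i)"
    and on: "\<And>i j. i \<in> F \<Longrightarrow> j \<in> F \<Longrightarrow> ip (e i) (e j) = (if i = j then 1 else 0)"
    using es by (auto simp: orthonormal_eigensystem_def eigvec_def)
  define c where "c i = ip v (e i)" for i
  define p where "p = (\<lambda>x. \<Sum>i\<in>F. c i * e i x)"
  define B where "B = (\<Sum>i\<in>F. l i * (c i)\<^sup>2)"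
  have p: "p \<in> L2 M" unfolding p_def using e by (intro L2_sum L2_scale)
  have ip_p: "ip u p = (\<Sum>i\<in>F. c i * ip u (e i))" if "u \<in> L2 M" for u
    unfolding p_def using e that by (simp add: l2ip_sum_right L2_scale l2ip_scale_right)
  have pe: "ip p (e j) = c j" if j: "j \<in> F" for j
  proof -
    have "ip p (e j) = (\<Sum>i\<in>F. c i * ip (e j) (e i))"
      using ip_p[OF e(1)[OF j]] by (simp add: l2ip_commute)
    also have "\<dots> = (\<Sum>i\<in>F. if j = i then c i else 0)"
      using on j by (intro sum.cong) auto
    finally show ?thesis using F j by simp
  qed
  have Tvp: "ip (T v) p = B"
    unfolding ip_p[OF T_L2[OF v]] B_def using eigvec_ip[OF e(2) v]
    by (intro sum.cong) (auto simp: c_def power2_eq_square)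
  have Tpp: "ip (T p) p = B"
    unfolding ip_p[OF T_L2[OF p]] B_def using eigvec_ip[OF e(2) p] pe
    by (intro sum.cong) (auto simp: power2_eq_square)
  have Tpv: "ip (T p) v = B" using T_selfadjoint[OF p v] Tvp by (simp add: l2ip_commute)
  have "T (\<lambda>x. v x - p x) = (\<lambda>x. T v x - T p x)" by (rule ext) (rule T_diff[OF v p])
  then have "ip (T (\<lambda>x. v x - p x)) (\<lambda>x. v x - p x) = ip (T v) v - B"
    using Tvp Tpp Tpv v p by (simp add: l2ip_diff_left l2ip_diff_right T_L2 L2_diff)
  then show ?thesis using psd[OF L2_diff[OF v p]] by (simp add: B_def c_def)
qed

lemma indicator_L2: "U \<in> sets M \<Longrightarrow> indicator U \<in> L2 M"
  by (rule L2_bound[of "\<lambda>_. 1"]) (auto simp: L2_def indicator_def)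

text \<open>Were the residual kernel negative at a diagonal point, its form would be negative on the
  indicator function of a small neighbourhood of this point.\<close>

lemma eigensystem_diagonal:
  assumes es: "orthonormal_eigensystem F l e" and F: "finite F"
  shows "(\<Sum>i\<in>F. l i * (e i x)\<^sup>2) \<le> k x x"
proof (rule ccontr)
  have e: "\<And>i. i \<in> F \<Longrightarrow> e i \<in> L2 M" "\<And>i. i \<in> F \<Longrightarrow> continuous_on UNIV (e i)"
    using es eigvec_continuous by (fastforce simp: orthonormal_eigensystem_def eigvec_def)+
  define r where "r p = k (fst p) (snd p) - (\<Sum>i\<in>F. l i * e i (fst p) * e i (snd p))" for p
  have e12: "continuous_on UNIV (\<lambda>p. e i (fst p))" "continuous_on UNIV (\<lambda>p. e i (snd p))"
    if "i \<in> F" for i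
    using that e(2) by (auto intro!: continuous_on_compose2[OF e(2)] continuous_intros)
  have r: "continuous_on UNIV r"
    unfolding r_def using e12 by (intro continuous_intros k_continuous) auto
  assume "\<not> (\<Sum>i\<in>F. l i * (e i x)\<^sup>2) \<le> k x x"
  then have "r (x, x) < 0" by (simp add: r_def power2_eq_square mult.assoc)
  define \<epsilon> where "\<epsilon> = - r (x, x) / 2"
  have \<epsilon>: "0 < \<epsilon>" "r (x, x) < - \<epsilon>" using \<open>r (x, x) < 0\<close> by (auto simp: \<epsilon>_def)
  have "open {p. r p < - \<epsilon>}"
    using r by (intro open_Collect_less continuous_on_const)
  then obtain A B where AB: "open A" "open B" "x \<in> A" "x \<in> B" "A \<times> B \<subseteq> {p. r p < - \<epsilon>}"
    using \<epsilon>(2) by (elim open_prod_elim[of _ "(x, x)"]) auto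
  define U where "U = A \<inter> B"
  have U: "open U" "U \<in> sets M" "0 < measure M U"
    using AB full[of U] open_in_M[of U] by (auto simp: U_def)
  define v :: "'a \<Rightarrow> real" where "v = indicator U"
  have v: "v \<in> L2 M" unfolding v_def by (rule indicator_L2[OF U(2)])
  have int_v: "(\<integral>y. v y \<partial>M) = measure M U" "integrable M v"
    using U integrable_L2[OF v] by (auto simp: v_def space_M)
  define G where "G y = T v y - (\<Sum>i\<in>F. (l i * ip v (e i)) * e i y)" for y
  have sum_L2: "(\<lambda>y. \<Sum>i\<in>F. (l i * ip v (e i)) * e i y) \<in> L2 M"
    by (intro L2_sum L2_scale e)
  have G: "G \<in> L2 M"
    unfolding G_def by (intro L2_diff T_L2 sum_L2 v)
  have G_le: "G y \<le> - \<epsilon> * measure M U" if y: "y \<in> U" for y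
  proof -
    have ek: "integrable M (\<lambda>z. (\<Sum>i\<in>F. l i * e i y * e i z) * v z)"
      by (intro L2_mult_integrable L2_sum L2_scale e v)
    have "ip (\<lambda>z. \<Sum>i\<in>F. (l i * e i y) * e i z) v = (\<Sum>i\<in>F. (l i * e i y) * ip (e i) v)"
      by (subst l2ip_sum_left) (simp_all only: L2_scale e v l2ip_scale_left)
    then have "(\<integral>z. (\<Sum>i\<in>F. l i * e i y * e i z) * v z \<partial>M) = (\<Sum>i\<in>F. (l i * ip v (e i)) * e i y)"
      by (simp add: l2ip_def mult_ac)
    then have "G y = (\<integral>z. k y z * v z \<partial>M) - (\<integral>z. (\<Sum>i\<in>F. l i * e i y * e i z) * v z \<partial>M)"
      unfolding G_def T_def by simp
    also have "\<dots> = (\<integral>z. r (y, z) * v z \<partial>M)"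
      using k_mult_integrable[OF v] ek by (simp add: r_def left_diff_distrib)
    also have "\<dots> \<le> (\<integral>z. - \<epsilon> * v z \<partial>M)"
    proof (rule integral_mono)
      show "integrable M (\<lambda>z. r (y, z) * v z)"
        using k_mult_integrable[OF v] ek by (simp add: r_def left_diff_distrib)
      show "integrable M (\<lambda>z. - \<epsilon> * v z)" using int_v by simp
      show "r (y, z) * v z \<le> - \<epsilon> * v z" for z
        using AB(5) y by (auto simp: v_def U_def indicator_def)
    qed
    finally show ?thesis using int_v by simp
  qed
  have "ip G v = ip (T v) v - (\<Sum>i\<in>F. l i * (ip v (e i))\<^sup>2)"
  proof -
    have "ip G v = ip (T v) v - ip (\<lambda>y. \<Sum>i\<in>F. (l i * ip v (e i)) * e i y) v"
      unfolding G_def by (rule l2ip_diff_left[OF T_L2[OF v] sum_L2 v])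
    also have "ip (\<lambda>y. \<Sum>i\<in>F. (l i * ip v (e i)) * e i y) v = (\<Sum>i\<in>F. (l i * ip v (e i)) * ip (e i) v)"
      by (subst l2ip_sum_left) (simp_all only: L2_scale e v l2ip_scale_left)
    also have "\<dots> = (\<Sum>i\<in>F. l i * (ip v (e i))\<^sup>2)"
      by (simp add: power2_eq_square l2ip_commute[of M _ v] mult_ac)
    finally show ?thesis .
  qed
  then have "0 \<le> ip G v" using eigensystem_Bessel[OF es F v] by simp
  also have "ip G v \<le> (\<integral>y. - \<epsilon> * measure M U * v y \<partial>M)"
    unfolding l2ip_def
  proof (rule integral_mono)
    show "integrable M (\<lambda>y. G y * v y)" by (rule L2_mult_integrable[OF G v])
    show "G y * v y \<le> - \<epsilon> * measure M U * v y" for y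
      using G_le[of y] by (simp add: v_def indicator_def)
  qed (use int_v in simp)
  also have "\<dots> = - \<epsilon> * (measure M U)\<^sup>2" using int_v by (simp add: power2_eq_square)
  finally show False using \<epsilon> U by (simp add: mult_le_0_iff)
qed

lemma k_diag_le: "k x x \<le> (h x)\<^sup>2"
  using k_bound[of x x] by (simp add: power2_eq_square)

text \<open>The diagonal bound, integrated. This finite trace is the source of finite multiplicities
  and of the countability of an eigensystem.\<close>

lemma eigensystem_trace:
  assumes es: "orthonormal_eigensystem F l e" and F: "finite F"
  shows "(\<Sum>i\<in>F. l i) \<le> ip h h"
proof -
  have e: "\<And>i. i \<in> F \<Longrightarrow> e i \<in> L2 M" "\<And>i. i \<in> F \<Longrightarrow> ip (e i) (e i) = 1"
    using es by (auto simp: orthonormal_eigensystem_def eigvec_def)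
  have int: "integrable M (\<lambda>x. l i * (e i x)\<^sup>2)" if "i \<in> F" for i
    using e[OF that] by (auto simp: L2_def)
  have "(\<Sum>i\<in>F. l i) = (\<Sum>i\<in>F. \<integral>x. l i * (e i x)\<^sup>2 \<partial>M)"
    using e by (intro sum.cong) (auto simp: l2ip_def power2_eq_square)
  also have "\<dots> = (\<integral>x. (\<Sum>i\<in>F. l i * (e i x)\<^sup>2) \<partial>M)"
    using int by (intro Bochner_Integration.integral_sum[symmetric]) auto
  also have "\<dots> \<le> (\<integral>x. h x * h x \<partial>M)"
  proof (rule integral_mono)
    show "integrable M (\<lambda>x. \<Sum>i\<in>F. l i * (e i x)\<^sup>2)" using int by auto
    show "integrable M (\<lambda>x. h x * h x)" by (intro L2_mult_integrable h_L2)
    show "(\<Sum>i\<in>F. l i * (e i x)\<^sup>2) \<le> h x * h x" for x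
      using eigensystem_diagonal[OF es F, of x] k_diag_le[of x] by (simp add: power2_eq_square)
  qed
  finally show ?thesis by (simp add: l2ip_def)
qed


text \<open>Cauchy-Schwarz for the nonnegative form of T, tested with \<open>v = T w\<close>, makes
  \<open>T w\<close> a null function; by continuity and full support it then vanishes
  everywhere.\<close>

lemma psd_form_zero_imp_zero:
  assumes w: "w \<in> L2 M" and 0: "ip (T w) w = 0"
  shows "T w x = 0"
proof -
  have "(ip (T w) v)\<^sup>2 \<le> ip (T w) w * ip (T v) v" if v: "v \<in> L2 M" for v
  proof (rule positive_form_Cauchy_Schwarz[of "\<lambda>u v. ip (T u) v" w v])
    show "0 \<le> ip (T (\<lambda>x. w x + t * v x)) (\<lambda>x. w x + t * v x)" for t
      by (intro psd L2_add L2_scale w v)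
    show "ip (T (\<lambda>x. w x + t * v x)) (\<lambda>x. w x + t * v x)
        = ip (T w) w + 2 * t * ip (T w) v + t\<^sup>2 * ip (T v) v" for t
      using form_add_scale[OF w v, of 0 t] by simp
  qed
  from this[OF T_L2[OF w]] have "ip (T w) (T w) = 0" using 0 by simp
  then show ?thesis
    using l2ip_eq_0_iff[OF T_L2[OF w]] AE_zero_continuous[OF T_continuous[OF w]] by blast
qed

text \<open>Mercer's expansion without compactness. For fixed x the difference r of
  \<open>k x\<close> and the sum \<open>g x\<close> of the series is orthogonal to every
  eigenfunction. Hence \<open>T r x = 0\<close> by completeness, that is
  \<open>ip (k x) r = 0\<close>, while \<open>ip (g x) r = 0\<close> term by term; so
  \<open>ip r r = 0\<close>, and r is continuous.\<close>

lemma eigensystem_embedding: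
  fixes I :: "nat set"
  assumes es: "orthonormal_eigensystem I l e"
    and complete: "\<And>w x. w \<in> perp (e ` I) \<Longrightarrow> T w x = 0"
  shows "\<exists>f :: 'a \<Rightarrow> ell2. (\<forall>x. coord (f x) = (\<lambda>i. if i \<in> I then sqrt (l i) * e i x else 0)) \<and>
    (\<forall>x y. inner (f x) (f y) = k x y)"
proof -
  have e: "e i \<in> L2 M" "continuous_on UNIV (e i)" "0 < l i" "eigvec (l i) (e i)" if "i \<in> I" for i
    using es eigvec_continuous[of "l i" "e i"] that by (auto simp: orthonormal_eigensystem_def eigvec_def)
  have on: "ip (e i) (e j) = (if i = j then 1 else 0)" if "i \<in> I" "j \<in> I" for i j
    using es that by (auto simp: orthonormal_eigensystem_def)
  define a where "a i x = (if i \<in> I then sqrt (l i) * e i x else 0)" for i x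
  have a_in: "a i = (\<lambda>x. sqrt (l i) * e i x)" if "i \<in> I" for i using that by (auto simp: a_def)
  have a_out: "a i = (\<lambda>x. 0)" if "i \<notin> I" for i using that by (auto simp: a_def)
  have aL2: "a i \<in> L2 M" and acont: "continuous_on UNIV (a i)" for i
    by (cases "i \<in> I"; simp add: a_in a_out L2_scale L2_zero e continuous_on_mult_left)+
  have partial: "(\<Sum>i<n. (a i x)\<^sup>2) \<le> k x x" for n x
  proof -
    have "(\<Sum>i<n. (a i x)\<^sup>2) = (\<Sum>i\<in>I \<inter> {..<n}. l i * (e i x)\<^sup>2)"
    proof (rule sum.mono_neutral_cong_right)
      show "(a i x)\<^sup>2 = l i * (e i x)\<^sup>2" if "i \<in> I \<inter> {..<n}" for i
        using that e(3)[of i] by (simp add: a_def power_mult_distrib)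
    qed (auto simp: a_def)
    also have "\<dots> \<le> k x x"
      by (rule eigensystem_diagonal[OF orthonormal_eigensystem_mono[OF es]]) auto
    finally show ?thesis .
  qed
  have summ: "summable (\<lambda>i. (a i x)\<^sup>2)" for x
    by (rule summableI_nonneg_bounded[where x = "k x x"]) (use partial in auto)
  define f where "f x = Abs_ell2 (\<lambda>i. a i x)" for x
  have f: "coord (f x) = (\<lambda>i. a i x)" for x
    unfolding f_def by (rule Abs_ell2_inverse) (simp add: summ)
  have f_norm: "norm (f x) \<le> h x" for x
  proof (rule power2_le_imp_le)
    have "(norm (f x))\<^sup>2 \<le> k x x"
      unfolding norm_ell2_power2 by (rule suminf_le_const[OF summable_coord]) (simp add: f partial)
    then show "(norm (f x))\<^sup>2 \<le> (h x)\<^sup>2" using k_diag_le[of x] by linarith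
  qed (rule h_nonneg)
  define g where "g x y = inner (f x) (f y)" for x y
  have g_sums: "(\<lambda>i. a i x * a i y) sums g x y" for x y
    unfolding g_def inner_ell2_def using summable_sums[OF summable_coord_prod[of "f x" "f y"]]
    by (simp add: f)
  have g_bound: "\<bar>g x y\<bar> \<le> h x * h y" for x y
    unfolding g_def using Cauchy_Schwarz_ineq2[of "f x" "f y"]
      mult_mono[OF f_norm[of x] f_norm[of y] h_nonneg norm_ge_zero] by linarith
  \<comment> \<open>Cauchy-Schwarz with the diagonal bound gives a majorant independent of n, which
    permits integrating the series term by term.\<close>
  have partial_bound: "\<bar>\<Sum>i<n. a i x * a i y\<bar> \<le> h x * h y" for n x y
  proof (rule power2_le_imp_le)
    have "\<bar>\<Sum>i<n. a i x * a i y\<bar>\<^sup>2 \<le> (\<Sum>i<n. (a i x)\<^sup>2) * (\<Sum>i<n. (a i y)\<^sup>2)"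
      using Cauchy_Schwarz_ineq_sum[of "\<lambda>i. a i x" "\<lambda>i. a i y" "{..<n}"] by simp
    also have "\<dots> \<le> (h x)\<^sup>2 * (h y)\<^sup>2"
      by (intro mult_mono order_trans[OF partial k_diag_le] sum_nonneg) auto
    finally show "\<bar>\<Sum>i<n. a i x * a i y\<bar>\<^sup>2 \<le> (h x * h y)\<^sup>2" by (simp add: power_mult_distrib)
  qed (simp add: h_nonneg)
  have g_meas: "g x \<in> borel_measurable M" for x
  proof (rule borel_measurable_LIMSEQ_real)
    show "(\<lambda>n. \<Sum>i<n. a i x * a i y) \<longlonglongrightarrow> g x y" for y
      using g_sums by (simp add: sums_def)
    show "(\<lambda>y. \<Sum>i<n. a i x * a i y) \<in> borel_measurable M" for n
      by (rule L2_D(1)[OF L2_sum[OF L2_scale[OF aL2]]])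
  qed
  have gL2: "g x \<in> L2 M" for x
    by (rule L2_bound[OF L2_scale[OF h_L2, of "h x"] g_meas])
      (use g_bound abs_ge_self order_trans in blast)
  have g_ip: "(\<lambda>i. a i x * ip (a i) v) sums ip (g x) v" if v: "v \<in> L2 M" for x v
  proof -
    have "(\<lambda>n. \<integral>y. (\<Sum>i<n. a i x * a i y) * v y \<partial>M) \<longlonglongrightarrow> (\<integral>y. g x y * v y \<partial>M)"
    proof (rule integral_dominated_convergence)
      show "(\<lambda>y. g x y * v y) \<in> borel_measurable M"
        using g_meas[of x] L2_D(1)[OF v] by measurable
      show "(\<lambda>y. (\<Sum>i<n. a i x * a i y) * v y) \<in> borel_measurable M" for n
        by (rule borel_measurable_integrable[OF L2_mult_integrable[OF L2_sum[OF L2_scale[OF aL2]] v]])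
      show "integrable M (\<lambda>y. h x * \<bar>h y * v y\<bar>)"
        using L2_mult_integrable[OF h_L2 v] by auto
      show "AE y in M. (\<lambda>n. (\<Sum>i<n. a i x * a i y) * v y) \<longlonglongrightarrow> g x y * v y"
        using g_sums by (intro AE_I2 tendsto_mult_right) (simp add: sums_def)
      show "AE y in M. norm ((\<Sum>i<n. a i x * a i y) * v y) \<le> h x * \<bar>h y * v y\<bar>" for n
      proof (rule AE_I2)
        fix y
        have "\<bar>\<Sum>i<n. a i x * a i y\<bar> * \<bar>v y\<bar> \<le> (h x * h y) * \<bar>v y\<bar>"
          by (intro mult_right_mono partial_bound) simp
        then show "norm ((\<Sum>i<n. a i x * a i y) * v y) \<le> h x * \<bar>h y * v y\<bar>"
          using h_nonneg[of y] by (simp add: abs_mult mult.assoc)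
      qed
    qed
    moreover have "(\<integral>y. (\<Sum>i<n. a i x * a i y) * v y \<partial>M) = (\<Sum>i<n. a i x * ip (a i) v)" for n
      using l2ip_sum_left[of "{..<n}" "\<lambda>i y. a i x * a i y", OF L2_scale[OF aL2] v]
      by (simp add: l2ip_def mult.assoc)
    ultimately show ?thesis unfolding sums_def l2ip_def by simp
  qed
  \<comment> \<open>The series need not converge uniformly in y. Continuity comes from weak
    continuity of f: its norms are bounded by h, and its coordinates are continuous.\<close>
  have g_cont: "continuous_on UNIV (g x)" for x
  proof -
    have "(\<lambda>n. g x (Y n)) \<longlonglongrightarrow> g x y" if Y: "Y \<longlonglongrightarrow> y" for Y y
    proof -
      have "(\<lambda>n. h (Y n)) \<longlonglongrightarrow> h y"
        using h_continuous Y by (simp add: continuous_on_sequentially o_def)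
      then have "Bseq (\<lambda>n. h (Y n))" by (intro convergent_imp_Bseq convergentI)
      then obtain C where C: "\<And>n. \<bar>h (Y n)\<bar> \<le> C" by (auto simp: Bseq_def)
      show ?thesis unfolding g_def
      proof (rule ell2_bounded_weak_tendsto)
        show "norm (f (Y n)) \<le> C" for n using f_norm[of "Y n"] C[of n] by linarith
        show "(\<lambda>n. coord (f (Y n)) i) \<longlonglongrightarrow> coord (f y) i" for i
          using acont[of i] Y by (simp add: f continuous_on_sequentially o_def)
      qed
    qed
    then show ?thesis by (simp add: continuous_on_sequentially o_def)
  qed
  have "k x y = g x y" for x y
  proof -
    define r where "r = (\<lambda>y. k x y - g x y)"
    have rL2: "r \<in> L2 M" unfolding r_def by (intro L2_diff k_section_L2 gL2)
    have "ip r (e j) = 0" if j: "j \<in> I" for j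
    proof -
      have "a i x * ip (a i) (e j) = (if i = j then l j * e j x else 0)" for i
        using e(3)[OF j] on[OF _ j]
        by (cases "i \<in> I") (auto simp: a_in a_out l2ip_scale_left l2ip_def[of M "\<lambda>x. 0"] j)
      then have "(\<lambda>i. if i = j then l j * e j x else 0) sums ip (g x) (e j)"
        using g_ip[OF e(1)[OF j], of x] by simp
      then have "ip (g x) (e j) = l j * e j x"
        using sums_single[of j "\<lambda>_. l j * e j x"] sums_unique2 by fastforce
      moreover have "ip (k x) (e j) = l j * e j x"
        using e(4)[OF j] by (simp add: eigvec_def T_eq_ip)
      ultimately show ?thesis
        unfolding r_def using l2ip_diff_left[OF k_section_L2 gL2 e(1)[OF j]] by simp
    qed
    then have perp: "r \<in> perp (e ` I)" using rL2 by (auto simp: perp_def)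
    then have "ip (k x) r = 0" using complete[of r x] by (simp add: T_eq_ip)
    moreover have "ip (g x) r = 0"
    proof -
      have "(\<lambda>i. a i x * ip (a i) r) = (\<lambda>i. 0)"
      proof
        show "a i x * ip (a i) r = 0" for i
          using perp by (cases "i \<in> I")
            (auto simp: a_in a_out l2ip_scale_left l2ip_def[of M "\<lambda>x. 0"] perp_def l2ip_commute[of M _ r])
      qed
      then have "(\<lambda>i. 0) sums ip (g x) r" using g_ip[OF rL2, of x] by metis
      then show ?thesis using sums_unique2[OF _ sums_zero] by blast
    qed
    ultimately have "ip r r = 0"
      using l2ip_diff_left[OF k_section_L2 gL2 rL2] by (simp add: r_def)
    then have "AE y in M. r y = 0" using l2ip_eq_0_iff[OF rL2] by simp
    moreover have "continuous_on UNIV r"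
      unfolding r_def by (intro continuous_intros k_section_continuous g_cont)
    ultimately have "r y = 0" by (rule AE_zero_continuous[rotated])
    then show ?thesis by (simp add: r_def)
  qed
  then show ?thesis using f by (intro exI[of _ f]) (simp add: g_def a_def)
qed

end

lemma lin_indep_AE_orthonormal:
  assumes "\<And>i. i < n \<Longrightarrow> u i \<in> L2 M"
    and "\<And>i j. i < n \<Longrightarrow> j < n \<Longrightarrow> l2ip M (u i) (u j) = (if i = j then 1 else 0)"
  shows "lin_indep_AE M n u"
  unfolding lin_indep_AE_def
proof (intro allI impI)
  fix c :: "nat \<Rightarrow> real" and j
  assume ae: "AE x in M. (\<Sum>i<n. c i * u i x) = 0" and j: "j < n"
  have sL2: "(\<lambda>x. \<Sum>i<n. c i * u i x) \<in> L2 M" using assms(1) by (intro L2_sum L2_scale) auto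
  have "l2ip M (\<lambda>x. \<Sum>i<n. c i * u i x) (u j) = l2ip M (\<lambda>x. 0) (u j)"
    by (rule l2ip_cong_AE[OF sL2 L2_zero assms(1)[OF j] ae])
  moreover have "l2ip M (\<lambda>x. \<Sum>i<n. c i * u i x) (u j) = (\<Sum>i<n. c i * l2ip M (u i) (u j))"
    using assms(1) j by (subst l2ip_sum_left) (auto intro!: L2_scale sum.cong simp: l2ip_scale_left)
  moreover have "\<dots> = (\<Sum>i<n. if i = j then c j else 0)"
    using assms(2) j by (intro sum.cong) auto
  ultimately show "c j = 0" using j by (simp add: l2ip_def)
qed

section \<open>Completeness, multiplicities and existence of eigensystems\<close>

context psd_kernel
begin

definition complete_eigensystem :: "'i set \<Rightarrow> ('i \<Rightarrow> real) \<Rightarrow> ('i \<Rightarrow> 'a \<Rightarrow> real) \<Rightarrow> bool" where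
  "complete_eigensystem I l e \<longleftrightarrow>
     orthonormal_eigensystem I l e \<and> (\<forall>w\<in>perp (e ` I). \<forall>x. T w x = 0)"

lemma eigensystem_finite_ge:
  assumes es: "orthonormal_eigensystem I l e" and r: "0 < r"
  shows "finite {i \<in> I. r \<le> l i}"
proof (rule ccontr)
  assume "infinite {i \<in> I. r \<le> l i}"
  \<comment> \<open>Each index contributes at least r to a trace of at most \<open>ip h h\<close>,
    so this many indices are too many.\<close>
  then obtain F where F: "finite F" "card F = nat \<lceil>ip h h / r\<rceil> + 1" "F \<subseteq> {i \<in> I. r \<le> l i}"
    using infinite_arbitrarily_large by blast
  have "ip h h < real (card F) * r"
    using r F(2) by (simp add: field_simps) (smt (verit) of_nat_nat real_nat_ceiling_ge mult.commute pos_divide_le_eq)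
  also have "\<dots> = (\<Sum>i\<in>F. r)" by simp
  also have "\<dots> \<le> (\<Sum>i\<in>F. l i)" using F(3) by (intro sum_mono) auto
  also have "\<dots> \<le> ip h h"
    using F by (intro eigensystem_trace[OF orthonormal_eigensystem_mono[OF es]]) auto
  finally show False by simp
qed

lemma finite_eigenvalue_indices:
  assumes "orthonormal_eigensystem I l e" "0 < r"
  shows "finite {i \<in> I. l i = r}"
  using eigensystem_finite_ge[OF assms] by (rule rev_finite_subset) auto

lemma eigenspace_eigvec:
  assumes "eigvec r e"
  shows "e \<in> eigenspace M (L2 M) T r"
  using assms by (auto simp: eigenspace_def eigvec_def)

text \<open>For the upper bound, more than m independent eigenfunctions for r admit a nontrivial
  combination w orthogonal to the m listed ones; the listed eigenfunctions for other eigenvalues are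
  orthogonal to w anyway. Completeness then gives \<open>T w x = 0\<close>, while
  \<open>T w x = r * w x\<close> almost everywhere, so w is null, against independence.\<close>

lemma eig_mult_complete:
  assumes c: "complete_eigensystem I l e" and r: "0 < r"
  shows "eig_mult M (L2 M) T r = ecard {i \<in> I. l i = r}"
proof -
  have es: "orthonormal_eigensystem I l e" and zero: "\<And>w x. w \<in> perp (e ` I) \<Longrightarrow> T w x = 0"
    using c by (auto simp: complete_eigensystem_def)
  have e: "e i \<in> L2 M" "eigvec (l i) (e i)" if "i \<in> I" for i
    using es that by (auto simp: orthonormal_eigensystem_def eigvec_def)
  define J where "J = {i \<in> I. l i = r}"
  have J: "finite J" "J \<subseteq> I" using finite_eigenvalue_indices[OF es r] by (auto simp: J_def)
  define m where "m = card J"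
  obtain b where b: "bij_betw b {..<m} J"
    using ex_bij_betw_nat_finite[OF J(1)] by (auto simp: m_def atLeast0LessThan)
  have bJ: "b i \<in> J" if "i < m" for i using b that by (auto simp: bij_betw_def)
  have b_inj: "b i = b j \<longleftrightarrow> i = j" if "i < m" "j < m" for i j
    using b that by (auto simp: bij_betw_def inj_on_def)
  have "eig_mult M (L2 M) T r = enat m"
    unfolding eig_mult_def
  proof (rule antisym)
    show "(SUP n\<in>{n. \<exists>u. (\<forall>i<n. u i \<in> eigenspace M (L2 M) T r) \<and> lin_indep_AE M n u}. enat n) \<le> enat m"
    proof (rule SUP_least, clarsimp)
      fix n u
      assume u: "\<forall>i<n. u i \<in> eigenspace M (L2 M) T r" and li: "lin_indep_AE M n u"
      have uL2: "u i \<in> L2 M" "AE x in M. T (u i) x = r * u i x" if "i < n" for i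
        using u that by (auto simp: eigenspace_def)
      show "n \<le> m"
      proof (rule ccontr)
        assume "\<not> n \<le> m"
        then obtain c where c: "\<exists>j<n. c j \<noteq> 0" "\<forall>i<m. (\<Sum>j<n. c j * ip (u j) (e (b i))) = 0"
          using exists_nontrivial_solution[of m n "\<lambda>i j. ip (u j) (e (b i))"] by auto
        define w where "w = (\<lambda>x. \<Sum>j<n. c j * u j x)"
        have wL2: "w \<in> L2 M" unfolding w_def using uL2 by (intro L2_sum L2_scale) auto
        have Tw: "T w x = (\<Sum>j<n. c j * T (u j) x)" for x
          unfolding w_def using uL2 by (subst T_sum) (simp_all add: L2_scale T_scale)
        have "AE x in M. \<forall>j\<in>{..<n}. T (u j) x = r * u j x"
          by (rule AE_finite_allI[OF finite_lessThan]) (rule uL2(2), simp)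
        then have ae: "AE x in M. T w x = r * w x"
        proof eventually_elim
          fix x assume "\<forall>j\<in>{..<n}. T (u j) x = r * u j x"
          then have "T w x = (\<Sum>j<n. c j * (r * u j x))" by (simp add: Tw)
          then show "T w x = r * w x" by (simp add: w_def sum_distrib_left mult.left_commute)
        qed
        have rL2: "(\<lambda>x. r * w x) \<in> L2 M" by (rule L2_scale[OF wL2])
        have "ip w (e i) = 0" if i: "i \<in> I" for i
        proof (cases "l i = r")
          case True
          then have "i \<in> b ` {..<m}" using i b by (auto simp: J_def bij_betw_def)
          then obtain j where j: "j < m" "i = b j" by auto
          have "ip w (e i) = (\<Sum>j<n. c j * ip (u j) (e i))"
            unfolding w_def using uL2 e[OF i]
            by (subst l2ip_sum_left) (auto intro!: L2_scale sum.cong simp: l2ip_scale_left)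
          then show ?thesis using c(2) j by simp
        next
          case False
          have "l i * ip w (e i) = ip (T w) (e i)" using eigvec_ip[OF e(2)[OF i] wL2] by simp
          also have "\<dots> = r * ip w (e i)"
            using l2ip_cong_AE[OF T_L2[OF wL2] rL2 e(1)[OF i] ae] by (simp add: l2ip_scale_left)
          finally show ?thesis using False by simp
        qed
        then have "w \<in> perp (e ` I)" using wL2 by (auto simp: perp_def)
        then have "AE x in M. w x = 0" using ae by (auto simp: zero r less_imp_neq[OF r, symmetric])
        then have "\<forall>i<n. c i = 0" using li unfolding lin_indep_AE_def w_def by blast
        then show False using c(1) by blast
      qed
    qed
    have "lin_indep_AE M m (\<lambda>i. e (b i))"
      using bJ J e es b_inj by (intro lin_indep_AE_orthonormal) (auto simp: orthonormal_eigensystem_def subset_iff)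
    moreover have "\<forall>i<m. e (b i) \<in> eigenspace M (L2 M) T r"
    proof (intro allI impI)
      fix i assume "i < m"
      then have "b i \<in> I" "l (b i) = r" using bJ by (auto simp: J_def)
      then show "e (b i) \<in> eigenspace M (L2 M) T r"
        using eigenspace_eigvec[OF e(2)[of "b i"]] by simp
    qed
    ultimately show "enat m \<le> (SUP n\<in>{n. \<exists>u. (\<forall>i<n. u i \<in> eigenspace M (L2 M) T r) \<and> lin_indep_AE M n u}. enat n)"
      by (intro SUP_upper) (auto intro!: exI[of _ "\<lambda>i. e (b i)"])
  qed
  then show ?thesis using J(1) by (simp add: ecard_def m_def J_def)
qed

lemma complete_if_no_positive_eigvec:
  assumes es: "orthonormal_eigensystem I l e"
    and no: "\<And>v r. v \<in> perp (e ` I) \<Longrightarrow> 0 < r \<Longrightarrow> eigvec r v \<Longrightarrow> ip v v = 1 \<Longrightarrow> False"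
  shows "complete_eigensystem I l e"
  unfolding complete_eigensystem_def
proof (intro conjI es ballI allI)
  fix w x assume w: "w \<in> perp (e ` I)"
  have ev: "\<exists>r. eigvec r f" if "f \<in> e ` I" for f
    using es that by (auto simp: orthonormal_eigensystem_def)
  have wL2: "w \<in> L2 M" using w by (simp add: perp_def)
  have "\<not> 0 < ip (T w) w"
    using exists_positive_eigvec[OF ev w] no by blast
  then have "ip (T w) w = 0" using psd[OF wL2] by simp
  then show "T w x = 0" by (rule psd_form_zero_imp_zero[OF wL2])
qed

text \<open>A further positive eigenfunction orthogonal to the system would, with the m listed ones
  for its eigenvalue, form an independent family of length m + 1; since m is finite, this exceeds
  the multiplicity. It serves enumerations that are given and not constructed.\<close>

lemma complete_if_multiplicities:
  assumes es: "orthonormal_eigensystem I l e"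
    and mult: "\<And>r. 0 < r \<Longrightarrow> ecard {i \<in> I. l i = r} = eig_mult M (L2 M) T r"
  shows "complete_eigensystem I l e"
proof (rule complete_if_no_positive_eigvec[OF es])
  fix v r
  assume v: "v \<in> perp (e ` I)" and r: "0 < r" and ev: "eigvec r v" and vv: "ip v v = 1"
  have e: "e i \<in> L2 M" "eigvec (l i) (e i)" if "i \<in> I" for i
    using es that by (auto simp: orthonormal_eigensystem_def eigvec_def)
  have vL2: "v \<in> L2 M" and ve: "\<And>i. i \<in> I \<Longrightarrow> ip v (e i) = 0" using v by (auto simp: perp_def)
  have ve': "\<And>i. i \<in> I \<Longrightarrow> ip (e i) v = 0" using ve by (simp add: l2ip_commute)
  define J where "J = {i \<in> I. l i = r}"
  have J: "finite J" "J \<subseteq> I" using finite_eigenvalue_indices[OF es r] by (auto simp: J_def)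
  define m where "m = card J"
  obtain b where b: "bij_betw b {..<m} J"
    using ex_bij_betw_nat_finite[OF J(1)] by (auto simp: m_def atLeast0LessThan)
  have bJ: "b i \<in> J" if "i < m" for i using b that by (auto simp: bij_betw_def)
  have b_inj: "b i = b j \<longleftrightarrow> i = j" if "i < m" "j < m" for i j
    using b that by (auto simp: bij_betw_def inj_on_def)
  have bI: "b i \<in> I" if "i < m" for i using bJ[OF that] J by auto
  define u where "u i = (if i < m then e (b i) else v)" for i
  have on: "ip (e i) (e j) = (if i = j then 1 else 0)" if "i \<in> I" "j \<in> I" for i j
    using es that by (auto simp: orthonormal_eigensystem_def)
  have "lin_indep_AE M (Suc m) u"
  proof (rule lin_indep_AE_orthonormal)
    show "u i \<in> L2 M" if "i < Suc m" for i using bI e vL2 by (auto simp: u_def)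
    show "ip (u i) (u j) = (if i = j then 1 else 0)" if "i < Suc m" "j < Suc m" for i j
      using that by (auto simp: u_def on bI b_inj ve ve' vv)
  qed
  moreover have "\<forall>i<Suc m. u i \<in> eigenspace M (L2 M) T r"
  proof (intro allI impI)
    fix i
    have "eigvec r (u i)"
      using bJ[of i] e(2)[of "b i"] ev by (cases "i < m") (auto simp: u_def J_def)
    then show "u i \<in> eigenspace M (L2 M) T r" by (rule eigenspace_eigvec)
  qed
  ultimately have "enat (Suc m) \<le> eig_mult M (L2 M) T r"
    unfolding eig_mult_def by (intro SUP_upper) blast
  moreover have "eig_mult M (L2 M) T r = enat m"
    using mult[OF r] J(1) by (simp add: ecard_def m_def J_def)
  ultimately show False by simp
qed

text \<open>A maximal system from Zorn's lemma cannot leave out a positive eigenfunction orthogonal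
  to it. It is countable, since by the trace bound only finitely many of its eigenvalues are at
  least 1/(n+1), for each n.\<close>

lemma exists_complete_eigensystem:
  obtains N l e where "complete_eigensystem {i. enat i < N} l e"
proof -
  define \<A> where "\<A> = {S. orthonormal_eigensystem S fst snd}"
  have "\<exists>S\<in>\<A>. \<forall>X\<in>\<A>. S \<subseteq> X \<longrightarrow> X = S"
  proof (rule subset_Zorn')
    fix C assume C: "subset.chain \<A> C"
    have "\<Union>C \<in> \<A>"
      unfolding \<A>_def mem_Collect_eq orthonormal_eigensystem_def
    proof (intro conjI ballI)
      fix p assume "p \<in> \<Union>C"
      then obtain S where "p \<in> S" "S \<in> \<A>" using C by (auto simp: subset.chain_def)
      then show "0 < fst p" "eigvec (fst p) (snd p)"
        by (auto simp: \<A>_def orthonormal_eigensystem_def)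
    next
      fix p q assume "p \<in> \<Union>C" "q \<in> \<Union>C"
      then obtain S1 S2 where S12: "p \<in> S1" "q \<in> S2" "S1 \<in> C" "S2 \<in> C" by auto
      then have "S1 \<subseteq> S2 \<or> S2 \<subseteq> S1" "S1 \<in> \<A>" "S2 \<in> \<A>"
        using C unfolding subset_chain_def by blast+
      with S12 obtain S where "p \<in> S" "q \<in> S" "S \<in> \<A>" by blast
      then show "ip (snd p) (snd q) = (if p = q then 1 else 0)"
        unfolding \<A>_def orthonormal_eigensystem_def by blast
    qed
    then show "\<Union>C \<in> \<A>" .
  qed
  then obtain S where "S \<in> \<A>" and "\<forall>X\<in>\<A>. S \<subseteq> X \<longrightarrow> X = S" by (rule bexE)
  then have S: "orthonormal_eigensystem S fst snd"
      and max: "\<And>X. orthonormal_eigensystem X fst snd \<Longrightarrow> S \<subseteq> X \<Longrightarrow> X = S"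
    unfolding \<A>_def by blast+
  have c: "complete_eigensystem S fst snd"
  proof (rule complete_if_no_positive_eigvec[OF S])
    fix v r assume v: "v \<in> perp (snd ` S)" "0 < r" "eigvec r v" "ip v v = 1"
    have S1: "\<forall>p\<in>S. 0 < fst p \<and> eigvec (fst p) (snd p)"
      and S2: "\<forall>p\<in>S. \<forall>q\<in>S. ip (snd p) (snd q) = (if p = q then 1 else 0)"
      using S unfolding orthonormal_eigensystem_def by blast+
    have vS: "ip v (snd p) = 0" "ip (snd p) v = 0" if "p \<in> S" for p
    proof -
      show "ip v (snd p) = 0" using v(1) that unfolding perp_def by blast
      then show "ip (snd p) v = 0" by (simp only: l2ip_commute[of M "snd p"])
    qed
    have notin: "(r, v) \<notin> S" using vS(1)[of "(r, v)"] v(4) by auto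
    have "orthonormal_eigensystem (insert (r, v) S) fst snd"
      unfolding orthonormal_eigensystem_def
    proof (intro conjI)
      show "\<forall>p\<in>insert (r, v) S. 0 < fst p \<and> eigvec (fst p) (snd p)"
        using S1 v(2,3) by simp
      have "ip (snd p) (snd (r, v)) = (if p = (r, v) then 1 else 0)"
        "ip (snd (r, v)) (snd p) = (if (r, v) = p then 1 else 0)" if "p \<in> S" for p
        using that vS[OF that] notin by auto
      then show "\<forall>p\<in>insert (r, v) S. \<forall>q\<in>insert (r, v) S. ip (snd p) (snd q) = (if p = q then 1 else 0)"
        using S2 v(4) unfolding ball_simps by simp
    qed
    from max[OF this] notin show False by blast
  qed
  have "countable S"
  proof (rule countable_subset)
    show "S \<subseteq> (\<Union>n. {p \<in> S. inverse (real (Suc n)) \<le> fst p})"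
    proof
      fix p assume p: "p \<in> S"
      then have "0 < fst p" using S by (auto simp: orthonormal_eigensystem_def)
      then obtain n where "inverse (real (Suc n)) < fst p" using reals_Archimedean by blast
      then have "p \<in> {p \<in> S. inverse (real (Suc n)) \<le> fst p}" using p by simp
      then show "p \<in> (\<Union>n. {p \<in> S. inverse (real (Suc n)) \<le> fst p})" by (rule UN_I[OF UNIV_I])
    qed
    show "countable (\<Union>n. {p \<in> S. inverse (real (Suc n)) \<le> fst p})"
    proof (rule countable_UN)
      show "countable {p \<in> S. inverse (real (Suc n)) \<le> fst p}" for n
        by (rule countable_finite, rule eigensystem_finite_ge[OF S]) simp
    qed simp
  qed
  \<comment> \<open>A finite S is numbered by an initial segment, an infinite one by all natural
    numbers; \<open>ecard S\<close> is \<infinity> in the latter case.\<close>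
  have "\<exists>b. bij_betw b {i. enat i < ecard S} S"
  proof (cases "finite S")
    case True
    then show ?thesis
      using ex_bij_betw_nat_finite[OF True] by (auto simp: ecard_def atLeast0LessThan lessThan_def)
  next
    case False
    then show ?thesis
      using bij_betw_from_nat_into[OF \<open>countable S\<close> False] by (auto simp: ecard_def)
  qed
  then obtain b where b: "bij_betw b {i. enat i < ecard S} S" ..
  let ?I = "{i. enat i < ecard S}"
  have bS: "b ` ?I = S" "inj_on b ?I" using b by (auto simp: bij_betw_def)
  have "orthonormal_eigensystem ?I (\<lambda>i. fst (b i)) (\<lambda>i. snd (b i))"
    unfolding orthonormal_eigensystem_def
  proof (intro conjI ballI)
    fix i j assume i: "i \<in> ?I"
    then have bi: "b i \<in> S" using bS by blast
    then show "0 < fst (b i)" "eigvec (fst (b i)) (snd (b i))"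
      using S by (auto simp: orthonormal_eigensystem_def)
    assume j: "j \<in> ?I"
    then have bj: "b j \<in> S" using bS by blast
    have "b i = b j \<longleftrightarrow> i = j" using inj_on_eq_iff[OF bS(2) i j] .
    then show "ip (snd (b i)) (snd (b j)) = (if i = j then 1 else 0)"
      using S bi bj unfolding orthonormal_eigensystem_def by metis
  qed
  moreover have "(\<lambda>i. snd (b i)) ` ?I = snd ` S" using bS by (metis image_image)
  ultimately have "complete_eigensystem ?I (\<lambda>i. fst (b i)) (\<lambda>i. snd (b i))"
    using c unfolding complete_eigensystem_def by simp
  then show thesis by (rule that)
qed

end

section \<open>The centred kernel under a finite fourth moment\<close>

text \<open>Separability matters, as the Borel sets of the square can exceed the product
  sigma-algebra: it makes a sublevel set of the distance a countable union of products of balls,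
  with centres q in a dense set and rational r.\<close>

lemma dist_measurable_pair:
  fixes M :: "'a::metric_space measure"
  assumes M: "sets M = sets borel" and sep: "separable_space (euclidean :: 'a topology)"
  shows "(\<lambda>p. dist (fst p) (snd p)) \<in> borel_measurable (M \<Otimes>\<^sub>M M)"
proof -
  obtain D where "countable D \<and> closure D = (UNIV :: 'a set)"
    using countable_dense_if_separable[OF sep] ..
  then have D: "countable D" "closure D = UNIV" by simp_all
  have sp: "space (M \<Otimes>\<^sub>M M) = UNIV"
    using sets_eq_imp_space_eq[OF M] by (simp add: space_pair_measure)
  have "{p. dist (fst p) (snd p) < a} = (\<Union>q\<in>D. \<Union>r\<in>\<rat>. ball q r \<times> ball q (a - r))" for a
  proof (intro equalityI subsetI)
    fix p :: "'a \<times> 'a" assume "p \<in> {p. dist (fst p) (snd p) < a}"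
    then obtain x y where p: "p = (x, y)" and lt: "dist x y < a" by (cases p) auto
    have "x \<in> closure D" using D by simp
    \<comment> \<open>A centre q within half the slack of x leaves an interval for the radius r that
      also keeps y within \<open>a - r\<close> of q.\<close>
    then obtain q where q: "q \<in> D" "dist q x < (a - dist x y) / 2"
      using lt unfolding closure_approachable by (metis diff_gt_0_iff_gt half_gt_zero)
    then have "dist q x < a - dist x y - dist q x" by simp
    then obtain r where r: "r \<in> \<rat>" "dist q x < r" "r < a - dist x y - dist q x"
      using Rats_dense_in_real by blast
    have "dist q y < a - r" using r dist_triangle[of q y x] by linarith
    then show "p \<in> (\<Union>q\<in>D. \<Union>r\<in>\<rat>. ball q r \<times> ball q (a - r))"
      using p q r by auto
  next
    fix p :: "'a \<times> 'a" assume "p \<in> (\<Union>q\<in>D. \<Union>r\<in>\<rat>. ball q r \<times> ball q (a - r))"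
    then obtain q r where "dist q (fst p) < r" "dist q (snd p) < a - r" by auto
    then have "dist (fst p) (snd p) < a"
      using dist_triangle[of "fst p" "snd p" q] by (simp add: dist_commute)
    then show "p \<in> {p. dist (fst p) (snd p) < a}" by simp
  qed
  moreover have "(\<Union>q\<in>D. \<Union>r\<in>\<rat>. ball q r \<times> ball q (a - r)) \<in> sets (M \<Otimes>\<^sub>M M)" for a
    using D countable_rat by (intro sets.countable_UN' pair_measureI) (auto simp: M)
  ultimately show ?thesis
    unfolding borel_measurable_iff_less sp by simp
qed

lemma finite_fourth_momentE:
  fixes \<mu> :: "'a::metric_space measure"
  assumes "borel_prob \<mu>" "finite_fourth_moment \<mu>"
  obtains x\<^sub>0 where "(\<lambda>x. 1 + (dist x\<^sub>0 x)\<^sup>2) \<in> L2 \<mu>"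
proof -
  obtain x\<^sub>0 where fin: "(\<integral>\<^sup>+ y. ennreal ((dist x\<^sub>0 y) ^ 4) \<partial>\<mu>) < \<infinity>"
    using assms(2) by (auto simp: finite_fourth_moment_def)
  interpret prob_space \<mu> using assms(1) by (simp add: borel_prob_def)
  have sets: "sets \<mu> = sets borel" using assms(1) by (simp add: borel_prob_def)
  have cont: "continuous_on UNIV (\<lambda>x. dist x\<^sub>0 x)" by (intro continuous_intros)
  have dm[measurable]: "(\<lambda>x. dist x\<^sub>0 x) \<in> borel_measurable \<mu>"
    using borel_measurable_continuous_onI[OF cont] measurable_cong_sets[OF sets refl] by blast
  have i4: "integrable \<mu> (\<lambda>y. (dist x\<^sub>0 y) ^ 4)"
    using fin by (intro integrableI_nonneg) auto
  have "(\<lambda>x. (dist x\<^sub>0 x)\<^sup>2) \<in> L2 \<mu>"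
    unfolding L2_def using i4 by (auto simp: power_mult[symmetric])
  moreover have "(\<lambda>x. 1) \<in> L2 \<mu>" by (simp add: L2_def)
  ultimately show thesis using that[of x\<^sub>0] L2_add by blast
qed

locale fourth_moment = prob_space \<mu> for \<mu> :: "'a::metric_space measure" +
  fixes x\<^sub>0 :: 'a
  assumes borel_sets: "sets \<mu> = sets borel"
    and separable_euclidean: "separable_space (euclidean :: 'a topology)"
    and weight_L2: "(\<lambda>x. 1 + (dist x\<^sub>0 x)\<^sup>2) \<in> L2 \<mu>"
begin

text \<open>If a and b are the distances of x and y from the base point, the kernel is at most a^2 +
  b^2 in absolute value, and a^2 + b^2 \<le> (1 + a^2) (1 + b^2): the 1 turns the sum into a
  product. A finite fourth moment makes the weight square integrable.\<close>

definition weight :: "'a \<Rightarrow> real" where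
  "weight x = 1 + (dist x\<^sub>0 x)\<^sup>2"

lemma dist_sq_bound: "(dist x y)\<^sup>2 \<le> 2 * (dist x\<^sub>0 x)\<^sup>2 + 2 * (dist x\<^sub>0 y)\<^sup>2"
proof -
  have "dist x y \<le> dist x\<^sub>0 x + dist x\<^sub>0 y"
    using dist_triangle[of x y x\<^sub>0] by (simp add: dist_commute)
  then have "(dist x y)\<^sup>2 \<le> (dist x\<^sub>0 x + dist x\<^sub>0 y)\<^sup>2" by (intro power_mono) auto
  also have "\<dots> \<le> 2 * (dist x\<^sub>0 x)\<^sup>2 + 2 * (dist x\<^sub>0 y)\<^sup>2"
    using zero_le_power2[of "dist x\<^sub>0 x - dist x\<^sub>0 y"] unfolding power2_sum power2_diff by linarith
  finally show ?thesis .
qed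

sublocale K: sym_kernel \<mu> kern weight
proof
  show "sets \<mu> = sets borel" by (rule borel_sets)
  show "separable_space (euclidean :: 'a topology)" by (rule separable_euclidean)
  show "(\<lambda>p. kern (fst p) (snd p)) \<in> borel_measurable (\<mu> \<Otimes>\<^sub>M \<mu>)"
    unfolding kern_def using dist_measurable_pair[OF borel_sets separable_euclidean] by measurable
  show "kern x y = kern y x" for x y :: 'a by (simp add: kern_def dist_commute)
  show "\<bar>kern x y\<bar> \<le> weight x * weight y" for x y
  proof -
    have "\<bar>kern x y\<bar> = (dist x y)\<^sup>2 / 2" by (simp add: kern_def)
    also have "\<dots> \<le> (dist x\<^sub>0 x)\<^sup>2 + (dist x\<^sub>0 y)\<^sup>2" using dist_sq_bound[of x y] by simp
    also have "\<dots> \<le> weight x * weight y" by (simp add: weight_def algebra_simps)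
    finally show ?thesis .
  qed
  show "continuous_on UNIV (\<lambda>p. kern (fst p) (snd p) :: real)"
    unfolding kern_def by (intro continuous_intros)
  show "0 \<le> weight x" for x by (simp add: weight_def)
  show "continuous_on UNIV weight" unfolding weight_def by (intro continuous_intros)
  show "weight \<in> L2 \<mu>" using weight_L2 unfolding weight_def .
qed

lemma const_L2: "(\<lambda>x. c) \<in> L2 \<mu>"
  by (simp add: L2_def)

definition mean :: "'a \<Rightarrow> real" where
  "mean = K.T (\<lambda>x. 1)"

lemma mean_L2: "mean \<in> L2 \<mu>"
  unfolding mean_def by (rule K.T_L2[OF const_L2])

lemma K_op_eq: "K_op \<mu> u x = K.T u x"
  by (simp only: K_op_def K.T_def kern_def mult.assoc integral_mult_right_zero)

lemma kern_T_eq: "kern_T \<mu> x y = kern x y - mean x - mean y + l2ip \<mu> mean (\<lambda>x. 1)"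
proof -
  have "mean z = (\<integral>y. kern z y \<partial>\<mu>)" "mean z = (\<integral>y. kern y z \<partial>\<mu>)" for z
    using K.k_sym[of z] by (simp_all add: mean_def K.T_def)
  then show ?thesis by (simp add: kern_T_def l2ip_def)
qed

text \<open>With H the L^2 norm of \<open>weight\<close>, the four terms of k_T are bounded by the
  four terms of \<open>(weight x + H) * (weight y + H)\<close>.\<close>

definition weight_T :: "'a \<Rightarrow> real" where
  "weight_T x = weight x + sqrt (l2ip \<mu> weight weight)"

sublocale T: sym_kernel \<mu> "kern_T \<mu>" weight_T
proof
  let ?H = "sqrt (l2ip \<mu> weight weight)"
  have one: "l2ip \<mu> (\<lambda>x. 1) (\<lambda>x. 1) = 1" by (simp add: l2ip_def prob_space)
  have mean_cont: "continuous_on UNIV mean"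
    unfolding mean_def by (rule K.T_continuous[OF const_L2])
  show "sets \<mu> = sets borel" by (rule borel_sets)
  show "separable_space (euclidean :: 'a topology)" by (rule separable_euclidean)
  show "(\<lambda>p. kern_T \<mu> (fst p) (snd p)) \<in> borel_measurable (\<mu> \<Otimes>\<^sub>M \<mu>)"
    unfolding kern_T_eq using K.k_measurable L2_D(1)[OF mean_L2] by measurable
  show "kern_T \<mu> x y = kern_T \<mu> y x" for x y :: 'a
    by (simp add: kern_T_eq K.k_sym[of x y])
  show "\<bar>kern_T \<mu> x y\<bar> \<le> weight_T x * weight_T y" for x y
  proof -
    have mean: "\<bar>mean z\<bar> \<le> weight z * ?H" for z
      using K.T_bound[OF const_L2, of 1 z] by (simp add: mean_def one)
    have "\<bar>l2ip \<mu> mean (\<lambda>x. 1)\<bar> \<le> l2ip \<mu> weight weight"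
      using K.T_form_bound[OF const_L2, of 1] by (simp add: mean_def one)
    then have "\<bar>l2ip \<mu> mean (\<lambda>x. 1)\<bar> \<le> ?H * ?H" by (simp add: l2ip_nonneg)
    then have "\<bar>kern_T \<mu> x y\<bar> \<le> weight x * weight y + weight x * ?H + weight y * ?H + ?H * ?H"
      using K.k_bound[of x y] mean[of x] mean[of y] unfolding kern_T_eq abs_le_iff by linarith
    also have "\<dots> = weight_T x * weight_T y" by (simp only: weight_T_def algebra_simps)
    finally show ?thesis .
  qed
  have mf: "continuous_on UNIV (\<lambda>p :: 'a \<times> 'a. mean (fst p))" "continuous_on UNIV (\<lambda>p :: 'a \<times> 'a. mean (snd p))"
    by (intro continuous_on_compose2[OF mean_cont] continuous_intros subset_UNIV)+
  show "continuous_on UNIV (\<lambda>p. kern_T \<mu> (fst p) (snd p) :: real)"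
    unfolding kern_T_eq by (intro continuous_intros K.k_continuous mf)
  show "0 \<le> weight_T x" for x by (simp add: weight_T_def K.h_nonneg l2ip_nonneg)
  show "continuous_on UNIV weight_T"
    unfolding weight_T_def by (intro continuous_intros K.h_continuous)
  show "weight_T \<in> L2 \<mu>" unfolding weight_T_def by (rule L2_add[OF K.h_L2 const_L2])
qed

lemma K_dom_eq: "K_dom \<mu> = L2 \<mu>"
proof -
  have "u \<in> K_dom \<mu>" if u: "u \<in> L2 \<mu>" for u
  proof -
    have "integrable \<mu> (\<lambda>y. (dist x y)\<^sup>2 * u y)" for x
      using integrable_mult_right[OF K.k_mult_integrable[OF u, of x], of "-2"]
      by (simp add: kern_def mult.assoc[symmetric])
    moreover have "K_op \<mu> u = K.T u" by (rule ext) (rule K_op_eq)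
    ultimately show ?thesis using u K.T_L2[OF u] by (simp add: K_dom_def)
  qed
  then show ?thesis by (auto simp: K_dom_def)
qed

lemma T_dom_eq: "T_dom \<mu> = L2 \<mu>"
  using P_op_in_L2 by (auto simp: T_dom_def K_dom_eq)

text \<open>Self-adjointness turns the mean of \<open>K.T u\<close> into
  \<open>l2ip \<mu> u mean\<close>, the contribution of the third term of k_T. The equality holds at
  every point, so the eigenspaces of the two operators coincide as sets of functions.\<close>

lemma T_op_eq:
  assumes u: "u \<in> L2 \<mu>"
  shows "T_op \<mu> u x = T.T u x"
proof -
  define c where "c = l2ip \<mu> mean (\<lambda>x. 1)"
  define a where "a = (\<integral>x. u x \<partial>\<mu>)"
  have a1: "l2ip \<mu> (\<lambda>x. 1) u = a" "l2ip \<mu> u (\<lambda>x. 1) = a" by (simp_all add: a_def l2ip_def)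
  have KP: "K_op \<mu> (P_op \<mu> u) y = K.T u y - a * mean y" for y
  proof -
    have "K.T (\<lambda>x. u x - a * 1) y = K.T u y - K.T (\<lambda>x. a * 1) y"
      by (rule K.T_diff[OF u]) (simp add: const_L2)
    also have "K.T (\<lambda>x. a * 1) y = a * mean y" unfolding mean_def by (rule K.T_scale)
    finally show ?thesis by (simp add: K_op_eq P_op_def a_def)
  qed
  have "(\<integral>y. K_op \<mu> (P_op \<mu> u) y \<partial>\<mu>) = l2ip \<mu> (\<lambda>y. K.T u y - a * mean y) (\<lambda>x. 1)"
    by (simp add: KP l2ip_def)
  also have "\<dots> = l2ip \<mu> (K.T u) (\<lambda>x. 1) - a * c"
    by (simp add: l2ip_diff_left K.T_L2 u L2_scale mean_L2 const_L2 l2ip_scale_left c_def)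
  also have "l2ip \<mu> (K.T u) (\<lambda>x. 1) = l2ip \<mu> u mean"
    unfolding mean_def by (rule K.T_selfadjoint[OF u const_L2])
  finally have "T_op \<mu> u x = K.T u x - a * mean x - (l2ip \<mu> u mean - a * c)"
    by (simp add: T_op_def P_op_def[of \<mu> "K_op \<mu> (P_op \<mu> u)"] KP)
  moreover have "T.T u x = K.T u x - mean x * a - l2ip \<mu> mean u + c * a"
  proof -
    have "T.T u x = l2ip \<mu> (\<lambda>y. (kern x y - mean y) + (c - mean x) * 1) u"
      by (simp add: T.T_eq_ip l2ip_def kern_T_eq c_def algebra_simps)
    also have "\<dots> = l2ip \<mu> (\<lambda>y. kern x y - mean y) u + l2ip \<mu> (\<lambda>y. (c - mean x) * 1) u"
      by (rule l2ip_add_left[OF L2_diff[OF K.k_section_L2 mean_L2] L2_scale[OF const_L2] u])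
    also have "\<dots> = (l2ip \<mu> (kern x) u - l2ip \<mu> mean u) + (c - mean x) * l2ip \<mu> (\<lambda>x. 1) u"
      by (simp only: l2ip_diff_left[OF K.k_section_L2 mean_L2 u] l2ip_scale_left)
    finally show ?thesis by (simp add: a1 K.T_eq_ip left_diff_distrib)
  qed
  ultimately show ?thesis by (simp add: l2ip_commute[of \<mu> mean u] mult.commute)
qed

lemma eigenspace_eq: "eigenspace \<mu> (T_dom \<mu>) (T_op \<mu>) r = eigenspace \<mu> (L2 \<mu>) T.T r"
  unfolding eigenspace_def T_dom_eq by (auto simp: T_op_eq)

lemma eig_mult_eq: "eig_mult \<mu> (T_dom \<mu>) (T_op \<mu>) r = eig_mult \<mu> (L2 \<mu>) T.T r"
  unfolding eig_mult_def eigenspace_eq ..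

lemma positive_semidefinite_eq:
  "positive_semidefinite_op \<mu> (T_dom \<mu>) (T_op \<mu>) \<longleftrightarrow> (\<forall>u\<in>L2 \<mu>. 0 \<le> l2ip \<mu> (T.T u) u)"
  unfolding positive_semidefinite_op_def T_dom_eq l2ip_def by (simp add: T_op_eq)

end

section \<open>Vanishing negative signature and positivity\<close>

lemma s_minus_op_eq_0I:
  assumes "\<And>r. r < 0 \<Longrightarrow> eig_mult \<mu> D A r = 0"
  shows "s_minus_op \<mu> D A = 0"
proof -
  have "(\<Sum>r\<in>F. eig_mult \<mu> D A r) = 0" if "F \<subseteq> {..<0}" for F
    using that assms by (intro sum.neutral) auto
  then have "s_minus_op \<mu> D A \<le> 0"
    unfolding s_minus_op_def by (intro SUP_least) simp
  then show ?thesis by simp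
qed

text \<open>At an eigenfunction u for r < 0 the form is \<open>r * l2ip \<mu> u u\<close>, which is
  nonnegative only if u is null. The domain is left general because T need not act on all of L^2
  when the fourth moment is infinite.\<close>

lemma s_minus_op_eq_0_if_positive_semidefinite:
  assumes D: "D \<subseteq> L2 \<mu>" and A: "\<And>u. u \<in> D \<Longrightarrow> A u \<in> L2 \<mu>"
    and psd: "positive_semidefinite_op \<mu> D A"
  shows "s_minus_op \<mu> D A = 0"
proof (rule s_minus_op_eq_0I)
  fix r :: real assume r: "r < 0"
  have zero: "AE x in \<mu>. u x = 0" if u: "u \<in> eigenspace \<mu> D A r" for u
  proof -
    have uD: "u \<in> D" "u \<in> L2 \<mu>" and ae: "AE x in \<mu>. A u x = r * u x"
      using u D by (auto simp: eigenspace_def)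
    have "0 \<le> l2ip \<mu> (A u) u"
      using psd uD by (simp add: positive_semidefinite_op_def l2ip_def)
    also have "l2ip \<mu> (A u) u = r * l2ip \<mu> u u"
      using l2ip_cong_AE[OF A[OF uD(1)] L2_scale[OF uD(2), of r] uD(2) ae] by (simp add: l2ip_scale_left)
    finally have "l2ip \<mu> u u = 0"
      using r l2ip_nonneg[of \<mu> u] by (simp add: zero_le_mult_iff)
    then show ?thesis using l2ip_eq_0_iff[OF uD(2)] by simp
  qed
  have n0: "n = 0" if u: "\<forall>i<n. u i \<in> eigenspace \<mu> D A r" and li: "lin_indep_AE \<mu> n u" for n u
  proof (rule ccontr)
    assume "n \<noteq> 0"
    have "AE x in \<mu>. \<forall>i\<in>{..<n}. u i x = 0"
      by (rule AE_finite_allI[OF finite_lessThan]) (rule zero, use u in simp)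
    then have "AE x in \<mu>. (\<Sum>i<n. 1 * u i x) = 0" by eventually_elim simp
    \<comment> \<open>Null functions satisfy every linear relation, in particular the one with all
      coefficients 1; independence leaves only the empty family.\<close>
    then have "\<forall>i<n. (1::real) = 0" using li[unfolded lin_indep_AE_def, rule_format, of "\<lambda>_. 1"] by auto
    then show False using \<open>n \<noteq> 0\<close> by auto
  qed
  have "eig_mult \<mu> D A r \<le> 0"
    unfolding eig_mult_def
  proof (rule SUP_least)
    fix n assume "n \<in> {n. \<exists>u. (\<forall>i<n. u i \<in> eigenspace \<mu> D A r) \<and> lin_indep_AE \<mu> n u}"
    then show "enat n \<le> 0" using n0 by (auto simp: zero_enat_def)
  qed
  then show "eig_mult \<mu> D A r = 0" by simp
qed

lemma s_minus_op_0_imp_no_negative_eigenvalue: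
  assumes 0: "s_minus_op \<mu> D A = 0" and r: "r < 0" and u: "u \<in> eigenspace \<mu> D A r"
  shows "AE x in \<mu>. u x = 0"
proof (rule ccontr)
  assume nz: "\<not> (AE x in \<mu>. u x = 0)"
  have "lin_indep_AE \<mu> 1 (\<lambda>_. u)"
    using nz by (auto simp: lin_indep_AE_def)
  then have "enat 1 \<le> eig_mult \<mu> D A r"
    unfolding eig_mult_def using u by (intro SUP_upper) auto
  also have "\<dots> = (\<Sum>r\<in>{r}. eig_mult \<mu> D A r)" by simp
  also have "\<dots> \<le> s_minus_op \<mu> D A"
    unfolding s_minus_op_def using r by (intro SUP_upper[of "{r}"]) auto
  finally show False using 0 by (simp add: zero_enat_def)
qed

text \<open>The variational existence result for the kernel \<open>- k x y\<close> with the empty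
  set S: a negative value of the form produces a negative eigenvalue of T.\<close>

lemma (in sym_kernel) psd_if_no_negative_eigvec:
  assumes no: "\<And>v r. r < 0 \<Longrightarrow> eigvec r v \<Longrightarrow> ip v v = 0"
    and u: "u \<in> L2 M"
  shows "0 \<le> ip (T u) u"
proof (rule ccontr)
  assume neg: "\<not> 0 \<le> ip (T u) u"
  interpret N: sym_kernel M "\<lambda>x y. - k x y" h
    by unfold_locales
      (use sets_M separable k_measurable k_sym k_bound k_continuous h_nonneg h_continuous h_L2 in
        \<open>auto intro!: continuous_intros\<close>)
  have NT: "N.T v = (\<lambda>x. - T v x)" for v by (rule ext) (simp add: N.T_def T_def)
  have "0 < ip (N.T u) u" using neg by (simp add: NT l2ip_def)
  then obtain v r where v: "0 < r" "N.eigvec r v" "ip v v = 1"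
    using N.exists_positive_eigvec[of "{}" u] u by (auto simp: N.perp_def)
  have "T v x = - r * v x" for x
  proof -
    have "- T v x = r * v x" using v(2) by (simp add: N.eigvec_def NT)
    then show ?thesis by simp
  qed
  then have "eigvec (- r) v" using v(2) by (simp add: eigvec_def N.eigvec_def)
  then show False using no[of "- r" v] v by simp
qed

context fourth_moment
begin

lemma s_minus_T_eq_0_iff:
  "s_minus_T \<mu> = 0 \<longleftrightarrow> positive_semidefinite_op \<mu> (T_dom \<mu>) (T_op \<mu>)"
proof
  assume 0: "s_minus_T \<mu> = 0"
  have "0 \<le> l2ip \<mu> (T.T u) u" if "u \<in> L2 \<mu>" for u
  proof (rule T.psd_if_no_negative_eigvec[OF _ that])
    fix v r assume r: "r < 0" and v: "T.eigvec r v"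
    then have "v \<in> eigenspace \<mu> (T_dom \<mu>) (T_op \<mu>) r" and vL2: "v \<in> L2 \<mu>"
      unfolding eigenspace_eq by (auto simp: eigenspace_def T.eigvec_def)
    then have "AE x in \<mu>. v x = 0"
      using s_minus_op_0_imp_no_negative_eigenvalue[OF 0[unfolded s_minus_T_def] r] by blast
    then show "l2ip \<mu> v v = 0" using l2ip_eq_0_iff[OF vL2] by simp
  qed
  then show "positive_semidefinite_op \<mu> (T_dom \<mu>) (T_op \<mu>)"
    unfolding positive_semidefinite_eq by blast
next
  assume psd: "positive_semidefinite_op \<mu> (T_dom \<mu>) (T_op \<mu>)"
  have "T_op \<mu> u = T.T u" if "u \<in> L2 \<mu>" for u using T_op_eq[OF that] by auto
  then show "s_minus_T \<mu> = 0"
    unfolding s_minus_T_def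
    by (intro s_minus_op_eq_0_if_positive_semidefinite[OF _ _ psd]) (auto simp: T_dom_eq T.T_L2)
qed

lemma psd_kernelI:
  assumes "full_support \<mu>" "s_minus_T \<mu> = 0"
  shows "psd_kernel \<mu> (kern_T \<mu>) weight_T"
proof
  show "0 \<le> l2ip \<mu> (T.T u) u" if "u \<in> L2 \<mu>" for u
    using assms(2) that unfolding s_minus_T_eq_0_iff positive_semidefinite_eq by blast
  show "0 < measure \<mu> U" if U: "open U" "U \<noteq> {}" for U
  proof -
    obtain x where x: "x \<in> U" using U by blast
    have "x \<in> measure_supp \<mu>" using assms(1) by (simp add: full_support_def)
    then have "0 < emeasure \<mu> U" using U x by (simp add: measure_supp_def)
    then show ?thesis by (simp add: emeasure_eq_measure)
  qed
qed

lemma kern_T_dist: "kern_T \<mu> x x - 2 * kern_T \<mu> x y + kern_T \<mu> y y = (dist x y)\<^sup>2"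
  by (simp add: kern_T_eq kern_def)

lemma exists_pos_eigensystem:
  assumes "full_support \<mu>" "s_minus_T \<mu> = 0"
  shows "\<exists>N l u. pos_eigensystem \<mu> N l u"
proof -
  interpret P: psd_kernel \<mu> "kern_T \<mu>" weight_T by (rule psd_kernelI[OF assms])
  obtain N l e where c: "P.complete_eigensystem {i. enat i < N} l e"
    by (rule P.exists_complete_eigensystem)
  then have es: "P.orthonormal_eigensystem {i. enat i < N} l e"
    by (simp add: P.complete_eigensystem_def)
  have e: "0 < l i" "T.eigvec (l i) (e i)" if "enat i < N" for i
    using es that by (auto simp: P.orthonormal_eigensystem_def)
  have "pos_eigensystem \<mu> N l e"
    unfolding pos_eigensystem_def
  proof (intro conjI allI impI)
    fix i assume i: "enat i < N"
    show "0 < l i" by (rule e(1)[OF i])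
    show "e i \<in> eigenspace \<mu> (T_dom \<mu>) (T_op \<mu>) (l i)"
      unfolding eigenspace_eq by (rule P.eigenspace_eigvec[OF e(2)[OF i]])
    show "e i x = inverse (l i) * (\<integral>y. kern_T \<mu> x y * e i y \<partial>\<mu>)" for x
      using e[OF i] by (simp add: T.eigvec_def T.T_def field_simps)
  next
    fix r :: real assume "0 < r"
    show "ecard {i. enat i < N \<and> l i = r} = eig_mult \<mu> (T_dom \<mu>) (T_op \<mu>) r"
      using P.eig_mult_complete[OF c \<open>0 < r\<close>] by (simp add: eig_mult_eq)
  next
    fix i j assume "enat i < N \<and> enat j < N"
    then show "(\<integral>x. e i x * e j x \<partial>\<mu>) = (if i = j then 1 else 0)"
      using es by (simp add: P.orthonormal_eigensystem_def l2ip_def)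
  qed
  then show ?thesis by blast
qed

text \<open>The condition on representatives makes each \<open>u i\<close> an eigenfunction at every
  point, and the count of multiplicities makes the system complete. Mercer's expansion therefore
  applies to any admissible enumeration, not only to a constructed one.\<close>

lemma pos_eigensystem_embedding:
  assumes "full_support \<mu>" "s_minus_T \<mu> = 0" and pe: "pos_eigensystem \<mu> N l u"
  shows "\<exists>f :: 'a \<Rightarrow> ell2. isometric_embedding f \<and> (\<forall>x. coord (f x) = eigenmap N l u x)"
proof -
  interpret P: psd_kernel \<mu> "kern_T \<mu>" weight_T by (rule psd_kernelI[OF assms(1,2)])
  let ?I = "{i. enat i < N}"
  have pos: "0 < l i" and mem: "u i \<in> eigenspace \<mu> (T_dom \<mu>) (T_op \<mu>) (l i)"
    and rep: "u i x = inverse (l i) * T.T (u i) x" if "enat i < N" for i x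
    using pe that unfolding pos_eigensystem_def T.T_def by blast+
  have mult: "ecard {i. enat i < N \<and> l i = r} = eig_mult \<mu> (T_dom \<mu>) (T_op \<mu>) r" if "0 < r" for r
    using pe that unfolding pos_eigensystem_def by blast
  have on: "l2ip \<mu> (u i) (u j) = (if i = j then 1 else 0)" if "enat i < N" "enat j < N" for i j
    using pe that unfolding pos_eigensystem_def l2ip_def by blast
  have "T.eigvec (l i) (u i)" if i: "enat i < N" for i
    unfolding T.eigvec_def
  proof (intro conjI allI)
    show "u i \<in> L2 \<mu>" using mem[OF i] by (simp add: eigenspace_def T_dom_eq)
    show "T.T (u i) x = l i * u i x" for x
      by (subst rep[OF i]) (use pos[OF i] in simp)
  qed
  then have es: "P.orthonormal_eigensystem ?I l u"
    using pos on by (simp add: P.orthonormal_eigensystem_def)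
  have "P.complete_eigensystem ?I l u"
    by (rule P.complete_if_multiplicities[OF es]) (simp add: mult flip: eig_mult_eq)
  then have "T.T w x = 0" if "w \<in> T.perp (u ` ?I)" for w x
    using that by (simp add: P.complete_eigensystem_def)
  from P.eigensystem_embedding[OF es this] obtain f :: "'a \<Rightarrow> ell2"
    where f: "\<And>x. coord (f x) = (\<lambda>i. if i \<in> ?I then sqrt (l i) * u i x else 0)"
      and ip: "\<And>x y. inner (f x) (f y) = kern_T \<mu> x y"
    by blast
  have "dist (f x) (f y) = dist x y" for x y
  proof -
    have "(dist (f x) (f y))\<^sup>2 = (dist x y)\<^sup>2"
      unfolding dist_norm power2_norm_eq_inner
      using kern_T_dist[of x y] T.k_sym[of x y] by (simp add: inner_diff_left inner_diff_right ip)
    then show ?thesis by simp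
  qed
  then show ?thesis using f by (intro exI[of _ f]) (auto simp: isometric_embedding_def eigenmap_def)
qed

end

section \<open>Embedded spaces have a positive semidefinite operator\<close>

lemma T_op_L2:
  assumes "borel_prob \<mu>" "u \<in> T_dom \<mu>"
  shows "T_op \<mu> u \<in> L2 \<mu>"
proof -
  interpret prob_space \<mu> using assms(1) by (simp add: borel_prob_def)
  show ?thesis using assms(2) P_op_in_L2 by (simp add: T_op_def T_dom_def K_dom_def)
qed

text \<open>With \<open>F x = \<phi> x - \<phi> x\<^sub>0\<close>, orthogonality of \<open>v\<close> to the constants leaves only the
  inner product in the expansion of the squared distance, so the form of the operator is
  the squared norm of the weak integral of \<open>F v\<close>, computed coordinatewise.\<close>

lemma ell2_embedding_imp_positive_semidefinite:
  fixes \<phi> :: "'a::metric_space \<Rightarrow> ell2" and \<mu> :: "'a measure"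
  assumes \<phi>: "isometric_embedding \<phi>" and \<mu>: "borel_prob \<mu>"
  shows "positive_semidefinite_op \<mu> (T_dom \<mu>) (T_op \<mu>)"
  unfolding positive_semidefinite_op_def
proof
  interpret prob_space \<mu> using \<mu> by (simp add: borel_prob_def)
  fix u assume u: "u \<in> T_dom \<mu>"
  define v where "v = P_op \<mu> u"
  define Kv where "Kv = K_op \<mu> v"
  have uL2: "u \<in> L2 \<mu>" and vL2: "v \<in> L2 \<mu>" and KvL2: "Kv \<in> L2 \<mu>"
    and int_ae: "AE x in \<mu>. integrable \<mu> (\<lambda>y. (dist x y)\<^sup>2 * v y)"
    using u by (auto simp: T_dom_def K_dom_def v_def Kv_def)
  have v_int: "integrable \<mu> v" by (rule integrable_L2[OF vL2])
  have v0: "(\<integral>x. v x \<partial>\<mu>) = 0"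
    using integrable_L2[OF uL2] by (simp add: v_def P_op_def prob_space)
  \<comment> \<open>One point with a convergent integral suffices: it makes
    \<open>(q y)\<^sup>2 * v y\<close> integrable and, as v is integrable, also
    \<open>q y * v y\<close>, which dominates the integrals below.\<close>
  obtain x0 where x0: "integrable \<mu> (\<lambda>y. (dist x0 y)\<^sup>2 * v y)"
    using AE_E_prob[OF int_ae] by (metis (no_types, lifting) AE_False int_ae eventually_mono)
  define F where "F x = \<phi> x - \<phi> x0" for x
  have F_diff: "norm (F x - F y) = dist x y" for x y
    using \<phi> by (simp add: F_def isometric_embedding_def flip: dist_norm)
  have F_norm: "norm (F x) = dist x0 x" for x
    using F_diff[of x x0] by (simp add: F_def dist_commute)
  define q where "q x = dist x0 x" for x
  have q0: "0 \<le> q x" for x by (simp add: q_def)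
  have cont_meas: "f \<in> borel_measurable \<mu>" if "continuous_on UNIV f" for f :: "'a \<Rightarrow> real"
    using borel_measurable_continuous_onI[OF that] \<mu> measurable_cong_sets[of \<mu> borel borel borel]
    by (auto simp: borel_prob_def)
  have q_meas: "q \<in> borel_measurable \<mu>"
    unfolding q_def by (intro cont_meas continuous_intros)
  have F_cont: "continuous_on UNIV (\<lambda>x. coord (F x) i)" for i
  proof (rule continuous_onI)
    fix x and e :: real assume "0 < e"
    moreover have "dist (coord (F y) i) (coord (F x) i) \<le> dist y x" for y
      using abs_coord_le_norm[of "F y - F x" i] F_diff[of y x]
      by (simp add: minus_ell2.rep_eq dist_real_def)
    ultimately show "\<exists>d>0. \<forall>y\<in>UNIV. dist y x < d \<longrightarrow> dist (coord (F y) i) (coord (F x) i) \<le> e"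
      by (intro exI[of _ e]) (auto intro: order_trans less_imp_le)
  qed
  have F_meas: "(\<lambda>x. coord (F x) i) \<in> borel_measurable \<mu>" for i
    by (rule cont_meas[OF F_cont])
  have v_meas: "v \<in> borel_measurable \<mu>" by (rule L2_D(1)[OF vL2])
  have qv_int: "integrable \<mu> (\<lambda>y. q y * v y)"
  proof (rule Bochner_Integration.integrable_bound)
    show "integrable \<mu> (\<lambda>y. \<bar>v y\<bar> + \<bar>(q y)\<^sup>2 * v y\<bar>)"
      using v_int x0 by (auto simp: q_def)
    show "(\<lambda>y. q y * v y) \<in> borel_measurable \<mu>" using q_meas v_meas by measurable
    have "q y * \<bar>v y\<bar> \<le> (1 + (q y)\<^sup>2) * \<bar>v y\<bar>" for y
    proof (rule mult_right_mono)
      show "q y \<le> 1 + (q y)\<^sup>2"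
        using sum_squares_bound[of "q y" 1] q0[of y] by simp
    qed simp
    then show "AE y in \<mu>. norm (q y * v y) \<le> norm (\<bar>v y\<bar> + \<bar>(q y)\<^sup>2 * v y\<bar>)"
      using q0 by (intro AE_I2) (simp add: abs_mult distrib_right)
  qed
  have dom: "integrable \<mu> (\<lambda>y. q x * \<bar>q y * v y\<bar>)" for x
    using integrable_mult_right[OF integrable_abs[OF qv_int], of "q x"] by simp
  \<comment> \<open>Coordinates of the weak integral of F against v. Their square summability is not
    presupposed: it results from the convergence of the partial sums of squares to the form.\<close>
  define w where "w i = (\<integral>y. coord (F y) i * v y \<partial>\<mu>)" for i
  have partial_le: "\<bar>\<Sum>i<n. coord (F x) i * coord (F y) i\<bar> \<le> q x * q y" for n x y
  proof (rule power2_le_imp_le)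
    have "\<bar>\<Sum>i<n. coord (F x) i * coord (F y) i\<bar>\<^sup>2 \<le> (\<Sum>i<n. (coord (F x) i)\<^sup>2) * (\<Sum>i<n. (coord (F y) i)\<^sup>2)"
      using Cauchy_Schwarz_ineq_sum[of "coord (F x)" "coord (F y)" "{..<n}"] by simp
    also have "\<dots> \<le> (norm (F x))\<^sup>2 * (norm (F y))\<^sup>2"
      by (intro mult_mono sum_coord_le_norm sum_nonneg) auto
    finally show "\<bar>\<Sum>i<n. coord (F x) i * coord (F y) i\<bar>\<^sup>2 \<le> (q x * q y)\<^sup>2"
      by (simp add: F_norm q_def power_mult_distrib)
  qed (simp add: q0)
  have partial_dom: "\<bar>(\<Sum>i<n. coord (F x) i * coord (F y) i) * v y\<bar> \<le> q x * \<bar>q y * v y\<bar>" for n x y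
  proof -
    have "\<bar>\<Sum>i<n. coord (F x) i * coord (F y) i\<bar> * \<bar>v y\<bar> \<le> (q x * q y) * \<bar>v y\<bar>"
      by (intro mult_right_mono partial_le) simp
    then show ?thesis using q0[of y] by (simp add: abs_mult mult.assoc)
  qed
  have partial_int: "integrable \<mu> (\<lambda>y. (\<Sum>i<n. coord (F x) i * coord (F y) i) * v y)" for n x
    by (rule Bochner_Integration.integrable_bound[OF dom[of x]])
      (use F_meas v_meas partial_dom q0 in \<open>auto intro!: borel_measurable_times borel_measurable_sum simp: abs_mult\<close>)
  have coord_int: "integrable \<mu> (\<lambda>y. coord (F y) i * v y)" for i
  proof (rule Bochner_Integration.integrable_bound[OF qv_int])
    show "(\<lambda>y. coord (F y) i * v y) \<in> borel_measurable \<mu>" using F_meas[of i] v_meas by measurable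
    show "AE y in \<mu>. norm (coord (F y) i * v y) \<le> norm (q y * v y)"
      using abs_coord_le_norm[of "F _" i] q0
      by (intro AE_I2) (auto simp: abs_mult F_norm q_def intro!: mult_right_mono)
  qed
  have partial_eq: "(\<integral>y. (\<Sum>i<n. coord (F x) i * coord (F y) i) * v y \<partial>\<mu>) = (\<Sum>i<n. coord (F x) i * w i)" for n x
  proof -
    have "(\<integral>y. (\<Sum>i<n. coord (F x) i * coord (F y) i) * v y \<partial>\<mu>)
        = (\<integral>y. (\<Sum>i<n. coord (F x) i * (coord (F y) i * v y)) \<partial>\<mu>)"
      by (simp add: sum_distrib_right mult.assoc)
    also have "\<dots> = (\<Sum>i<n. \<integral>y. coord (F x) i * (coord (F y) i * v y) \<partial>\<mu>)"
      by (rule Bochner_Integration.integral_sum) (intro integrable_mult_right coord_int)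
    finally show ?thesis by (simp add: w_def)
  qed
  define W where "W x = (\<integral>y. inner (F x) (F y) * v y \<partial>\<mu>)" for x
  have inner_lim: "(\<lambda>n. (\<Sum>i<n. coord (F x) i * coord (F y) i) * v y) \<longlonglongrightarrow> inner (F x) (F y) * v y" for x y
    using summable_LIMSEQ[OF summable_coord_prod[of "F x" "F y"]]
    unfolding inner_ell2_def by (rule tendsto_mult_right)
  have inner_meas: "(\<lambda>y. inner (F x) (F y) * v y) \<in> borel_measurable \<mu>" for x
    by (rule borel_measurable_LIMSEQ_real[OF inner_lim]) (rule borel_measurable_integrable[OF partial_int])
  have W_lim: "(\<lambda>n. \<Sum>i<n. coord (F x) i * w i) \<longlonglongrightarrow> W x" for x
    unfolding W_def partial_eq[symmetric]
  proof (rule integral_dominated_convergence)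
    show "(\<lambda>y. inner (F x) (F y) * v y) \<in> borel_measurable \<mu>" by (rule inner_meas)
    show "(\<lambda>y. (\<Sum>i<n. coord (F x) i * coord (F y) i) * v y) \<in> borel_measurable \<mu>" for n
      by (rule borel_measurable_integrable[OF partial_int])
    show "integrable \<mu> (\<lambda>y. q x * \<bar>q y * v y\<bar>)" by (rule dom)
    show "AE y in \<mu>. (\<lambda>n. (\<Sum>i<n. coord (F x) i * coord (F y) i) * v y) \<longlonglongrightarrow> inner (F x) (F y) * v y"
      by (intro AE_I2 inner_lim)
    show "AE y in \<mu>. norm ((\<Sum>i<n. coord (F x) i * coord (F y) i) * v y) \<le> q x * \<bar>q y * v y\<bar>" for n
      using partial_dom by simp
  qed
  define C where "C = (\<integral>y. \<bar>q y * v y\<bar> \<partial>\<mu>)"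
  have W_partial_bound: "\<bar>\<Sum>i<n. coord (F x) i * w i\<bar> \<le> C * q x" for n x
  proof -
    have "\<bar>\<Sum>i<n. coord (F x) i * w i\<bar> \<le> (\<integral>y. q x * \<bar>q y * v y\<bar> \<partial>\<mu>)"
      unfolding partial_eq[symmetric]
      by (rule order_trans[OF integral_abs_bound integral_mono[OF integrable_abs[OF partial_int] dom partial_dom]])
    then show ?thesis by (simp add: C_def mult.commute)
  qed
  have inner_int: "integrable \<mu> (\<lambda>y. inner (F x) (F y) * v y)" for x
  proof (rule Bochner_Integration.integrable_bound[OF dom[of x] inner_meas])
    show "AE y in \<mu>. norm (inner (F x) (F y) * v y) \<le> norm (q x * \<bar>q y * v y\<bar>)"
    proof (rule AE_I2)
      fix y
      have "\<bar>inner (F x) (F y)\<bar> * \<bar>v y\<bar> \<le> (q x * q y) * \<bar>v y\<bar>"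
        using Cauchy_Schwarz_ineq2[of "F x" "F y"] by (intro mult_right_mono) (auto simp: F_norm q_def)
      then show "norm (inner (F x) (F y) * v y) \<le> norm (q x * \<bar>q y * v y\<bar>)"
        using q0[of x] q0[of y] by (simp add: abs_mult mult.assoc)
    qed
  qed
  \<comment> \<open>In the expansion of the squared distance the term \<open>(q x)\<^sup>2\<close>
    drops out because v has mean zero; the term \<open>(q y)\<^sup>2\<close> leaves a constant,
    which disappears at the end for the same reason.\<close>
  have Kv_eq: "Kv x = W x - (\<integral>y. (q y)\<^sup>2 * v y \<partial>\<mu>) / 2" for x
  proof -
    have "(dist x y)\<^sup>2 * v y = (q x)\<^sup>2 * v y + (q y)\<^sup>2 * v y - 2 * (inner (F x) (F y) * v y)" for y
    proof -
      have "(dist x y)\<^sup>2 = (q x)\<^sup>2 + (q y)\<^sup>2 - 2 * inner (F x) (F y)"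
      proof -
        have "(norm (F x - F y))\<^sup>2 = (norm (F x))\<^sup>2 + (norm (F y))\<^sup>2 - 2 * inner (F x) (F y)"
          unfolding power2_norm_eq_inner by (simp add: inner_diff_left inner_diff_right inner_commute)
        then show ?thesis by (simp only: F_diff F_norm q_def)
      qed
      then show ?thesis by (simp add: left_diff_distrib distrib_right)
    qed
    moreover have "integrable \<mu> (\<lambda>y. (q y)\<^sup>2 * v y)" using x0 by (simp add: q_def)
    ultimately have "(\<integral>y. (dist x y)\<^sup>2 * v y \<partial>\<mu>) = (\<integral>y. (q y)\<^sup>2 * v y \<partial>\<mu>) - 2 * W x"
      using v_int inner_int[of x] by (simp add: v0 W_def)
    then show ?thesis by (simp add: Kv_def K_op_def field_simps)
  qed
  have W_meas: "W \<in> borel_measurable \<mu>"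
    by (rule borel_measurable_LIMSEQ_real[OF W_lim]) (use F_meas in measurable)
  have Wv_lim: "(\<lambda>n. \<integral>x. (\<Sum>i<n. coord (F x) i * w i) * v x \<partial>\<mu>) \<longlonglongrightarrow> (\<integral>x. W x * v x \<partial>\<mu>)"
    and Wv_int: "integrable \<mu> (\<lambda>x. W x * v x)"
  proof -
    have a: "(\<lambda>x. W x * v x) \<in> borel_measurable \<mu>" using W_meas v_meas by measurable
    have b: "(\<lambda>x. (\<Sum>i<n. coord (F x) i * w i) * v x) \<in> borel_measurable \<mu>" for n
      using F_meas v_meas by measurable
    have c: "integrable \<mu> (\<lambda>x. C * \<bar>q x * v x\<bar>)"
      using integrable_mult_right[OF integrable_abs[OF qv_int], of C] by simp
    have d: "AE x in \<mu>. (\<lambda>n. (\<Sum>i<n. coord (F x) i * w i) * v x) \<longlonglongrightarrow> W x * v x"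
      by (intro AE_I2 tendsto_mult_right W_lim)
    have e: "AE x in \<mu>. norm ((\<Sum>i<n. coord (F x) i * w i) * v x) \<le> C * \<bar>q x * v x\<bar>" for n
    proof (rule AE_I2)
      fix x
      show "norm ((\<Sum>i<n. coord (F x) i * w i) * v x) \<le> C * \<bar>q x * v x\<bar>"
        using q0[of x] mult_right_mono[OF W_partial_bound abs_ge_zero[of "v x"], of x n]
        by (simp add: abs_mult mult.assoc)
    qed
    show "(\<lambda>n. \<integral>x. (\<Sum>i<n. coord (F x) i * w i) * v x \<partial>\<mu>) \<longlonglongrightarrow> (\<integral>x. W x * v x \<partial>\<mu>)"
      by (rule integral_dominated_convergence[OF a b c d e])
    show "integrable \<mu> (\<lambda>x. W x * v x)"
      by (rule integrable_dominated_convergence[OF a b c d e])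
  qed
  have "(\<integral>x. (\<Sum>i<n. coord (F x) i * w i) * v x \<partial>\<mu>) = (\<Sum>i<n. (w i)\<^sup>2)" for n
  proof -
    have "(\<integral>x. (\<Sum>i<n. coord (F x) i * w i) * v x \<partial>\<mu>) = (\<integral>x. (\<Sum>i<n. w i * (coord (F x) i * v x)) \<partial>\<mu>)"
      unfolding sum_distrib_right by (simp add: mult_ac)
    also have "\<dots> = (\<Sum>i<n. \<integral>x. w i * (coord (F x) i * v x) \<partial>\<mu>)"
      by (rule Bochner_Integration.integral_sum) (intro integrable_mult_right coord_int)
    finally show ?thesis by (simp add: w_def power2_eq_square)
  qed
  then have "(\<lambda>n. \<Sum>i<n. (w i)\<^sup>2) \<longlonglongrightarrow> (\<integral>x. W x * v x \<partial>\<mu>)" using Wv_lim by simp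
  then have W_pos: "0 \<le> (\<integral>x. W x * v x \<partial>\<mu>)"
    by (rule LIMSEQ_le_const) (simp add: sum_nonneg)
  define c where "c = (\<integral>x. Kv x \<partial>\<mu>)"
  define a where "a = (\<integral>x. u x \<partial>\<mu>)"
  have one: "(\<lambda>x. 1) \<in> L2 \<mu>" by (simp add: L2_def)
  have "(\<integral>x. T_op \<mu> u x * u x \<partial>\<mu>) = l2ip \<mu> (\<lambda>x. Kv x - c * 1) u"
    by (simp add: l2ip_def T_op_def P_op_def[of \<mu> "K_op \<mu> (P_op \<mu> u)"] c_def Kv_def v_def)
  also have "\<dots> = l2ip \<mu> Kv u - c * l2ip \<mu> (\<lambda>x. 1) u"
    by (subst l2ip_diff_left[OF KvL2 L2_scale[OF one] uL2]) (simp only: l2ip_scale_left)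
  \<comment> \<open>Both subtracted terms are \<open>a * c\<close>; exchanging them moves the
    projector from the left factor to the right one.\<close>
  also have "\<dots> = l2ip \<mu> Kv u - a * l2ip \<mu> Kv (\<lambda>x. 1)"
    by (simp add: l2ip_def a_def c_def)
  also have "\<dots> = l2ip \<mu> Kv (\<lambda>x. u x - a * 1)"
    by (subst l2ip_diff_right[OF KvL2 uL2 L2_scale[OF one]]) (simp only: l2ip_scale_right)
  also have "(\<lambda>x. u x - a * 1) = v" by (simp add: v_def P_op_def a_def)
  also have "l2ip \<mu> Kv v = (\<integral>x. W x * v x \<partial>\<mu>)"
    using Wv_int v_int by (simp add: l2ip_def Kv_eq left_diff_distrib v0)
  finally show "0 \<le> (\<integral>x. T_op \<mu> u x * u x \<partial>\<mu>)" using W_pos by simp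
qed

lemma ell2_embedding_imp_s_minus_T:
  fixes \<phi> :: "'a::metric_space \<Rightarrow> ell2" and \<mu> :: "'a measure"
  assumes "isometric_embedding \<phi>" "borel_prob \<mu>"
  shows "s_minus_T \<mu> = 0"
  unfolding s_minus_T_def
  using ell2_embedding_imp_positive_semidefinite[OF assms] T_op_L2[OF assms(2)]
  by (intro s_minus_op_eq_0_if_positive_semidefinite) (auto simp: T_dom_def)

section \<open>Measures of full support and embeddings into the sequence space\<close>

lemma separable_space_dense_sequence:
  assumes "separable_space (euclidean :: 'a::metric_space topology)"
  shows "\<exists>X :: nat \<Rightarrow> 'a. closure (range X) = UNIV"
proof -
  obtain D where "countable D \<and> closure D = (UNIV :: 'a set)"
    using countable_dense_if_separable[OF assms] ..
  then have D: "countable D" "closure D = UNIV" by simp_all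
  then have "D \<noteq> {}" by auto
  then have "range (from_nat_into D) = D" by (rule range_from_nat_into[OF _ D(1)])
  then show ?thesis using D(2) by metis
qed

lemma exists_full_support_measure:
  assumes "separable_space (euclidean :: 'a::metric_space topology)"
  shows "\<exists>\<mu> :: 'a measure. borel_prob \<mu> \<and> full_support \<mu> \<and> finite_fourth_moment \<mu>"
proof -
  obtain X :: "nat \<Rightarrow> 'a" where X: "closure (range X) = UNIV"
    using separable_space_dense_sequence[OF assms] ..
  define d where "d n = dist (X 0) (X n) ^ 4" for n
  \<comment> \<open>The geometric factor keeps the total mass finite and the denominator tames the
    fourth moment: both \<open>w n\<close> and \<open>w n * d n\<close> are at most (1/2)^(n+1), and
    every atom keeps positive mass.\<close>
  define w where "w n = (1 / 2) ^ Suc n / (1 + d n)" for n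
  have d0: "0 \<le> d n" for n by (simp add: d_def)
  have half: "summable (\<lambda>n. (1 / 2 :: real) ^ Suc n)" using power_half_series sums_summable by blast
  have w0: "0 < w n" for n using d0[of n] by (simp add: w_def add_pos_nonneg)
  have w_le: "w n \<le> (1 / 2) ^ Suc n" "w n * d n \<le> (1 / 2) ^ Suc n" for n
    using d0[of n] by (simp_all add: w_def field_simps add_pos_nonneg)
  have sw: "summable w"
    by (rule summable_comparison_test'[OF half]) (use w_le(1) w0 in \<open>simp add: less_imp_le\<close>)
  define W where "W = suminf w"
  have W0: "0 < W" unfolding W_def by (rule suminf_pos[OF sw w0])
  define P where "P = embed_pmf (\<lambda>n. w n / W)"
  have "(\<integral>\<^sup>+ n. ennreal (w n / W) \<partial>count_space UNIV) = (\<Sum>n. ennreal (w n / W))"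
    by (rule nn_integral_count_space_nat)
  also have "\<dots> = ennreal (\<Sum>n. w n / W)"
    using w0 W0 sw by (intro suminf_ennreal2 summable_divide) (auto intro: less_imp_le)
  also have "(\<Sum>n. w n / W) = 1" using suminf_divide[OF sw, of W] W0 by (simp add: W_def)
  finally have P: "pmf P n = w n / W" for n
    unfolding P_def using w0 W0 by (intro pmf_embed_pmf) (auto intro: less_imp_le)
  define \<mu> where "\<mu> = distr (measure_pmf P) borel X"
  have Xm: "X \<in> measurable (measure_pmf P) borel" by simp
  have "borel_prob \<mu>"
    unfolding borel_prob_def \<mu>_def by (simp add: measure_pmf.prob_space_distr)
  moreover have "full_support \<mu>"
    unfolding full_support_def measure_supp_def
  proof (intro equalityI subset_UNIV subsetI CollectI allI impI)
    fix x :: 'a and U assume U: "open U \<and> x \<in> U"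
    have "U \<inter> range X \<noteq> {}" using U X open_Int_closure_eq_empty[of U "range X"] by auto
    then obtain n where n: "X n \<in> U" by auto
    have "0 < pmf P n" using w0 W0 by (simp add: P)
    then have "0 < ennreal (pmf P n)" by simp
    also have "\<dots> = emeasure (measure_pmf P) {n}" by (simp add: emeasure_pmf_single)
    also have "\<dots> \<le> emeasure (measure_pmf P) (X -` U)" using n by (intro emeasure_mono) auto
    also have "\<dots> = emeasure \<mu> U"
      unfolding \<mu>_def using U by (subst emeasure_distr[OF Xm]) auto
    finally show "0 < emeasure \<mu> U" .
  qed
  moreover have "finite_fourth_moment \<mu>"
    unfolding finite_fourth_moment_def
  proof
    have "(\<lambda>y. dist (X 0) y ^ 4) \<in> borel_measurable borel"
      by (intro borel_measurable_continuous_onI continuous_intros)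
    then have "(\<integral>\<^sup>+ y. ennreal (dist (X 0) y ^ 4) \<partial>\<mu>) = (\<integral>\<^sup>+ n. ennreal (d n) \<partial>measure_pmf P)"
      unfolding \<mu>_def d_def by (subst nn_integral_distr[OF Xm]) auto
    also have "\<dots> = (\<integral>\<^sup>+ n. ennreal (w n / W) * ennreal (d n) \<partial>count_space UNIV)"
      by (simp add: nn_integral_measure_pmf P)
    also have "\<dots> = (\<Sum>n. ennreal (w n / W * d n))"
    proof -
      have "ennreal (w n / W) * ennreal (d n) = ennreal (w n / W * d n)" for n
        using w0[of n] W0 d0 by (intro ennreal_mult[symmetric]) auto
      then show ?thesis by (simp only: nn_integral_count_space_nat)
    qed
    also have "\<dots> \<le> (\<Sum>n. ennreal ((1 / 2) ^ Suc n / W))"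
    proof (intro suminf_le summableI ennreal_leI)
      show "w n / W * d n \<le> (1 / 2) ^ Suc n / W" for n
        using divide_right_mono[OF w_le(2)[of n], of W] W0 by simp
    qed
    also have "\<dots> = ennreal (\<Sum>n. (1 / 2) ^ Suc n / W)"
      using W0 half by (intro suminf_ennreal2 summable_divide) auto
    also have "\<dots> < \<infinity>" by simp
    finally show "(\<integral>\<^sup>+ y. ennreal (dist (X 0) y ^ 4) \<partial>\<mu>) < \<infinity>" .
  qed
  ultimately show ?thesis by blast
qed

text \<open>Gram--Schmidt with the convention \<open>sgn 0 = 0\<close>: linearly dependent terms become 0.\<close>

fun orthonormalization :: "(nat \<Rightarrow> 'b::real_inner) \<Rightarrow> nat \<Rightarrow> 'b" where
  "orthonormalization y n =
     sgn (y n - (\<Sum>i\<in>{..<n}. inner (y n) (orthonormalization y i) *\<^sub>R orthonormalization y i))"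

declare orthonormalization.simps [simp del]

text \<open>Each term is a unit vector or 0. The identity covers both cases and stands in for the
  normalization to length 1.\<close>

lemma inner_orthonormalization_self:
  "inner z (orthonormalization y j) * inner (orthonormalization y j) (orthonormalization y j)
    = inner z (orthonormalization y j)"
proof (cases "orthonormalization y j = 0")
  case False
  then have "norm (orthonormalization y j) = 1"
    by (subst (asm) orthonormalization.simps, subst orthonormalization.simps) (simp add: norm_sgn sgn_zero_iff)
  then show ?thesis by (simp flip: power2_norm_eq_inner)
qed simp

lemma orthonormalization_orthogonal_less:
  "j < n \<Longrightarrow> inner (orthonormalization y n) (orthonormalization y j) = 0"
proof (induction n arbitrary: j rule: less_induct)
  case (less n)
  let ?e = "orthonormalization y"
  have orth: "inner (?e i) (?e j) = 0" if "i < n" "i \<noteq> j" for i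
    using that less.prems less.IH[of j i] less.IH[of i j]
    by (cases i j rule: linorder_cases) (simp_all add: inner_commute)
  have "inner (\<Sum>i\<in>{..<n}. inner (y n) (?e i) *\<^sub>R ?e i) (?e j)
      = (\<Sum>i\<in>{..<n}. inner (y n) (?e i) * inner (?e i) (?e j))"
    by (simp add: inner_sum_left)
  also have "\<dots> = (\<Sum>i\<in>{..<n}. if i = j then inner (y n) (?e j) else 0)"
    using orth inner_orthonormalization_self by (intro sum.cong) auto
  finally have "inner (y n - (\<Sum>i\<in>{..<n}. inner (y n) (?e i) *\<^sub>R ?e i)) (?e j) = 0"
    using less.prems by (simp add: inner_diff_left)
  then show ?case
    by (subst orthonormalization.simps) (simp add: sgn_div_norm)
qed

lemma orthonormalization_orthogonal:
  "i \<noteq> j \<Longrightarrow> inner (orthonormalization y i) (orthonormalization y j) = 0"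
  using orthonormalization_orthogonal_less[of i j y] orthonormalization_orthogonal_less[of j i y]
  by (metis inner_commute nat_neq_iff)

lemma in_span_orthonormalization: "y n \<in> span (range (orthonormalization y))"
proof -
  let ?e = "orthonormalization y" and ?r = "y n - (\<Sum>i\<in>{..<n}. inner (y n) (orthonormalization y i) *\<^sub>R orthonormalization y i)"
  have "?r = norm ?r *\<^sub>R sgn ?r" by (cases "?r = 0") (simp_all add: sgn_div_norm)
  also have "sgn ?r = ?e n" by (rule orthonormalization.simps[symmetric])
  finally have "y n = norm ?r *\<^sub>R ?e n + (\<Sum>i\<in>{..<n}. inner (y n) (?e i) *\<^sub>R ?e i)"
    by (simp add: diff_eq_eq)
  moreover have "norm ?r *\<^sub>R ?e n + (\<Sum>i\<in>{..<n}. inner (y n) (?e i) *\<^sub>R ?e i) \<in> span (range ?e)"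
    by (intro span_add span_scale span_sum span_base rangeI)
  ultimately show ?thesis by simp
qed

lemma orthonormalization_Bessel:
  "(\<Sum>i<n. (inner z (orthonormalization y i))\<^sup>2) \<le> (norm z)\<^sup>2"
proof -
  let ?e = "orthonormalization y"
  define p where "p = (\<Sum>i<n. inner z (?e i) *\<^sub>R ?e i)"
  have pe: "inner p (?e j) = inner z (?e j)" if "j < n" for j
  proof -
    have "inner p (?e j) = (\<Sum>i<n. inner z (?e i) * inner (?e i) (?e j))"
      by (simp add: p_def inner_sum_left)
    also have "\<dots> = (\<Sum>i<n. if i = j then inner z (?e j) else 0)"
      using orthonormalization_orthogonal[of _ j y] inner_orthonormalization_self by (intro sum.cong) auto
    finally show ?thesis using that by simp
  qed
  define B where "B = (\<Sum>i<n. (inner z (?e i))\<^sup>2)"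
  have zp: "inner z p = B" by (simp add: p_def B_def inner_sum_right power2_eq_square)
  have "inner p p = (\<Sum>i<n. inner z (?e i) * inner p (?e i))"
    unfolding p_def by (simp add: inner_sum_right)
  also have "\<dots> = B" using pe by (simp add: B_def power2_eq_square)
  finally have pp: "inner p p = B" .
  have "0 \<le> inner (z - p) (z - p)" by simp
  also have "\<dots> = inner z z - B"
    using zp pp by (simp add: inner_diff_left inner_diff_right inner_commute[of p z])
  finally show ?thesis by (simp add: B_def power2_norm_eq_inner)
qed

text \<open>The target may be nonseparable, so only the coordinates along the orthonormalized images
  of a dense sequence are kept. The coordinate map V is a contraction and preserves inner products
  with vectors of the span; the composite is 1-Lipschitz and isometric on the dense sequence, hence
  isometric throughout.\<close>

lemma inner_space_embedding_imp_ell2_embedding: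
  fixes \<phi> :: "'a::metric_space \<Rightarrow> 'h::real_inner"
  assumes sep: "separable_space (euclidean :: 'a topology)" and \<phi>: "isometric_embedding \<phi>"
  shows "\<exists>\<psi> :: 'a \<Rightarrow> ell2. isometric_embedding \<psi>"
proof -
  obtain X :: "nat \<Rightarrow> 'a" where X: "closure (range X) = UNIV"
    using separable_space_dense_sequence[OF sep] ..
  define e where "e = orthonormalization (\<lambda>n. \<phi> (X n))"
  define V where "V z = Abs_ell2 (\<lambda>i. inner z (e i))" for z
  have V: "coord (V z) = (\<lambda>i. inner z (e i))" for z
    unfolding V_def
  proof (rule Abs_ell2_inverse, rule CollectI, rule summableI_nonneg_bounded)
    show "(\<Sum>i<n. (inner z (e i))\<^sup>2) \<le> (norm z)\<^sup>2" for n
      unfolding e_def by (rule orthonormalization_Bessel)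
  qed simp
  have V_add: "V (z + z') = V z + V z'" and V_diff: "V (z - z') = V z - V z'"
    and V_scale: "V (c *\<^sub>R z) = c *\<^sub>R V z" and V_0: "V 0 = 0" for z z' c
    by (simp_all add: coord_inject[symmetric] plus_ell2.rep_eq minus_ell2.rep_eq scaleR_ell2.rep_eq
        zero_ell2.rep_eq V inner_add_left inner_diff_left fun_eq_iff)
  have V_norm: "norm (V z) \<le> norm z" for z
  proof (rule power2_le_imp_le)
    show "(norm (V z))\<^sup>2 \<le> (norm z)\<^sup>2"
      unfolding norm_ell2_power2
      by (rule suminf_le_const[OF summable_coord]) (simp add: V e_def orthonormalization_Bessel)
  qed simp
  have V_inner: "inner (V z) (V w) = inner z w" if "z \<in> span (range e)" for z w
    using that
  proof (induction rule: span_induct_alt)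
    case base
    show ?case by (simp add: V_0)
  next
    case (step c s z)
    then obtain j where s: "s = e j" by auto
    \<comment> \<open>A vanishing \<open>e j\<close> is no exception: then s is 0 and both sides
      vanish.\<close>
    have "coord (V s) i * coord (V w) i = (if i = j then inner s w else 0)" for i
      using orthonormalization_orthogonal[of j i] inner_orthonormalization_self[of w _ j]
      by (auto simp: V s e_def inner_commute mult.commute)
    then have "inner (V s) (V w) = inner s w"
      unfolding inner_ell2_def using sums_unique[OF sums_single[of j "\<lambda>_. inner s w"]] by simp
    then show ?case using step.IH by (simp add: V_add V_scale inner_add_left)
  qed
  define \<psi> where "\<psi> x = V (\<phi> x)" for x
  have lip: "dist (\<psi> x) (\<psi> y) \<le> dist x y" for x y
    using V_norm[of "\<phi> x - \<phi> y"] \<phi> by (simp add: \<psi>_def isometric_embedding_def dist_norm V_diff)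
  have dense: "dist (\<psi> (X m)) (\<psi> (X n)) = dist (X m) (X n)" for m n
  proof -
    have "\<phi> (X m) - \<phi> (X n) \<in> span (range e)"
      unfolding e_def using in_span_orthonormalization[of "\<lambda>n. \<phi> (X n)"] by (intro span_diff) auto
    then have "(norm (V (\<phi> (X m) - \<phi> (X n))))\<^sup>2 = (norm (\<phi> (X m) - \<phi> (X n)))\<^sup>2"
      unfolding power2_norm_eq_inner by (rule V_inner)
    then have "dist (\<psi> (X m)) (\<psi> (X n)) = dist (\<phi> (X m)) (\<phi> (X n))"
      by (simp add: \<psi>_def dist_norm V_diff)
    then show ?thesis using \<phi> by (simp add: isometric_embedding_def)
  qed
  have \<psi>_lim: "(\<lambda>n. \<psi> (a n)) \<longlonglongrightarrow> \<psi> x" if lim: "a \<longlonglongrightarrow> x" for a x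
  proof (rule metric_LIMSEQ_I)
    fix r :: real assume "0 < r"
    then obtain N where "\<And>n. n \<ge> N \<Longrightarrow> dist (a n) x < r" using metric_LIMSEQ_D[OF lim] by blast
    then have "\<And>n. n \<ge> N \<Longrightarrow> dist (\<psi> (a n)) (\<psi> x) < r" using lip by (meson le_less_trans)
    then show "\<exists>N. \<forall>n\<ge>N. dist (\<psi> (a n)) (\<psi> x) < r" by blast
  qed
  have "dist (\<psi> x) (\<psi> y) = dist x y" for x y
  proof -
    have "x \<in> closure (range X)" "y \<in> closure (range X)" using X by simp_all
    then obtain a b where ab: "\<And>n. a n \<in> range X" "a \<longlonglongrightarrow> x" "\<And>n. b n \<in> range X" "b \<longlonglongrightarrow> y"
      unfolding closure_sequential by blast
    have "dist (\<psi> (a n)) (\<psi> (b n)) = dist (a n) (b n)" for n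
      using ab(1)[of n] ab(3)[of n] dense by auto
    then have "(\<lambda>n. dist (a n) (b n)) \<longlonglongrightarrow> dist (\<psi> x) (\<psi> y)"
      using tendsto_dist[OF \<psi>_lim[OF ab(2)] \<psi>_lim[OF ab(4)]] by simp
    moreover have "(\<lambda>n. dist (a n) (b n)) \<longlonglongrightarrow> dist x y" by (rule tendsto_dist[OF ab(2,4)])
    ultimately show ?thesis by (rule LIMSEQ_unique)
  qed
  then show ?thesis by (auto simp: isometric_embedding_def)
qed

section \<open>Negative eigenvalues of the distance matrices\<close>

lemma symmetric_eigenvectors_orthogonal:
  fixes A :: "real mat"
  assumes A: "A \<in> carrier_mat n n" "A\<^sup>T = A"
    and v: "v \<in> carrier_vec n" "A *\<^sub>v v = r \<cdot>\<^sub>v v"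
    and w: "w \<in> carrier_vec n" "A *\<^sub>v w = s \<cdot>\<^sub>v w"
    and "r \<noteq> s"
  shows "scalar_prod v w = 0"
proof -
  have "r * scalar_prod v w = scalar_prod (A *\<^sub>v v) w" using v w by simp
  also have "\<dots> = scalar_prod v (A *\<^sub>v w)"
    using transpose_vec_mult_scalar[OF A(1) w(1) v(1)] A(2) by (simp add: comm_scalar_prod[of _ n] v w A)
  also have "\<dots> = s * scalar_prod v w" using v w by simp
  finally show ?thesis using \<open>r \<noteq> s\<close> by simp
qed

lemma S_mat_carrier: "S_mat xs \<in> carrier_mat (length xs) (length xs)"
  by (simp add: S_mat_def)

lemma S_mat_symmetric: "(S_mat xs)\<^sup>T = S_mat xs"
  by (rule eq_matI) (auto simp: S_mat_def dist_commute)

lemma S_mat_form: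
  assumes "v \<in> carrier_vec (length xs)"
  shows "scalar_prod v (S_mat xs *\<^sub>v v)
    = (\<Sum>i<length xs. \<Sum>j<length xs. - (1/2) * (dist (xs ! i) (xs ! j))\<^sup>2 * (v $ i * v $ j))"
proof -
  let ?n = "length xs"
  have "(S_mat xs *\<^sub>v v) $ i = (\<Sum>j<?n. - (1/2) * (dist (xs ! i) (xs ! j))\<^sup>2 * v $ j)" if "i < ?n" for i
  proof -
    have "(S_mat xs *\<^sub>v v) $ i = (\<Sum>j<?n. row (S_mat xs) i $ j * v $ j)"
      using assms that by (simp add: S_mat_def scalar_prod_def atLeast0LessThan)
    then show ?thesis using that by (simp add: S_mat_def)
  qed
  moreover have "scalar_prod v (S_mat xs *\<^sub>v v) = (\<Sum>i<?n. v $ i * (S_mat xs *\<^sub>v v) $ i)"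
    by (simp add: scalar_prod_def S_mat_def atLeast0LessThan)
  ultimately show ?thesis by (simp add: sum_distrib_left mult_ac)
qed

text \<open>When the coefficients sum to 0, the squared norms in the expanded distances drop out,
  and what remains is the squared norm of the combination of the \<open>y i\<close> with
  coefficients \<open>v $ i\<close>.\<close>

lemma S_mat_form_nonneg:
  fixes \<phi> :: "'a::metric_space \<Rightarrow> 'h::real_inner" and xs :: "'a list"
  assumes \<phi>: "isometric_embedding \<phi>" and v: "v \<in> carrier_vec (length xs)"
    and zero: "(\<Sum>i<length xs. v $ i) = 0"
  shows "0 \<le> scalar_prod v (S_mat xs *\<^sub>v v)"
proof -
  define y where "y i = \<phi> (xs ! i)" for i
  let ?n = "length xs"
  have d: "(dist (xs ! i) (xs ! j))\<^sup>2 = inner (y i) (y i) + inner (y j) (y j) - 2 * inner (y i) (y j)" for i j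
  proof -
    have "(dist (xs ! i) (xs ! j))\<^sup>2 = (norm (y i - y j))\<^sup>2"
      using \<phi> by (simp add: y_def isometric_embedding_def flip: dist_norm)
    then show ?thesis
      by (simp add: power2_norm_eq_inner inner_diff_left inner_diff_right inner_commute)
  qed
  define B where "B = (\<Sum>j<?n. inner (y j) (y j) * v $ j)"
  have row: "(\<Sum>j<?n. inner (y i) (y j) * (v $ i * v $ j)
      - ((1/2) * (inner (y i) (y i) * v $ i)) * v $ j - ((1/2) * v $ i) * (inner (y j) (y j) * v $ j))
    = (\<Sum>j<?n. inner (y i) (y j) * (v $ i * v $ j)) - ((1/2) * v $ i) * B" for i
    unfolding sum_subtractf sum_distrib_left[symmetric] zero B_def by simp
  have "scalar_prod v (S_mat xs *\<^sub>v v) = (\<Sum>i<?n. \<Sum>j<?n. inner (y i) (y j) * (v $ i * v $ j)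
      - ((1/2) * (inner (y i) (y i) * v $ i)) * v $ j - ((1/2) * v $ i) * (inner (y j) (y j) * v $ j))"
    unfolding S_mat_form[OF v] d by (intro sum.cong refl) (simp add: field_simps)
  also have "\<dots> = (\<Sum>i<?n. \<Sum>j<?n. inner (y i) (y j) * (v $ i * v $ j))"
    unfolding row sum_subtractf sum_distrib_left[symmetric] sum_distrib_right[symmetric] zero by simp
  also have "\<dots> = inner (\<Sum>i<?n. v $ i *\<^sub>R y i) (\<Sum>j<?n. v $ j *\<^sub>R y j)"
    unfolding inner_sum_left unfolding inner_sum_right by (simp add: mult_ac)
  finally show ?thesis by simp
qed

lemma char_matrix_kernel_iff:
  fixes A :: "real mat"
  assumes "A \<in> carrier_mat n n" "v \<in> carrier_vec n"
  shows "char_matrix A r *\<^sub>v v = 0\<^sub>v n \<longleftrightarrow> A *\<^sub>v v = r \<cdot>\<^sub>v v"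
proof (cases "v = 0\<^sub>v n")
  case True
  have "C *\<^sub>v 0\<^sub>v n = 0\<^sub>v n" if "C \<in> carrier_mat n n" for C :: "real mat"
    by (rule eq_vecI) (use that in \<open>auto simp: scalar_prod_def\<close>)
  moreover have "char_matrix A r \<in> carrier_mat n n" "r \<cdot>\<^sub>v 0\<^sub>v n = 0\<^sub>v n" using assms by auto
  ultimately have "char_matrix A r *\<^sub>v 0\<^sub>v n = 0\<^sub>v n" "A *\<^sub>v 0\<^sub>v n = 0\<^sub>v n" "r \<cdot>\<^sub>v 0\<^sub>v n = 0\<^sub>v n"
    using assms(1) by blast+
  then show ?thesis using True by simp
next
  case False
  then show ?thesis using eigenvector_char_matrix[OF assms(1), of v r] assms by (auto simp: eigenvector_def)
qed

lemma finite_eigenvalues: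
  assumes "(A :: real mat) \<in> carrier_mat n n"
  shows "finite {r. eigenvalue A r}"
proof -
  have "char_poly A \<noteq> 0" using degree_monic_char_poly[OF assms] by auto
  then show ?thesis using poly_roots_finite eigenvalue_root_char_poly[OF assms] by simp
qed

lemma kernel_dim_pos:
  assumes cA: "(A :: real mat) \<in> carrier_mat n n" and ev: "eigenvalue A r"
  shows "0 < kernel_dim (char_matrix A r)"
proof -
  interpret kernel n n "char_matrix A r" by unfold_locales (use cA in simp)
  obtain v where v: "v \<in> carrier_vec n" "v \<noteq> 0\<^sub>v n" "char_matrix A r *\<^sub>v v = 0\<^sub>v n"
    using ev eigenvector_char_matrix[OF cA] by (auto simp: eigenvalue_def)
  then have vk: "v \<in> mat_kernel (char_matrix A r)"
    by (intro mat_kernelI[OF A]) simp_all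
  have "dim \<noteq> 0"
  proof
    assume "dim = 0"
    obtain B where B: "finite B" "Ker.basis B" using kernel_basis_exists[OF A] by auto
    have "card B = 0" using Ker.dim_basis[OF B] \<open>dim = 0\<close> by simp
    then have "B = {}" using B by simp
    then have "mat_kernel (char_matrix A r) = Ker.span {}" using B by (auto simp: Ker.basis_def)
    then show False using vk v(2) by (simp add: Ker.span_empty)
  qed
  then show ?thesis by simp
qed

lemma kernel_dim_le_1:
  assumes cA: "(A :: real mat) \<in> carrier_mat n n" and v: "v \<in> carrier_vec n" "A *\<^sub>v v = r \<cdot>\<^sub>v v"
    and line: "\<And>w. w \<in> carrier_vec n \<Longrightarrow> A *\<^sub>v w = r \<cdot>\<^sub>v w \<Longrightarrow> \<exists>c. w = c \<cdot>\<^sub>v v"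
  shows "kernel_dim (char_matrix A r) \<le> 1"
proof -
  interpret kernel n n "char_matrix A r" by unfold_locales (use cA in simp)
  have mk: "w \<in> mat_kernel (char_matrix A r) \<longleftrightarrow> w \<in> carrier_vec n \<and> A *\<^sub>v w = r \<cdot>\<^sub>v w" for w
    using mat_kernel[OF A] char_matrix_kernel_iff[OF cA] by auto
  have vk: "v \<in> mat_kernel (char_matrix A r)" using v mk by simp
  have "Ker.span {v} = mat_kernel (char_matrix A r)"
  proof (intro equalityI subsetI)
    fix w assume "w \<in> Ker.span {v}"
    then show "w \<in> mat_kernel (char_matrix A r)" using Ker.span_closed[of "{v}"] vk by blast
  next
    fix w assume "w \<in> mat_kernel (char_matrix A r)"
    then obtain c where "w = c \<cdot>\<^sub>v v" using line mk by blast
    moreover have "c \<cdot>\<^sub>v v \<in> Ker.span {v}"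
      using submodule.smult_closed[OF Ker.span_is_submodule[of "{v}"], of c v] Ker.span_self[OF vk] vk
      by simp
    ultimately show "w \<in> Ker.span {v}" by simp
  qed
  then have "dim \<le> 1" using vk by (intro Ker.dim_le1I) auto
  then show ?thesis by simp
qed

section \<open>At most one negative eigenvalue for an embedded space\<close>

context
  fixes \<phi> :: "'a::metric_space \<Rightarrow> 'h::real_inner" and xs :: "'a list"
  assumes \<phi>: "isometric_embedding \<phi>"
begin

text \<open>The form at v is r times the squared length of v, yet it is nonnegative on the
  hyperplane of sum 0.\<close>

lemma negative_eigenvector_sum_nonzero:
  assumes v: "v \<in> carrier_vec (length xs)" "S_mat xs *\<^sub>v v = r \<cdot>\<^sub>v v" and r: "r < 0"
    and zero: "(\<Sum>i<length xs. v $ i) = 0"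
  shows "v = 0\<^sub>v (length xs)"
proof -
  have "0 \<le> r * scalar_prod v v" using S_mat_form_nonneg[OF \<phi> v(1) zero] v by simp
  moreover have "scalar_prod v v = (\<Sum>i<length xs. (v $ i)\<^sup>2)"
    using v by (simp add: scalar_prod_def atLeast0LessThan power2_eq_square)
  moreover have "0 \<le> (\<Sum>i<length xs. (v $ i)\<^sup>2)" by (intro sum_nonneg) simp
  ultimately have "(\<Sum>i<length xs. (v $ i)\<^sup>2) = 0" using r by (simp add: zero_le_mult_iff)
  then have "\<forall>i<length xs. v $ i = 0" by (simp add: sum_nonneg_eq_0_iff)
  then show ?thesis using v by (intro eq_vecI) auto
qed

text \<open>The multiple c of v is chosen so that w minus this multiple has sum 0; it still
  satisfies the eigenvalue equation, and hence vanishes. So a negative eigenvalue is simple.\<close>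

lemma negative_eigenvector_line:
  assumes v: "v \<in> carrier_vec (length xs)" "S_mat xs *\<^sub>v v = r \<cdot>\<^sub>v v" "v \<noteq> 0\<^sub>v (length xs)"
    and w: "w \<in> carrier_vec (length xs)" "S_mat xs *\<^sub>v w = r \<cdot>\<^sub>v w" and r: "r < 0"
  shows "\<exists>c. w = c \<cdot>\<^sub>v v"
proof -
  let ?n = "length xs"
  note A = S_mat_carrier[of xs]
  have sv: "(\<Sum>i<?n. v $ i) \<noteq> 0" using negative_eigenvector_sum_nonzero[OF v(1,2) r] v(3) by blast
  define c where "c = (\<Sum>i<?n. w $ i) / (\<Sum>i<?n. v $ i)"
  define z where "z = w + (- c) \<cdot>\<^sub>v v"
  have z: "z \<in> carrier_vec ?n" using v w by (simp add: z_def)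
  have "S_mat xs *\<^sub>v z = S_mat xs *\<^sub>v w + (- c) \<cdot>\<^sub>v (S_mat xs *\<^sub>v v)"
    unfolding z_def using v w A by (simp add: mult_add_distrib_mat_vec[OF A] mult_mat_vec[OF A])
  also have "\<dots> = r \<cdot>\<^sub>v z" unfolding v(2) w(2) z_def using v(1) w(1) by (intro eq_vecI) (auto simp: algebra_simps)
  finally have Az: "S_mat xs *\<^sub>v z = r \<cdot>\<^sub>v z" .
  have "(\<Sum>i<?n. z $ i) = (\<Sum>i<?n. w $ i) - c * (\<Sum>i<?n. v $ i)"
    using v w by (simp add: z_def sum_subtractf sum_distrib_left)
  then have "(\<Sum>i<?n. z $ i) = 0" using sv by (simp add: c_def)
  then have z0: "z = 0\<^sub>v ?n" by (rule negative_eigenvector_sum_nonzero[OF z Az r])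
  have "w $ i = c * v $ i" if "i < ?n" for i
    using arg_cong[OF z0, of "\<lambda>z. vec_index z i"] v w that by (simp add: z_def)
  then have "w = c \<cdot>\<^sub>v v" using v w by (intro eq_vecI) auto
  then show ?thesis ..
qed

text \<open>Eigenvectors for different eigenvalues are orthogonal, so the combination z = w - c v
  with sum 0 has form s |w|^2 + c^2 r |v|^2 < 0, against positivity on that hyperplane.\<close>

lemma negative_eigenvalue_unique:
  assumes v: "v \<in> carrier_vec (length xs)" "S_mat xs *\<^sub>v v = r \<cdot>\<^sub>v v" "v \<noteq> 0\<^sub>v (length xs)" "r < 0"
    and w: "w \<in> carrier_vec (length xs)" "S_mat xs *\<^sub>v w = s \<cdot>\<^sub>v w" "w \<noteq> 0\<^sub>v (length xs)" "s < 0"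
  shows "r = s"
proof (rule ccontr)
  assume "r \<noteq> s"
  let ?n = "length xs"
  note A = S_mat_carrier[of xs]
  have vw: "scalar_prod v w = 0" "scalar_prod w v = 0"
    using symmetric_eigenvectors_orthogonal[OF A S_mat_symmetric v(1,2) w(1,2) \<open>r \<noteq> s\<close>]
    by (simp_all add: comm_scalar_prod[OF w(1) v(1)])
  have pos: "0 < scalar_prod u u" if "u \<in> carrier_vec ?n" "u \<noteq> 0\<^sub>v ?n" for u :: "real vec"
  proof -
    have "scalar_prod u u = (\<Sum>i<?n. (u $ i)\<^sup>2)"
      using that by (simp add: scalar_prod_def atLeast0LessThan power2_eq_square)
    moreover have "\<exists>i<?n. u $ i \<noteq> 0" using that by (metis eq_vecI carrier_vecD index_zero_vec)
    then have "0 < (\<Sum>i<?n. (u $ i)\<^sup>2)" by (auto intro: sum_pos2)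
    ultimately show ?thesis by simp
  qed
  have sv: "(\<Sum>i<?n. v $ i) \<noteq> 0" using negative_eigenvector_sum_nonzero[OF v(1,2,4)] v(3) by blast
  define c where "c = (\<Sum>i<?n. w $ i) / (\<Sum>i<?n. v $ i)"
  define z where "z = w + (- c) \<cdot>\<^sub>v v"
  have z: "z \<in> carrier_vec ?n" using v w by (simp add: z_def)
  have Az: "S_mat xs *\<^sub>v z = s \<cdot>\<^sub>v w + (- c * r) \<cdot>\<^sub>v v"
    unfolding z_def using v w A by (simp add: mult_add_distrib_mat_vec[OF A] mult_mat_vec[OF A] smult_smult_assoc)
  have "(\<Sum>i<?n. z $ i) = (\<Sum>i<?n. w $ i) - c * (\<Sum>i<?n. v $ i)"
    using v w by (simp add: z_def sum_subtractf sum_distrib_left)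
  then have "(\<Sum>i<?n. z $ i) = 0" using sv by (simp add: c_def)
  then have "0 \<le> scalar_prod z (s \<cdot>\<^sub>v w + (- c * r) \<cdot>\<^sub>v v)"
    using S_mat_form_nonneg[OF \<phi> z] by (simp add: Az)
  also have "\<dots> = s * scalar_prod w w + c\<^sup>2 * r * scalar_prod v v"
    unfolding z_def using v(1) w(1) vw
    by (simp add: scalar_prod_add_distrib[of _ ?n] add_scalar_prod_distrib[of _ ?n] power2_eq_square)
  also have "\<dots> < 0"
  proof -
    have "s * scalar_prod w w < 0" using w(4) pos[OF w(1,3)] by (simp add: mult_neg_pos)
    moreover have "c\<^sup>2 * r * scalar_prod v v \<le> 0"
      using v(4) pos[OF v(1,3)] by (simp add: mult_nonneg_nonpos mult_nonpos_nonneg)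
    ultimately show ?thesis by simp
  qed
  finally show False by simp
qed

lemma s_minus_S_mat_le_1: "s_minus_mat (S_mat xs) \<le> 1"
proof (cases "\<exists>r. eigenvalue (S_mat xs) r \<and> r < 0")
  case False
  then have "{r. eigenvalue (S_mat xs) r \<and> r < 0} = {}" by auto
  then show ?thesis unfolding s_minus_mat_def by (simp only: sum.empty)
next
  case True
  have ev: "\<exists>v. v \<in> carrier_vec (length xs) \<and> v \<noteq> 0\<^sub>v (length xs) \<and> S_mat xs *\<^sub>v v = r \<cdot>\<^sub>v v"
    if "eigenvalue (S_mat xs) r" for r
    using that by (auto simp: eigenvalue_def eigenvector_def S_mat_def)
  obtain r where r: "eigenvalue (S_mat xs) r" "r < 0" using True by blast
  obtain v where v: "v \<in> carrier_vec (length xs)" "v \<noteq> 0\<^sub>v (length xs)" "S_mat xs *\<^sub>v v = r \<cdot>\<^sub>v v"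
    using ev[OF r(1)] by blast
  have unique: "s = r" if "eigenvalue (S_mat xs) s" "s < 0" for s
    using ev[OF that(1)] negative_eigenvalue_unique[OF _ _ _ that(2) v(1,3,2) r(2)] by blast
  have "{r. eigenvalue (S_mat xs) r \<and> r < 0} = {r}"
  proof (intro equalityI subsetI)
    show "s \<in> {r}" if "s \<in> {r. eigenvalue (S_mat xs) r \<and> r < 0}" for s
      using unique[of s] that by blast
  qed (use r in simp)
  moreover have "kernel_dim (char_matrix (S_mat xs) r) \<le> 1"
    by (rule kernel_dim_le_1[OF S_mat_carrier v(1,3)]) (rule negative_eigenvector_line[OF v(1,3,2) _ _ r(2)])
  ultimately show ?thesis unfolding s_minus_mat_def by simp
qed

end

lemma s_minus_S_mat_pair:
  fixes x y :: "'a::metric_space"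
  assumes "x \<noteq> y"
  shows "1 \<le> s_minus_mat (S_mat [x, y])"
proof -
  \<comment> \<open>For two points the matrix has zero diagonal and two equal off-diagonal entries,
    so the all-ones vector is an eigenvector for that entry.\<close>
  let ?A = "S_mat [x, y]" and ?r = "- (1/2) * (dist x y)\<^sup>2" and ?v = "Matrix.vec 2 (\<lambda>_. 1 :: real)"
  have A: "?A \<in> carrier_mat 2 2" using S_mat_carrier[of "[x, y]"] by (simp add: numeral_2_eq_2)
  have "?A *\<^sub>v ?v = ?r \<cdot>\<^sub>v ?v"
  proof (rule eq_vecI)
    fix i assume "i < dim_vec (?r \<cdot>\<^sub>v ?v)"
    then have "i = 0 \<or> i = 1" by auto
    then show "(?A *\<^sub>v ?v) $ i = (?r \<cdot>\<^sub>v ?v) $ i"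
      by (auto simp: S_mat_def scalar_prod_def dist_commute numeral_2_eq_2)
  qed (simp add: S_mat_def)
  moreover have "?v \<noteq> 0\<^sub>v 2"
  proof
    assume "?v = 0\<^sub>v 2"
    from arg_cong[OF this, of "\<lambda>v. vec_index v 0"] show False by simp
  qed
  ultimately have "eigenvector ?A ?v ?r" using A by (simp add: eigenvector_def)
  then have ev: "eigenvalue ?A ?r" by (auto simp: eigenvalue_def)
  \<comment> \<open>Finiteness matters, because a sum over an infinite set of eigenvalues would be 0
    by convention.\<close>
  have fin: "finite {r. eigenvalue ?A r \<and> r < 0}"
    using finite_eigenvalues[OF A] by (rule rev_finite_subset) auto
  have "kernel_dim (char_matrix ?A ?r) \<le> s_minus_mat ?A"
    unfolding s_minus_mat_def using ev assms by (intro member_le_sum fin) auto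
  then show ?thesis using kernel_dim_pos[OF A ev] by linarith
qed

text \<open>Two distinct points are indispensable: on a one-point space the matrices are empty or
  zero, and the supremum is 0.\<close>

lemma s_minus_space_eq_1:
  fixes \<phi> :: "'a::metric_space \<Rightarrow> 'h::real_inner" and x y :: 'a
  assumes "isometric_embedding \<phi>" "x \<noteq> y"
  shows "s_minus_space TYPE('a) = 1"
  unfolding s_minus_space_def
proof (rule antisym)
  show "(SUP xs\<in>{xs :: 'a list. distinct xs}. enat (s_minus_mat (S_mat xs))) \<le> 1"
    using s_minus_S_mat_le_1[OF assms(1)] by (intro SUP_least) (simp add: one_enat_def)
  have "1 \<le> enat (s_minus_mat (S_mat [x, y]))"
    using s_minus_S_mat_pair[OF assms(2)] by (simp add: one_enat_def)
  also have "\<dots> \<le> (SUP xs\<in>{xs :: 'a list. distinct xs}. enat (s_minus_mat (S_mat xs)))"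
    using assms(2) by (intro SUP_upper) simp
  finally show "1 \<le> (SUP xs\<in>{xs :: 'a list. distinct xs}. enat (s_minus_mat (S_mat xs)))" .
qed

section \<open>The equivalence\<close>

text \<open>Types cannot be quantified inside a formula. The first conjunct therefore lets
  \<open>'h\<close> be any Hilbert space and reduces embeddability to \<open>ell2\<close>, itself a
  Hilbert space, which then represents (i).\<close>

theorem proposition5p1:
  assumes "separable_space (euclidean :: 'a::metric_space topology)"
  shows
    "((\<exists>\<phi> :: 'a \<Rightarrow> 'h::{real_inner, complete_space}. isometric_embedding \<phi>) \<longrightarrow>
        (\<exists>\<phi> :: 'a \<Rightarrow> ell2. isometric_embedding \<phi>)) \<and>
     ((\<exists>\<phi> :: 'a \<Rightarrow> ell2. isometric_embedding \<phi>) \<longleftrightarrow>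
        (\<exists>\<mu> :: 'a measure. borel_prob \<mu> \<and> full_support \<mu> \<and> finite_fourth_moment \<mu> \<and>
            s_minus_T \<mu> = 0)) \<and>
     ((\<exists>\<phi> :: 'a \<Rightarrow> ell2. isometric_embedding \<phi>) \<longleftrightarrow>
        (\<forall>\<mu> :: 'a measure. borel_prob \<mu> \<longrightarrow> s_minus_T \<mu> = 0)) \<and>
     (\<forall>\<mu> :: 'a measure. borel_prob \<mu> \<and> full_support \<mu> \<and> finite_fourth_moment \<mu> \<longrightarrow>
        (s_minus_T \<mu> = 0 \<longleftrightarrow> positive_semidefinite_op \<mu> (T_dom \<mu>) (T_op \<mu>))) \<and>
     (\<forall>\<mu> :: 'a measure. borel_prob \<mu> \<and> full_support \<mu> \<and> finite_fourth_moment \<mu> \<and>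
        s_minus_T \<mu> = 0 \<longrightarrow>
          (\<exists>N l u. pos_eigensystem \<mu> N l u) \<and>
          (\<forall>N l u. pos_eigensystem \<mu> N l u \<longrightarrow>
             (\<exists>f :: 'a \<Rightarrow> ell2. isometric_embedding f \<and> (\<forall>x. coord (f x) = eigenmap N l u x)))) \<and>
     ((\<exists>x y :: 'a. x \<noteq> y) \<and> (\<exists>\<phi> :: 'a \<Rightarrow> ell2. isometric_embedding \<phi>) \<longrightarrow>
        s_minus_space TYPE('a) = 1)"
proof -
  have moment: "\<exists>x\<^sub>0. fourth_moment \<mu> x\<^sub>0"
    if \<mu>: "borel_prob \<mu>" "finite_fourth_moment \<mu>" for \<mu> :: "'a measure"
  proof -
    obtain x\<^sub>0 where "(\<lambda>x. 1 + (dist x\<^sub>0 x)\<^sup>2) \<in> L2 \<mu>" by (rule finite_fourth_momentE[OF \<mu>])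
    then have "fourth_moment \<mu> x\<^sub>0"
      using \<mu>(1) assms by (simp add: fourth_moment_def fourth_moment_axioms_def borel_prob_def)
    then show ?thesis ..
  qed
  have eigensystem: "\<exists>N l u. pos_eigensystem \<mu> N l u"
    and embedding: "\<And>N l u. pos_eigensystem \<mu> N l u \<Longrightarrow>
      \<exists>f :: 'a \<Rightarrow> ell2. isometric_embedding f \<and> (\<forall>x. coord (f x) = eigenmap N l u x)"
    if \<mu>: "borel_prob \<mu>" "full_support \<mu>" "finite_fourth_moment \<mu>" "s_minus_T \<mu> = 0"
    for \<mu> :: "'a measure"
  proof -
    obtain x\<^sub>0 where "fourth_moment \<mu> x\<^sub>0" using moment[OF \<mu>(1,3)] ..
    then interpret fourth_moment \<mu> x\<^sub>0 .
    show "\<exists>N l u. pos_eigensystem \<mu> N l u" by (rule exists_pos_eigensystem[OF \<mu>(2,4)])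
    show "\<exists>f :: 'a \<Rightarrow> ell2. isometric_embedding f \<and> (\<forall>x. coord (f x) = eigenmap N l u x)"
      if "pos_eigensystem \<mu> N l u" for N l u
      by (rule pos_eigensystem_embedding[OF \<mu>(2,4) that])
  qed
  have from_ii: "\<exists>\<phi> :: 'a \<Rightarrow> ell2. isometric_embedding \<phi>"
    if "borel_prob \<mu>" "full_support \<mu>" "finite_fourth_moment \<mu>" "s_minus_T \<mu> = 0"
    for \<mu> :: "'a measure"
    using eigensystem[OF that] embedding[OF that] by blast
  have to_iii: "s_minus_T \<mu> = 0" if "\<exists>\<phi> :: 'a \<Rightarrow> ell2. isometric_embedding \<phi>" "borel_prob \<mu>"
    for \<mu> :: "'a measure"
    using that ell2_embedding_imp_s_minus_T by blast
  \<comment> \<open>One measure serves two directions: it is the witness for (ii) when an embedding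
    is given, and the instance of (iii) from which an embedding is recovered.\<close>
  obtain \<mu>\<^sub>0 :: "'a measure"
    where \<mu>\<^sub>0: "borel_prob \<mu>\<^sub>0 \<and> full_support \<mu>\<^sub>0 \<and> finite_fourth_moment \<mu>\<^sub>0"
    using exists_full_support_measure[OF assms] ..
  have psd: "s_minus_T \<mu> = 0 \<longleftrightarrow> positive_semidefinite_op \<mu> (T_dom \<mu>) (T_op \<mu>)"
    if "borel_prob \<mu>" "finite_fourth_moment \<mu>" for \<mu> :: "'a measure"
    using moment[OF that] fourth_moment.s_minus_T_eq_0_iff by blast
  have hilbert: "\<exists>\<phi> :: 'a \<Rightarrow> ell2. isometric_embedding \<phi>"
    if "\<exists>\<phi> :: 'a \<Rightarrow> 'h. isometric_embedding \<phi>"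
    using that inner_space_embedding_imp_ell2_embedding[OF assms] by blast
  have signature: "s_minus_space TYPE('a) = 1"
    if "\<exists>x y :: 'a. x \<noteq> y" "\<exists>\<phi> :: 'a \<Rightarrow> ell2. isometric_embedding \<phi>"
    using that s_minus_space_eq_1 by blast
  show ?thesis
  proof (intro conjI)
    show "(\<exists>\<phi> :: 'a \<Rightarrow> 'h. isometric_embedding \<phi>) \<longrightarrow> (\<exists>\<phi> :: 'a \<Rightarrow> ell2. isometric_embedding \<phi>)"
      using hilbert by blast
    show "(\<exists>\<phi> :: 'a \<Rightarrow> ell2. isometric_embedding \<phi>) \<longleftrightarrow>
        (\<exists>\<mu> :: 'a measure. borel_prob \<mu> \<and> full_support \<mu> \<and> finite_fourth_moment \<mu> \<and> s_minus_T \<mu> = 0)"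
      using \<mu>\<^sub>0 to_iii from_ii by blast
    show "(\<exists>\<phi> :: 'a \<Rightarrow> ell2. isometric_embedding \<phi>) \<longleftrightarrow>
        (\<forall>\<mu> :: 'a measure. borel_prob \<mu> \<longrightarrow> s_minus_T \<mu> = 0)"
      using \<mu>\<^sub>0 to_iii from_ii by blast
    show "\<forall>\<mu> :: 'a measure. borel_prob \<mu> \<and> full_support \<mu> \<and> finite_fourth_moment \<mu> \<longrightarrow>
        (s_minus_T \<mu> = 0 \<longleftrightarrow> positive_semidefinite_op \<mu> (T_dom \<mu>) (T_op \<mu>))"
      using psd by blast
    show "\<forall>\<mu> :: 'a measure. borel_prob \<mu> \<and> full_support \<mu> \<and> finite_fourth_moment \<mu> \<and> s_minus_T \<mu> = 0 \<longrightarrow>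
        (\<exists>N l u. pos_eigensystem \<mu> N l u) \<and>
        (\<forall>N l u. pos_eigensystem \<mu> N l u \<longrightarrow>
          (\<exists>f :: 'a \<Rightarrow> ell2. isometric_embedding f \<and> (\<forall>x. coord (f x) = eigenmap N l u x)))"
      using eigensystem embedding by blast
    show "(\<exists>x y :: 'a. x \<noteq> y) \<and> (\<exists>\<phi> :: 'a \<Rightarrow> ell2. isometric_embedding \<phi>) \<longrightarrow>
        s_minus_space TYPE('a) = 1"
      using signature by blast
  qed
qed

end
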